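(* Let $\sigma\in S^0(\mathbb{Z}^n\times\mathbb{T}^n)$ and define $$d:=\limsup_{|k|\to\infty}\ \sup_{x\in\mathbb{T}^n}|\sigma(k,x)|.$$ Then $\mathrm{Op}(\sigma)$ is compact on $\ell^2(\mathbb{Z}^n)$ if and only if $d=0$. Moreover, $$\Sigma_{ess}(\mathrm{Op}(\sigma))\subset\{\lambda\in\mathbb{C}:|\lambda|\le d\}.$$
   Context: $\mathbb{T}^n=\mathbb{R}^n/\mathbb{Z}^n$ with normalised Lebesgue measure. $\widehat f(x)=\sum_{k\in\mathbb{Z}^n}e^{-2\pi i k\cdot x}f(k)$ and $\mathrm{Op}(\sigma)f(k)=\int_{\mathbb{T}^n}e^{2\pi i k\cdot x}\sigma(k,x)\widehat f(x)\,dx$. $\Delta^\alpha=\Delta_1^{\alpha_1}\cdots\Delta_n^{\alpha_n}$ with $\Delta_j\tau(k)=\tau(k+v_j)-\tau(k)$, $v_j$ the $j$-th standard unit vector; $D_x^{(\alpha)}=D_{x_1}^{(\alpha_1)}\cdots D_{x_n}^{(\alpha_n)}$ with $D_{x_j}^{(0)}=I$, $D_{x_j}^{(\ell)}=\prod_{m=0}^{\ell-1}\big(\frac{1}{2\pi i}\frac{\partial}{\partial x_j}-m\big)$ for $\ell\ge1$. The class $S^0(\mathbb{Z}^n\times\mathbb{T}^n)=S^0_{1,0}(\mathbb{Z}^n\times\mathbb{T}^n)$ consists of $\sigma:\mathbb{Z}^n\times\mathbb{T}^n\to\mathbb{C}$ with $\sigma(k,\cdot)\in C^\infty(\mathbb{T}^n)$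 for all $k$ and, for all multi-indices $\alpha,\beta$, $|D_x^{(\beta)}\Delta_k^\alpha\sigma(k,x)|\le C_{\alpha,\beta}(1+|k|)^{-|\alpha|}$ for all $(k,x)$. (For such $\sigma$, $\mathrm{Op}(\sigma)$ extends to a bounded operator on $\ell^2(\mathbb{Z}^n)$.) The essential spectrum of a closed linear operator $A$ on a complex Hilbert space is $\Sigma_{ess}(A)=\mathbb{C}\setminus\{\lambda\in\mathbb{C}: A-\lambda I\text{ is Fredholm and its index is }0\}$. *)

theory Defs
  imports "HOL-Analysis.Analysis"
begin

section \<open>The complex Hilbert space of square-summable families\<close>

typedef 'a ell2 = "{f :: 'a \<Rightarrow> complex. (\<lambda>k. (cmod (f k))\<^sup>2) summable_on UNIV}"
  morphisms ell2_coeff Abs_ell2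
  by (rule exI[of _ "\<lambda>_. 0"]) simp

setup_lifting type_definition_ell2

lemma square_summable_add:
  assumes "(\<lambda>k. (cmod (f k))\<^sup>2) summable_on A" and "(\<lambda>k. (cmod (g k))\<^sup>2) summable_on A"
  shows "(\<lambda>k. (cmod (f k + g k))\<^sup>2) summable_on A"
proof (rule summable_on_comparison_test)
  show "(\<lambda>k. 2 * (cmod (f k))\<^sup>2 + 2 * (cmod (g k))\<^sup>2) summable_on A"
    using assms by (intro summable_on_add summable_on_cmult_right)
  show "(cmod (f k + g k))\<^sup>2 \<le> 2 * (cmod (f k))\<^sup>2 + 2 * (cmod (g k))\<^sup>2" for k
  proof -
    have "(cmod (f k + g k))\<^sup>2 \<le> (cmod (f k) + cmod (g k))\<^sup>2"
      by (intro power_mono norm_triangle_ineq) auto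
    also have "\<dots> \<le> 2 * (cmod (f k))\<^sup>2 + 2 * (cmod (g k))\<^sup>2"
      using sum_squares_bound[of "cmod (f k)" "cmod (g k)"]
      by (simp add: power2_sum)
    finally show ?thesis .
  qed
qed auto

lemma square_summable_mult:
  assumes "(\<lambda>k. (cmod (f k))\<^sup>2) summable_on A"
  shows "(\<lambda>k. (cmod (c * f k))\<^sup>2) summable_on A"
  using summable_on_cmult_right[OF assms, of "(cmod c)\<^sup>2"]
  by (simp add: norm_mult power_mult_distrib)

lemma square_summable_inner:
  assumes "(\<lambda>k. (cmod (f k))\<^sup>2) summable_on A" and "(\<lambda>k. (cmod (g k))\<^sup>2) summable_on A"
  shows "(\<lambda>k. f k \<bullet> g k) summable_on A"
proof -
  have "(\<lambda>k. ((cmod (f k + g k))\<^sup>2 + (- (cmod (f k))\<^sup>2 + - (cmod (g k))\<^sup>2)) * (1/2)) summable_on A"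
    using assms by (intro summable_on_cmult_left summable_on_add square_summable_add)
      (simp_all add: summable_on_uminus)
  then show ?thesis
    by (rule summable_on_cong[THEN iffD1, rotated])
      (simp only: dot_norm, simp)
qed

text \<open>The inner product of the class \<open>real_inner\<close> is the real part of the complex one; both induce
  the same norm. The complex vector space structure is the interpretation below.\<close>

instantiation ell2 :: (type) real_inner
begin

lift_definition zero_ell2 :: "'a ell2" is "\<lambda>_. 0" by simp
lift_definition plus_ell2 :: "'a ell2 \<Rightarrow> 'a ell2 \<Rightarrow> 'a ell2" is "\<lambda>f g k. f k + g k"
  by (rule square_summable_add)
lift_definition uminus_ell2 :: "'a ell2 \<Rightarrow> 'a ell2" is "\<lambda>f k. - f k" by simp
lift_definition minus_ell2 :: "'a ell2 \<Rightarrow> 'a ell2 \<Rightarrow> 'a ell2" is "\<lambda>f g k. f k - g k"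
  subgoal for f g using square_summable_add[of f UNIV "\<lambda>k. - g k"] by simp
  done
lift_definition scaleR_ell2 :: "real \<Rightarrow> 'a ell2 \<Rightarrow> 'a ell2" is "\<lambda>r f k. complex_of_real r * f k"
  by (rule square_summable_mult)
lift_definition inner_ell2 :: "'a ell2 \<Rightarrow> 'a ell2 \<Rightarrow> real" is "\<lambda>f g. \<Sum>\<^sub>\<infinity>k. f k \<bullet> g k" .
lift_definition norm_ell2 :: "'a ell2 \<Rightarrow> real" is "\<lambda>f. sqrt (\<Sum>\<^sub>\<infinity>k. (cmod (f k))\<^sup>2)" .

definition dist_ell2 :: "'a ell2 \<Rightarrow> 'a ell2 \<Rightarrow> real" where
  "dist_ell2 f g = norm (f - g)"
definition sgn_ell2 :: "'a ell2 \<Rightarrow> 'a ell2" where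
  "sgn_ell2 f = scaleR (inverse (norm f)) f"
definition uniformity_ell2 :: "('a ell2 \<times> 'a ell2) filter" where
  "uniformity_ell2 = (INF e\<in>{0<..}. principal {(f, g). dist f g < e})"
definition open_ell2 :: "'a ell2 set \<Rightarrow> bool" where
  "open_ell2 U \<longleftrightarrow> (\<forall>f\<in>U. eventually (\<lambda>(f', g). f' = f \<longrightarrow> g \<in> U) uniformity)"

instance
proof
  fix f g h :: "'a ell2" and r s :: real
  show "f + g + h = f + (g + h)" by transfer (simp add: add.assoc)
  show "f + g = g + f" by transfer (simp add: add.commute)
  show "0 + f = f" by transfer simp
  show "- f + f = 0" by transfer simp
  show "f - g = f + - g" by transfer simp
  show "r *\<^sub>R (f + g) = r *\<^sub>R f + r *\<^sub>R g" by transfer (simp add: algebra_simps)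
  show "(r + s) *\<^sub>R f = r *\<^sub>R f + s *\<^sub>R f" by transfer (simp add: algebra_simps)
  show "r *\<^sub>R s *\<^sub>R f = (r * s) *\<^sub>R f" by transfer (simp add: algebra_simps)
  show "1 *\<^sub>R f = f" by transfer simp
  show "dist f g = norm (f - g)" by (rule dist_ell2_def)
  show "sgn f = inverse (norm f) *\<^sub>R f" by (rule sgn_ell2_def)
  show "uniformity = (INF e\<in>{0<..}. principal {(f :: 'a ell2, g). dist f g < e})"
    by (rule uniformity_ell2_def)
  show "open U \<longleftrightarrow> (\<forall>f\<in>U. eventually (\<lambda>(f', g). f' = f \<longrightarrow> g \<in> U) uniformity)"
    for U :: "'a ell2 set" by (rule open_ell2_def)
  show "inner f g = inner g f" by transfer (simp add: inner_commute)
  show "inner (f + g) h = inner f h + inner g h"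
    by transfer (simp add: inner_add_left infsum_add square_summable_inner)
  show "inner (r *\<^sub>R f) g = r * inner f g"
  proof transfer
    fix r :: real and f g :: "'a \<Rightarrow> complex"
    have "(complex_of_real r * f k) \<bullet> g k = r * (f k \<bullet> g k)" for k
      by (simp add: inner_complex_def algebra_simps)
    then show "(\<Sum>\<^sub>\<infinity>k. (complex_of_real r * f k) \<bullet> g k) = r * (\<Sum>\<^sub>\<infinity>k. f k \<bullet> g k)"
      by (simp add: infsum_cmult_right')
  qed
  show "0 \<le> inner f f" by transfer (simp add: infsum_nonneg)
  show "inner f f = 0 \<longleftrightarrow> f = 0"
  proof transfer
    fix f :: "'a \<Rightarrow> complex"
    assume f: "(\<lambda>k. (cmod (f k))\<^sup>2) summable_on UNIV"
    have "f = (\<lambda>_. 0)" if 0: "(\<Sum>\<^sub>\<infinity>k. f k \<bullet> f k) = 0"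
    proof
      fix k
      have "f k \<bullet> f k = 0"
        by (rule nonneg_infsum_le_0D[of _ UNIV])
          (use 0 square_summable_inner[OF f f] in \<open>simp_all only: inner_ge_zero order_refl UNIV_I\<close>)
      then show "f k = 0" by (simp only: inner_eq_zero_iff)
    qed
    then show "(\<Sum>\<^sub>\<infinity>k. f k \<bullet> f k) = 0 \<longleftrightarrow> f = (\<lambda>_. 0)" by auto
  qed
  show "norm f = sqrt (inner f f)"
    by transfer (simp only: power2_norm_eq_inner)
qed

end

lift_definition scaleC_ell2 :: "complex \<Rightarrow> 'a ell2 \<Rightarrow> 'a ell2" (infixr "*\<^sub>C" 75)
  is "\<lambda>c f k. c * f k"
  by (rule square_summable_mult)

global_interpretation ell2: vector_space "scaleC_ell2 :: complex \<Rightarrow> 'a ell2 \<Rightarrow> 'a ell2"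
  by unfold_locales (transfer; simp add: algebra_simps)+

section \<open>Compact operators, Fredholm operators, essential spectrum\<close>

definition bounded_clinear :: "('a ell2 \<Rightarrow> 'a ell2) \<Rightarrow> bool" where
  "bounded_clinear A \<longleftrightarrow> bounded_linear A \<and> (\<forall>c f. A (c *\<^sub>C f) = c *\<^sub>C A f)"

definition compact_operator :: "('a ell2 \<Rightarrow> 'a ell2) \<Rightarrow> bool" where
  "compact_operator A \<longleftrightarrow>
     bounded_clinear A \<and> (\<forall>S. bounded S \<longrightarrow> compact (closure (A ` S)))"

definition kernel :: "('a ell2 \<Rightarrow> 'a ell2) \<Rightarrow> 'a ell2 set" where
  "kernel A = {f. A f = 0}"

definition finite_dim :: "'a ell2 set \<Rightarrow> bool" where
  "finite_dim V \<longleftrightarrow> (\<exists>B. finite B \<and> V \<subseteq> ell2.span B)"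

text \<open>The classes modulo a subspace \<open>V\<close> of the elements of \<open>B\<close> span the quotient space by \<open>V\<close>
  iff \<open>V \<union> B\<close> spans the whole space, so the quotient has dimension \<open>codim V\<close> whenever it is
  finite-dimensional.\<close>

definition finite_codim :: "'a ell2 set \<Rightarrow> bool" where
  "finite_codim V \<longleftrightarrow> (\<exists>B. finite B \<and> ell2.span (V \<union> B) = UNIV)"

definition codim :: "'a ell2 set \<Rightarrow> nat" where
  "codim V = (LEAST m. \<exists>B. finite B \<and> card B = m \<and> ell2.span (V \<union> B) = UNIV)"

definition fredholm :: "('a ell2 \<Rightarrow> 'a ell2) \<Rightarrow> bool" where
  "fredholm A \<longleftrightarrow>
     bounded_clinear A \<and> closed (range A) \<and> finite_dim (kernel A) \<and> finite_codim (range A)"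

definition fredholm_index :: "('a ell2 \<Rightarrow> 'a ell2) \<Rightarrow> int" where
  "fredholm_index A = int (ell2.dim (kernel A)) - int (codim (range A))"

definition essential_spectrum :: "('a ell2 \<Rightarrow> 'a ell2) \<Rightarrow> complex set" where
  "essential_spectrum A =
     - {z. fredholm (\<lambda>f. A f - z *\<^sub>C f) \<and> fredholm_index (\<lambda>f. A f - z *\<^sub>C f) = 0}"

section \<open>Symbols on the lattice times the torus\<close>

text \<open>Functions on the torus are \<open>\<int>\<^sup>n\<close>-periodic functions on \<open>real ^ 'n\<close>, where \<open>n\<close> is
  \<open>CARD('n)\<close>; integrals over the torus are integrals over the unit cube.\<close>

definition of_lattice :: "int ^ 'n \<Rightarrow> real ^ 'n" where
  "of_lattice k = (\<chi> j. of_int (k $ j))"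

definition torus_fun :: "(real ^ 'n \<Rightarrow> complex) \<Rightarrow> bool" where
  "torus_fun g \<longleftrightarrow> (\<forall>x m. g (x + of_lattice m) = g x)"

definition partial :: "'n \<Rightarrow> (real ^ 'n \<Rightarrow> complex) \<Rightarrow> real ^ 'n \<Rightarrow> complex" where
  "partial j g x = vector_derivative (\<lambda>t. g (x + t *\<^sub>R axis j 1)) (at 0)"

primrec C_k :: "nat \<Rightarrow> (real ^ 'n \<Rightarrow> complex) \<Rightarrow> bool" where
  "C_k 0 g \<longleftrightarrow> continuous_on UNIV g"
| "C_k (Suc r) g \<longleftrightarrow> continuous_on UNIV g \<and>
     (\<forall>j. (\<forall>x. (\<lambda>t. g (x + t *\<^sub>R axis j 1)) differentiable (at 0)) \<and> C_k r (partial j g))"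

definition smooth_torus :: "(real ^ 'n \<Rightarrow> complex) \<Rightarrow> bool" where
  "smooth_torus g \<longleftrightarrow> torus_fun g \<and> (\<forall>r. C_k r g)"

text \<open>The order in which the coordinates are enumerated does not matter: the operators composed
  along the enumeration below commute (those in \<open>x\<close> on smooth functions).\<close>

definition coordinates :: "'n::finite list" where
  "coordinates = (SOME js. distinct js \<and> set js = UNIV)"

definition diff_op :: "'n \<Rightarrow> (int ^ 'n \<Rightarrow> complex) \<Rightarrow> int ^ 'n \<Rightarrow> complex" where
  "diff_op j \<tau> k = \<tau> (k + axis j 1) - \<tau> k"

definition diff_multi :: "('n \<Rightarrow> nat) \<Rightarrow> (int ^ 'n::finite \<Rightarrow> complex) \<Rightarrow> int ^ 'n \<Rightarrow> complex" where
  "diff_multi \<alpha> = foldr (\<lambda>j. diff_op j ^^ \<alpha> j) coordinates"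

primrec D_op :: "'n \<Rightarrow> nat \<Rightarrow> (real ^ 'n \<Rightarrow> complex) \<Rightarrow> real ^ 'n \<Rightarrow> complex" where
  "D_op j 0 g = g"
| "D_op j (Suc l) g =
     (\<lambda>x. 1 / (2 * pi * \<i>) * partial j (D_op j l g) x - of_nat l * D_op j l g x)"

definition D_multi :: "('n \<Rightarrow> nat) \<Rightarrow> (real ^ 'n::finite \<Rightarrow> complex) \<Rightarrow> real ^ 'n \<Rightarrow> complex" where
  "D_multi \<beta> = foldr (\<lambda>j. D_op j (\<beta> j)) coordinates"

definition S0 :: "(int ^ 'n::finite \<Rightarrow> real ^ 'n \<Rightarrow> complex) set" where
  "S0 = {\<sigma>. (\<forall>k. smooth_torus (\<sigma> k)) \<and>
     (\<forall>\<alpha> \<beta>. \<exists>C. \<forall>k x.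
        cmod (D_multi \<beta> (\<lambda>y. diff_multi \<alpha> (\<lambda>m. \<sigma> m y) k) x)
          \<le> C * (1 + norm (of_lattice k)) powr (- real (\<Sum>j\<in>UNIV. \<alpha> j)))}"

section \<open>Pseudo-differential operators on the lattice\<close>

definition fourier :: "(int ^ 'n::finite \<Rightarrow> complex) \<Rightarrow> real ^ 'n \<Rightarrow> complex" where
  "fourier f x = (\<Sum>\<^sub>\<infinity>k. exp (- 2 * pi * \<i> * (of_lattice k \<bullet> x)) * f k)"

definition Op_formula ::
  "(int ^ 'n::finite \<Rightarrow> real ^ 'n \<Rightarrow> complex) \<Rightarrow> (int ^ 'n \<Rightarrow> complex) \<Rightarrow> int ^ 'n \<Rightarrow> complex"
where
  "Op_formula \<sigma> f k =
     (LINT x:cbox 0 1|lborel. exp (2 * pi * \<i> * (of_lattice k \<bullet> x)) * \<sigma> k x * fourier f x)"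

text \<open>The bounded extension to the whole space; it is unique because the finitely supported
  families are dense.\<close>

definition Op :: "(int ^ 'n::finite \<Rightarrow> real ^ 'n \<Rightarrow> complex) \<Rightarrow> (int ^ 'n) ell2 \<Rightarrow> (int ^ 'n) ell2"
where
  "Op \<sigma> = (THE A. bounded_clinear A \<and>
     (\<forall>f. finite {k. ell2_coeff f k \<noteq> 0} \<longrightarrow>
        ell2_coeff (A f) = Op_formula \<sigma> (ell2_coeff f)))"

definition limsup_symbol :: "(int ^ 'n::finite \<Rightarrow> real ^ 'n \<Rightarrow> complex) \<Rightarrow> ereal" where
  "limsup_symbol \<sigma> =
     Limsup (filtercomap (\<lambda>k. norm (of_lattice k)) at_top) (\<lambda>k. SUP x. ereal (cmod (\<sigma> k x)))"

end

theory Submission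
  imports Defs
begin

text \<open>With \<open>a(k, l)\<close> the \<open>l\<close>-th Fourier coefficient of \<open>\<sigma>(k, \<cdot>)\<close>, the operator has the matrix
  \<open>a(k, m - k)\<close>. The bounds in \<open>x\<close> make \<open>a\<close> summable in \<open>l\<close> uniformly in \<open>k\<close>, and the bound on
  \<open>\<Delta>\<^sub>k \<sigma>\<close> makes it slowly varying in \<open>k\<close>. On a large cube far out the operator is therefore close to
  the convolution operator with a frozen symbol \<open>\<sigma>(p, \<cdot>)\<close>, whose norm is at most \<open>sup \<bar>\<sigma>(p, \<cdot>)\<bar>\<close> by
  Bessel's inequality. Averaging over all translates of the cube gives \<open>\<parallel>Op(\<sigma>) f\<parallel> \<le> (d + \<epsilon>) \<parallel>f\<parallel>\<close> for
  all \<open>f\<close> vanishing on a finite set. Hence \<open>Op(\<sigma>)\<close> is, up to a finite-rank operator, of norm at most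
  \<open>d + \<epsilon>\<close>: for \<open>d = 0\<close> it is compact, and for \<open>\<bar>\<lambda>\<bar> > d\<close> the operator \<open>Op(\<sigma>) - \<lambda>\<close> is invertible plus
  finite rank, thus Fredholm of index 0. Conversely, if \<open>Op(\<sigma>)\<close> is compact, every diagonal
  \<open>a(\<cdot>, l)\<close> tends to 0, and \<open>sup \<bar>\<sigma>(k, \<cdot>)\<bar> \<le> \<Sum>\<^sub>l \<bar>a(k, l)\<bar>\<close> gives \<open>d = 0\<close>.\<close>

section \<open>Square-summable families\<close>

text \<open>The obstacle is the sharp constant. Adding up the diagonals bounds the operator by
  \<open>\<Sum>\<close> of the moduli of the coefficients, which may exceed the supremum of the
  symbol and so cannot give the radius \<open>d\<close>; only a frozen symbol sees the supremum.
  Freezing inside a window \<open>p + Q\<close> has two costs: cutting off at the edge of the window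
  and replacing \<open>k\<close> by \<open>p\<close>. Neither is small uniformly in all frequencies,
  so finitely many diagonals are treated this way, and the rest by the uniform summability. All
  translates are used instead of a tiling because every lattice point then lies in exactly
  \<open>card Q\<close> windows, and no constant from seams or overlaps survives. Requiring
  \<open>f\<close> to vanish on a finite set switches off precisely the windows where freezing
  fails. In the converse direction the crude sum of coefficients suffices, since only convergence to
  0 is at stake. The index needs linear algebra alone; topology enters only through the closedness
  of the range.\<close>

lemmas ell2_coeff_simps [simp] = zero_ell2.rep_eq plus_ell2.rep_eq uminus_ell2.rep_eq
  minus_ell2.rep_eq scaleR_ell2.rep_eq scaleC_ell2.rep_eq

lemma ell2_eqI: "(\<And>k. ell2_coeff f k = ell2_coeff g k) \<Longrightarrow> f = g"
  by (metis ell2_coeff_inject ext)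

lemma ell2_coeff_sum [simp]: "ell2_coeff (sum f A) k = (\<Sum>i\<in>A. ell2_coeff (f i) k)"
  by (induction A rule: infinite_finite_induct) auto

lemma ell2_summable: "(\<lambda>k. (cmod (ell2_coeff f k))\<^sup>2) summable_on A"
  by (rule summable_on_subset_banach[of _ UNIV]) (use ell2_coeff[of f] in auto)

lemma norm_ell2_sq: "(norm f)\<^sup>2 = (\<Sum>\<^sub>\<infinity>k. (cmod (ell2_coeff f k))\<^sup>2)"
  by transfer (simp add: infsum_nonneg)

lemma ell2_sum_le_norm:
  assumes "finite F"
  shows "(\<Sum>k\<in>F. (cmod (ell2_coeff f k))\<^sup>2) \<le> (norm f)\<^sup>2"
  unfolding norm_ell2_sq by (rule finite_sum_le_infsum[OF ell2_summable assms]) auto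

lemma ell2_coeff_le_norm: "cmod (ell2_coeff f k) \<le> norm f"
  using ell2_sum_le_norm[of "{k}" f] by (simp add: power2_le_iff_abs_le)

text \<open>Norm estimates are reduced to finite partial sums, so that all later inequalities can be
  proved for finite sets of rows.\<close>

lemma ell2_norm_leI:
  assumes "C \<ge> 0" "\<And>F. finite F \<Longrightarrow> (\<Sum>k\<in>F. (cmod (ell2_coeff f k))\<^sup>2) \<le> C\<^sup>2"
  shows "norm f \<le> C"
proof -
  have "(norm f)\<^sup>2 \<le> C\<^sup>2"
    unfolding norm_ell2_sq by (rule infsum_le_finite_sums[OF ell2_summable]) (use assms in auto)
  then show ?thesis using assms(1) by (rule power2_le_imp_le)
qed

text \<open>Bounded finite sums certify membership in the type. This is how limits and matrix
  products are recognised as elements of the space.\<close>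

lemma ell2_coeff_Abs:
  assumes "\<And>F. finite F \<Longrightarrow> (\<Sum>k\<in>F. (cmod (g k))\<^sup>2) \<le> C"
  shows "ell2_coeff (Abs_ell2 g) = g"
proof (rule Abs_ell2_inverse)
  have "(\<lambda>k. (cmod (g k))\<^sup>2) summable_on UNIV"
    by (rule nonneg_bdd_above_summable_on) (use assms in \<open>auto intro!: bdd_aboveI2[where M = C]\<close>)
  then show "g \<in> {f. (\<lambda>k. (cmod (f k))\<^sup>2) summable_on UNIV}" by simp
qed

lemma norm_scaleC [simp]: "norm (c *\<^sub>C f) = cmod c * norm f"
proof -
  have "(norm (c *\<^sub>C f))\<^sup>2 = (cmod c * norm f)\<^sup>2"
    unfolding norm_ell2_sq power_mult_distrib
    by (simp add: norm_mult power_mult_distrib infsum_cmult_right')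
  then show ?thesis by (metis norm_ge_zero power2_eq_imp_eq mult_nonneg_nonneg)
qed

lemma scaleR_eq_scaleC: "r *\<^sub>R f = complex_of_real r *\<^sub>C (f :: 'a ell2)"
  by (rule ell2_eqI) simp

text \<open>Riesz-Fischer: the limit is formed coordinatewise, and the Cauchy estimate passes to it
  on each finite set. Completeness is used by the contraction principle and by the total boundedness
  criterion.\<close>

instance ell2 :: (type) banach
proof
  fix X :: "nat \<Rightarrow> 'a ell2"
  assume X: "Cauchy X"
  have "Cauchy (\<lambda>n. ell2_coeff (X n) k)" for k
  proof (rule metric_CauchyI)
    fix e :: real assume "0 < e"
    then obtain N where N: "\<And>m n. m \<ge> N \<Longrightarrow> n \<ge> N \<Longrightarrow> dist (X m) (X n) < e"
      using metric_CauchyD[OF X] by blast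
    have "dist (ell2_coeff (X m) k) (ell2_coeff (X n) k) \<le> dist (X m) (X n)" for m n
      using ell2_coeff_le_norm[of "X m - X n" k] by (simp add: dist_norm)
    with N show "\<exists>N. \<forall>m\<ge>N. \<forall>n\<ge>N. dist (ell2_coeff (X m) k) (ell2_coeff (X n) k) < e"
      by (meson le_less_trans)
  qed
  moreover define g where "g k = lim (\<lambda>n. ell2_coeff (X n) k)" for k
  ultimately have g: "(\<lambda>n. ell2_coeff (X n) k) \<longlonglongrightarrow> g k" for k
    by (simp add: Cauchy_convergent convergent_LIMSEQ_iff[symmetric])
  have bound: "(\<Sum>k\<in>F. (cmod (ell2_coeff (X n) k - g k))\<^sup>2) \<le> e\<^sup>2"
    if e: "e > 0" and n: "n \<ge> N" and N: "\<And>m n. m \<ge> N \<Longrightarrow> n \<ge> N \<Longrightarrow> dist (X m) (X n) < e"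
      and F: "finite F" for e n N F
  proof (rule tendsto_le[OF sequentially_bot tendsto_const])
    show "(\<lambda>m. \<Sum>k\<in>F. (cmod (ell2_coeff (X n) k - ell2_coeff (X m) k))\<^sup>2)
            \<longlonglongrightarrow> (\<Sum>k\<in>F. (cmod (ell2_coeff (X n) k - g k))\<^sup>2)"
      by (intro tendsto_intros g)
    show "\<forall>\<^sub>F m in sequentially. (\<Sum>k\<in>F. (cmod (ell2_coeff (X n) k - ell2_coeff (X m) k))\<^sup>2) \<le> e\<^sup>2"
      using eventually_ge_at_top[of N]
    proof eventually_elim
      case (elim m)
      have "(\<Sum>k\<in>F. (cmod (ell2_coeff (X n) k - ell2_coeff (X m) k))\<^sup>2) \<le> (norm (X n - X m))\<^sup>2"
        using ell2_sum_le_norm[OF F, of "X n - X m"] by simp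
      also have "\<dots> \<le> e\<^sup>2"
        using N[OF n elim] by (intro power_mono) (auto simp: dist_norm)
      finally show ?case .
    qed
  qed
  obtain N1 where N1: "\<And>m n. m \<ge> N1 \<Longrightarrow> n \<ge> N1 \<Longrightarrow> dist (X m) (X n) < 1"
    using metric_CauchyD[OF X zero_less_one] by blast
  \<comment> \<open>Only differences from the sequence have been bounded, so \<open>X N1 - g\<close>
    is shown to be square-summable and \<open>g\<close> is recovered as
    \<open>X N1 - h\<close>.\<close>
  define h where "h = Abs_ell2 (\<lambda>k. ell2_coeff (X N1) k - g k)"
  have h: "ell2_coeff h = (\<lambda>k. ell2_coeff (X N1) k - g k)"
    unfolding h_def by (rule ell2_coeff_Abs[where C = "1\<^sup>2"]) (rule bound[OF zero_less_one order_refl N1])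
  have "X \<longlonglongrightarrow> X N1 - h"
  proof (rule metric_LIMSEQ_I)
    fix e :: real assume e: "0 < e"
    then obtain N where N: "\<And>m n. m \<ge> N \<Longrightarrow> n \<ge> N \<Longrightarrow> dist (X m) (X n) < e / 2"
      using metric_CauchyD[OF X half_gt_zero[OF e]] by blast
    have "dist (X n) (X N1 - h) < e" if "n \<ge> N" for n
    proof -
      have "norm (X n - (X N1 - h)) \<le> e / 2"
      proof (rule ell2_norm_leI)
        fix F :: "'a set" assume "finite F"
        then show "(\<Sum>k\<in>F. (cmod (ell2_coeff (X n - (X N1 - h)) k))\<^sup>2) \<le> (e / 2)\<^sup>2"
          using bound[OF half_gt_zero[OF e] that N] by (simp add: h)
      qed (use e in simp)
      then show ?thesis using e by (simp add: dist_norm)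
    qed
    then show "\<exists>N. \<forall>n\<ge>N. dist (X n) (X N1 - h) < e" by blast
  qed
  then show "convergent X" by (auto simp: convergent_def)
qed

lift_definition restrict_ell2 :: "'a set \<Rightarrow> 'a ell2 \<Rightarrow> 'a ell2"
  is "\<lambda>F f k. if k \<in> F then f k else 0"
  by (erule summable_on_comparison_test) auto

lift_definition unit_ell2 :: "'a \<Rightarrow> 'a ell2" is "\<lambda>m k. if k = m then 1 else 0"
proof -
  fix m :: 'a
  have "(\<lambda>k. (cmod (if k = m then 1 else 0))\<^sup>2) summable_on {m}" by simp
  then show "(\<lambda>k. (cmod (if k = m then 1 else 0))\<^sup>2) summable_on UNIV"
    by (rule summable_on_cong_neutral[THEN iffD1, rotated -1]) auto
qed

lemmas ell2_coeff_restrict [simp] = restrict_ell2.rep_eq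
lemmas ell2_coeff_unit [simp] = unit_ell2.rep_eq

lemma norm_unit_ell2: "norm (unit_ell2 m) \<le> 1"
proof (rule ell2_norm_leI)
  fix F :: "'a set" assume F: "finite F"
  have "(\<Sum>k\<in>F. (cmod (ell2_coeff (unit_ell2 m) k))\<^sup>2) = (\<Sum>k\<in>F. if k = m then 1 else 0)"
    by (rule sum.cong) auto
  also have "\<dots> \<le> 1" using F by (simp add: sum.delta)
  finally show "(\<Sum>k\<in>F. (cmod (ell2_coeff (unit_ell2 m) k))\<^sup>2) \<le> 1\<^sup>2" by simp
qed simp

lemma restrict_ell2_finite:
  "finite F \<Longrightarrow> restrict_ell2 F f = (\<Sum>k\<in>F. ell2_coeff f k *\<^sub>C unit_ell2 k)"
  by (rule ell2_eqI) (simp add: if_distrib[of "\<lambda>x. _ * x"] cong: if_cong)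

lemma norm_restrict_ell2_le: "norm (restrict_ell2 F f) \<le> norm f"
proof (rule ell2_norm_leI)
  fix G :: "'a set" assume G: "finite G"
  have "(\<Sum>k\<in>G. (cmod (ell2_coeff (restrict_ell2 F f) k))\<^sup>2) \<le> (\<Sum>k\<in>G. (cmod (ell2_coeff f k))\<^sup>2)"
    by (rule sum_mono) auto
  also have "\<dots> \<le> (norm f)\<^sup>2" by (rule ell2_sum_le_norm[OF G])
  finally show "(\<Sum>k\<in>G. (cmod (ell2_coeff (restrict_ell2 F f) k))\<^sup>2) \<le> (norm f)\<^sup>2" .
qed simp

text \<open>Once \<open>F\<close> captures all but \<open>(e / 2)\<^sup>2\<close> of the squared
  norm, any finite set outside \<open>F\<close> carries at most that much.\<close>

lemma tendsto_restrict_ell2: "((\<lambda>F. restrict_ell2 F f) \<longlongrightarrow> f) (finite_subsets_at_top UNIV)"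
proof (rule tendstoI)
  fix e :: real assume e: "0 < e"
  have "((\<lambda>k. (cmod (ell2_coeff f k))\<^sup>2) has_sum (norm f)\<^sup>2) UNIV"
    unfolding norm_ell2_sq by (rule has_sum_infsum[OF ell2_summable])
  then have "((\<lambda>F. \<Sum>k\<in>F. (cmod (ell2_coeff f k))\<^sup>2) \<longlongrightarrow> (norm f)\<^sup>2) (finite_subsets_at_top UNIV)"
    by (simp add: has_sum_def)
  then have "\<forall>\<^sub>F F in finite_subsets_at_top UNIV.
      (\<Sum>k\<in>F. (cmod (ell2_coeff f k))\<^sup>2) > (norm f)\<^sup>2 - (e / 2)\<^sup>2"
    using e by (intro order_tendstoD) auto
  moreover have "\<forall>\<^sub>F F :: 'a set in finite_subsets_at_top UNIV. finite F"
    by (rule eventually_finite_subsets_at_top_weakI) auto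
  ultimately show "\<forall>\<^sub>F F in finite_subsets_at_top UNIV. dist (restrict_ell2 F f) f < e"
  proof eventually_elim
    case (elim F)
    have "norm (f - restrict_ell2 F f) \<le> e / 2"
    proof (rule ell2_norm_leI)
      fix G :: "'a set" assume G: "finite G"
      have "(\<Sum>k\<in>G. (cmod (ell2_coeff (f - restrict_ell2 F f) k))\<^sup>2) = (\<Sum>k\<in>G - F. (cmod (ell2_coeff f k))\<^sup>2)"
        using G by (intro sum.mono_neutral_cong_right) auto
      also have "\<dots> + (\<Sum>k\<in>F. (cmod (ell2_coeff f k))\<^sup>2) = (\<Sum>k\<in>(G - F) \<union> F. (cmod (ell2_coeff f k))\<^sup>2)"
        using G elim by (subst sum.union_disjoint) auto
      moreover have "\<dots> \<le> (norm f)\<^sup>2"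
        using G elim by (intro ell2_sum_le_norm) auto
      ultimately show "(\<Sum>k\<in>G. (cmod (ell2_coeff (f - restrict_ell2 F f) k))\<^sup>2) \<le> (e / 2)\<^sup>2"
        using elim by linarith
    qed (use e in auto)
    then show ?case using e by (simp add: dist_norm norm_minus_commute)
  qed
qed

lemma bounded_clinearI:
  assumes "\<And>f g. A (f + g) = A f + A g" "\<And>c f. A (c *\<^sub>C f) = c *\<^sub>C A f" "\<And>f. norm (A f) \<le> K * norm f"
  shows "bounded_clinear A"
  unfolding bounded_clinear_def
  using assms by (auto intro!: bounded_linear_intro[where K = K] simp: scaleR_eq_scaleC mult.commute)

text \<open>Bridge from the analytic predicate to the algebraic locale, so that spans, bases and
  kernels over the complex scalars become available for operators.\<close>

lemma bounded_clinear_linear: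
  assumes "bounded_clinear A"
  shows "Vector_Spaces.linear (*\<^sub>C) (*\<^sub>C) A"
  using assms unfolding bounded_clinear_def
  by (intro Vector_Spaces.linear.intro module_hom.intro module_hom_axioms.intro)
    (auto simp: ell2.vector_space_axioms ell2.module_axioms linear_simps)

lemma bounded_clinear_restrict: "bounded_clinear (restrict_ell2 F)"
  by (rule bounded_clinearI[where K = 1]) (auto intro!: ell2_eqI simp: norm_restrict_ell2_le)

lemma bounded_clinear_scaleC: "bounded_clinear (\<lambda>f. c *\<^sub>C f)"
  by (rule bounded_clinearI[where K = "cmod c"]) (auto simp: ell2.scale_right_distrib mult.commute)

lemma bounded_clinear_compose:
  "bounded_clinear A \<Longrightarrow> bounded_clinear B \<Longrightarrow> bounded_clinear (\<lambda>f. A (B f))"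
  unfolding bounded_clinear_def by (auto intro: bounded_linear_compose)

lemma bounded_clinear_add:
  "bounded_clinear A \<Longrightarrow> bounded_clinear B \<Longrightarrow> bounded_clinear (\<lambda>f. A f + B f)"
  unfolding bounded_clinear_def by (auto intro: bounded_linear_add simp: ell2.scale_right_distrib)

lemma bounded_clinear_diff:
  "bounded_clinear A \<Longrightarrow> bounded_clinear B \<Longrightarrow> bounded_clinear (\<lambda>f. A f - B f)"
  unfolding bounded_clinear_def by (auto intro: bounded_linear_sub simp: ell2.scale_right_diff_distrib)

lemma bounded_clinear_tendsto:
  "bounded_clinear A \<Longrightarrow> (X \<longlongrightarrow> f) F \<Longrightarrow> ((\<lambda>n. A (X n)) \<longlongrightarrow> A f) F"
  unfolding bounded_clinear_def by (auto intro: bounded_linear.tendsto)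

text \<open>Finite truncations are dense and both operators are continuous. This is the uniqueness
  behind the definite description in \<open>Op\<close>.\<close>

lemma bounded_clinear_eqI:
  assumes "bounded_clinear A" "bounded_clinear B"
    and "\<And>f. finite {k. ell2_coeff f k \<noteq> 0} \<Longrightarrow> A f = B f"
  shows "A = B"
proof
  fix f
  have "\<forall>\<^sub>F F in finite_subsets_at_top UNIV. A (restrict_ell2 F f) = B (restrict_ell2 F f)"
    by (rule eventually_finite_subsets_at_top_weakI) (auto intro!: assms(3) elim: rev_finite_subset)
  then have "((\<lambda>F. A (restrict_ell2 F f)) \<longlongrightarrow> B f) (finite_subsets_at_top UNIV)"
    using bounded_clinear_tendsto[OF assms(2) tendsto_restrict_ell2[of f]] by (subst tendsto_cong)
  then show "A f = B f"
    using bounded_clinear_tendsto[OF assms(1) tendsto_restrict_ell2[of f]]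
    by (intro tendsto_unique[OF finite_subsets_at_top_neq_bot])
qed

section \<open>Finite-rank perturbations and Fredholm index\<close>

context vector_space
begin

lemma vector_space_pair_self: "vector_space_pair scale scale"
  by unfold_locales

text \<open>The coordinates of \<open>x\<close> in the basis are supported both in \<open>S\<close>
  and in \<open>T\<close>.\<close>

lemma span_disjoint_eq_zero:
  assumes B: "independent B" "S \<subseteq> B" "T \<subseteq> B" "S \<inter> T = {}" and x: "x \<in> span S" "x \<in> span T"
  shows "x = 0"
proof -
  have xB: "x \<in> span B" using x(1) span_mono[OF B(2)] by blast
  have "representation B x b = 0" for b
  proof (rule ccontr)
    assume "representation B x b \<noteq> 0"
    then have "b \<in> S" "b \<in> T"
      using representation_extend[OF B(1) x(1) B(2)] representation_extend[OF B(1) x(2) B(3)]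
      by (metis representation_ne_zero)+
    then show False using B(4) by blast
  qed
  then show ?thesis using sum_nonzero_representation_eq[OF B(1) xB] by simp
qed

text \<open>A lower bound for codimensions. Each element of \<open>S\<close> is congruent modulo
  \<open>R\<close> to an element of \<open>span B\<close>; the linear extension \<open>g\<close> of
  such a choice stays congruent to the identity on \<open>span S\<close>. Hence
  \<open>g x = 0\<close> forces \<open>x\<close> into \<open>span S \<inter> R\<close>, so
  \<open>g\<close> is injective and embeds \<open>S\<close> independently in
  \<open>span B\<close>.\<close>

lemma independent_modulo_subspace_card_le:
  assumes R: "subspace R" and S: "independent S" "span S \<inter> R \<subseteq> {0}"
    and B: "finite B" "S \<subseteq> span (R \<union> B)"
  shows "card S \<le> card B"
proof -
  interpret vector_space_pair scale scale by (rule vector_space_pair_self)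
  have "\<exists>s. s \<in> span B \<and> b - s \<in> R" if "b \<in> S" for b
  proof -
    have "b \<in> {x + y |x y. x \<in> span R \<and> y \<in> span B}"
      using B(2) that by (auto simp: span_Un)
    then obtain x y where "b = x + y" "x \<in> R" "y \<in> span B"
      using R by (auto simp: span_eq_iff[THEN iffD2])
    then show ?thesis by (intro exI[of _ y]) auto
  qed
  then obtain s where s: "\<And>b. b \<in> S \<Longrightarrow> s b \<in> span B \<and> b - s b \<in> R" by metis
  obtain g where g: "Vector_Spaces.linear scale scale g" "\<And>b. b \<in> S \<Longrightarrow> g b = s b"
    using linear_independent_extend[OF S(1), of s] by blast
  interpret g: Vector_Spaces.linear scale scale g by (rule g(1))
  have mod: "x - g x \<in> R" if "x \<in> span S" for x
    using that
  proof (induction rule: span_induct_alt)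
    case base then show ?case by (simp add: g.zero subspace_0[OF R])
  next
    case (step c x y)
    have "c *s x + y - g (c *s x + y) = c *s (x - g x) + (y - g y)"
      by (simp add: g.add g.scale algebra_simps)
    also have "\<dots> \<in> R"
      using step s g(2) by (intro subspace_add[OF R] subspace_scale[OF R]) auto
    finally show ?case .
  qed
  have "x = 0" if "x \<in> span S" "g x = 0" for x
    using mod[OF that(1)] that S(2) by auto
  then have inj: "inj_on g (span S)"
    by (subst linear_inj_on_iff_eq_0[OF g(1) subspace_span]) auto
  have "independent (g ` S)" by (rule linear_independent_injective_image[OF g(1) S(1) inj])
  moreover have "g ` S \<subseteq> span B" using s g(2) by auto
  ultimately have "card (g ` S) \<le> card B" using independent_span_bound[OF B(1)] by blast
  moreover have "card (g ` S) = card S"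
    by (rule card_image) (meson inj inj_on_subset span_superset)
  ultimately show ?thesis by simp
qed

text \<open>Everything happens inside the finite-dimensional space \<open>span T\<close>, which \<open>N\<close> maps to itself,
  so the index vanishes by rank-nullity there.\<close>

lemma finite_rank_perturbation_of_identity:
  assumes N: "Vector_Spaces.linear scale scale N" and T: "finite T" "\<And>x. N x - x \<in> span T"
  obtains K S R where "finite K" "independent K" "span K = {x. N x = 0}"
    "finite S" "card S = card K" "span (range N \<union> S) = UNIV"
    "\<And>B. finite B \<Longrightarrow> span (range N \<union> B) = UNIV \<Longrightarrow> card S \<le> card B"
    "finite R" "range N = {x. N x - x \<in> span R}"
proof -
  interpret vector_space_pair scale scale by (rule vector_space_pair_self)
  interpret N: Vector_Spaces.linear scale scale N by (rule N)
  have sub_range: "subspace (range N)" by (rule linear_subspace_image[OF N subspace_UNIV])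
  have sub_ker: "subspace {x. N x = 0}" by (rule linear_subspace_kernel[OF N])
  have ker: "x \<in> span T" if "N x = 0" for x
    using span_neg[OF T(2)[of x]] that by simp
  have inv: "N x \<in> span T" if "x \<in> span T" for x
    using span_add[OF T(2)[of x] that] by simp
  have preim: "x \<in> span T" if "N x \<in> span T" for x
    using span_diff[OF that T(2)[of x]] by simp
  obtain K where K: "K \<subseteq> {x. N x = 0}" "independent K" "{x. N x = 0} \<subseteq> span K"
    using maximal_independent_subset by blast
  have spanK: "span K = {x. N x = 0}" using span_subspace[OF K(1,3) sub_ker] .
  have "K \<subseteq> span T" using K(1) ker by auto
  then obtain E where E: "K \<subseteq> E" "E \<subseteq> span T" "independent E" "span T \<subseteq> span E"
    using maximal_independent_subset_extend[OF _ K(2)] by metis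
  have finE: "finite E" using independent_span_bound[OF T(1) E(3,2)] by simp
  have spanE: "span E = span T" using E by (metis span_subspace subspace_span)
  \<comment> \<open>\<open>E - K\<close> spans a complement of the kernel inside
    \<open>span T\<close>.\<close>
  have inj: "inj_on N (span (E - K))"
    using span_disjoint_eq_zero[OF E(3), of "E - K" K] E(1) spanK
    by (subst linear_inj_on_iff_eq_0[OF N subspace_span]) auto
  have indR: "independent (N ` (E - K))"
    by (rule linear_independent_injective_image[OF N independent_mono[OF E(3)] inj]) auto
  have cardR: "card (N ` (E - K)) = card E - card K"
    using finE E(1) inj_on_subset[OF inj span_superset]
    by (simp add: card_image card_Diff_subset finite_subset)
  have "N ` (E - K) \<subseteq> span T" using E(2) inv by auto
  then obtain G where G: "N ` (E - K) \<subseteq> G" "G \<subseteq> span T" "independent G" "span T \<subseteq> span G"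
    using maximal_independent_subset_extend[OF _ indR] by metis
  have finG: "finite G" using independent_span_bound[OF T(1) G(3,2)] by simp
  \<comment> \<open>Both are bases of \<open>span T\<close>. Removing the
    \<open>card E - card K\<close> images from \<open>G\<close> therefore leaves exactly
    \<open>card K\<close> elements: this is where kernel and cokernel get the same
    dimension.\<close>
  have "card G = card E"
    using basis_card_eq_dim[OF G(2,4,3)] basis_card_eq_dim[OF E(2,4,3)] by simp
  define S where "S = G - N ` (E - K)"
  have cardS: "card S = card K"
    using cardR \<open>card G = card E\<close> G(1) finE E(1) card_mono[OF finE E(1)] unfolding S_def
    by (subst card_Diff_subset) auto
  \<comment> \<open>Preimages of points of \<open>span T\<close> lie in \<open>span T\<close> again,
    so nothing outside the finite-dimensional space contributes.\<close>
  have range_T: "range N \<inter> span T = span (N ` (E - K))"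
  proof (intro equalityI subsetI)
    fix y assume "y \<in> range N \<inter> span T"
    then obtain x where x: "y = N x" "x \<in> span E" using preim spanE by auto
    then have "y \<in> span (N ` E)" using linear_span_image[OF N, of E] by auto
    moreover have "N ` E \<subseteq> span (N ` (E - K))"
      using K(1) by (force intro: span_base span_zero)
    ultimately show "y \<in> span (N ` (E - K))" by (meson span_minimal subsetD subspace_span)
  next
    fix y assume y: "y \<in> span (N ` (E - K))"
    have "span (N ` (E - K)) \<subseteq> range N" by (rule span_minimal[OF _ sub_range]) auto
    moreover have "span (N ` (E - K)) \<subseteq> span T"
      using E(2) inv by (intro span_minimal[OF _ subspace_span]) auto
    ultimately show "y \<in> range N \<inter> span T" using y by auto
  qed
  \<comment> \<open>Uses \<open>x = N x - (N x - x)\<close>, whose last term lies in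
    \<open>span T\<close>, hence in the span of \<open>G\<close>.\<close>
  have "x \<in> span (range N \<union> S)" for x
  proof -
    have "N x \<in> span (range N \<union> S)" by (auto intro: span_base)
    moreover have "G \<subseteq> range N \<union> S" by (auto simp: S_def)
    then have "N x - x \<in> span (range N \<union> S)" using T(2) G(4) span_mono by blast
    ultimately have "N x - (N x - x) \<in> span (range N \<union> S)" by (rule span_diff)
    then show ?thesis by simp
  qed
  then have span_S: "span (range N \<union> S) = UNIV" by auto
  have "span S \<inter> range N \<subseteq> {0}"
  proof
    fix x assume x: "x \<in> span S \<inter> range N"
    have "span S \<subseteq> span T" using G(2) by (intro span_minimal[OF _ subspace_span]) (auto simp: S_def)
    with x range_T have "x \<in> span (N ` (E - K))" by auto
    then show "x \<in> {0}"
      using span_disjoint_eq_zero[OF G(3) _ G(1), of S x] x by (auto simp: S_def)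
  qed
  moreover have "independent S" using G(3) by (rule independent_mono) (auto simp: S_def)
  ultimately have codim: "card S \<le> card B" if "finite B" "span (range N \<union> B) = UNIV" for B
    using independent_modulo_subspace_card_le[OF sub_range _ _ that(1), of S] that(2) by auto
  \<comment> \<open>This form exhibits the range as the preimage of a finite-dimensional space under
    \<open>N - id\<close>, from which closedness will follow by continuity.\<close>
  have range_eq: "range N = {x. N x - x \<in> span (N ` (E - K))}"
  proof (intro equalityI subsetI)
    fix y assume "y \<in> range N"
    then obtain x where "y = N x" by auto
    then have "N y - y = N (y - x)" by (simp add: N.diff)
    then show "y \<in> {x. N x - x \<in> span (N ` (E - K))}" using T(2)[of y] range_T by auto
  next
    fix y assume "y \<in> {x. N x - x \<in> span (N ` (E - K))}"
    then have "N y - y \<in> range N" using range_T by auto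
    from subspace_diff[OF sub_range rangeI[of N y] this] show "y \<in> range N" by simp
  qed
  show ?thesis
  proof (rule that[OF _ K(2) spanK _ cardS span_S codim _ range_eq])
    show "finite K" "finite S" "finite (N ` (E - K))"
      using finE finG finite_subset[OF E(1)] by (simp_all add: S_def)
  qed
qed

end

section \<open>Closed range, Fredholm index and inverses\<close>

lemma closed_ell2_span_finite:
  assumes "finite S"
  shows "closed (ell2.span S :: 'a ell2 set)"
  using assms
proof (induction S)
  case empty
  then show ?case by simp
next
  case (insert b S)
  show ?case
  proof (cases "b \<in> ell2.span S")
    case True
    then show ?thesis using insert.IH by (simp add: ell2.span_redundant)
  next
    case False
    have "open (- ell2.span S)" using insert.IH by auto
    then obtain \<delta> where \<delta>: "\<delta> > 0" "\<And>w. dist b w < \<delta> \<Longrightarrow> w \<notin> ell2.span S"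
      using False unfolding open_dist by (metis ComplD ComplI dist_commute)
    \<comment> \<open>The distance of \<open>b\<close> from the closed span controls the coefficient
      of \<open>b\<close>: dividing by \<open>c\<close> puts
      \<open>b - inverse c *\<^sub>C f\<close> into the span of \<open>S\<close>. Coefficients of a
      convergent sequence are therefore Cauchy, and subtracting their multiples of \<open>b\<close>
      reduces to the induction hypothesis.\<close>
    have bound: "cmod c * \<delta> \<le> norm f" if "f - c *\<^sub>C b \<in> ell2.span S" for c f
    proof (cases "c = 0")
      case False
      have "inverse c *\<^sub>C - (f - c *\<^sub>C b) \<in> ell2.span S"
        using that by (intro ell2.span_scale ell2.span_neg)
      moreover have "inverse c *\<^sub>C - (f - c *\<^sub>C b) = b - inverse c *\<^sub>C f"
        using False by (intro ell2_eqI) (simp add: field_simps)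
      ultimately have "\<delta> \<le> dist b (b - inverse c *\<^sub>C f)" using \<delta>(2) by force
      also have "\<dots> = norm f / cmod c"
        by (simp add: dist_norm norm_inverse divide_inverse mult.commute)
      finally show ?thesis using False by (simp add: field_simps)
    qed simp
    show ?thesis unfolding closed_sequential_limits
    proof (intro allI impI)
      fix X f assume X: "(\<forall>n. X n \<in> ell2.span (insert b S)) \<and> X \<longlonglongrightarrow> f"
      then have "\<forall>n. \<exists>c. X n - c *\<^sub>C b \<in> ell2.span S" by (simp add: ell2.span_breakdown_eq)
      then obtain c where c: "\<And>n. X n - c n *\<^sub>C b \<in> ell2.span S" by metis
      have diff: "cmod (c m - c n) * \<delta> \<le> norm (X m - X n)" for m n
        using ell2.span_diff[OF c[of m] c[of n]]
        by (intro bound) (simp add: ell2.scale_left_diff_distrib algebra_simps)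
      have "Cauchy c"
      proof (rule metric_CauchyI)
        fix e :: real assume "0 < e"
        then have "0 < e * \<delta>" using \<delta>(1) by simp
        with X obtain M where "\<And>m n. m \<ge> M \<Longrightarrow> n \<ge> M \<Longrightarrow> dist (X m) (X n) < e * \<delta>"
          using metric_CauchyD[OF LIMSEQ_imp_Cauchy] by blast
        then have "\<forall>m\<ge>M. \<forall>n\<ge>M. dist (c m) (c n) * \<delta> < e * \<delta>"
          using le_less_trans[OF diff] by (auto simp: dist_norm)
        then show "\<exists>M. \<forall>m\<ge>M. \<forall>n\<ge>M. dist (c m) (c n) < e" using \<delta>(1) by auto
      qed
      then obtain c0 where c0: "c \<longlonglongrightarrow> c0" by (auto simp: Cauchy_convergent_iff convergent_def)
      have "(\<lambda>n. c n *\<^sub>C b) \<longlonglongrightarrow> c0 *\<^sub>C b"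
      proof (rule LIM_zero_cancel, rule tendsto_norm_zero_cancel)
        have "(\<lambda>n. cmod (c n - c0) * norm b) \<longlonglongrightarrow> 0"
          using tendsto_mult[OF tendsto_norm[OF LIM_zero[OF c0]] tendsto_const[of "norm b"]] by simp
        then show "(\<lambda>n. norm (c n *\<^sub>C b - c0 *\<^sub>C b)) \<longlonglongrightarrow> 0"
          by (simp flip: ell2.scale_left_diff_distrib)
      qed
      then have "(\<lambda>n. X n - c n *\<^sub>C b) \<longlonglongrightarrow> f - c0 *\<^sub>C b"
        using X by (intro tendsto_diff) auto
      then have "f - c0 *\<^sub>C b \<in> ell2.span S"
        by (rule closed_sequentially[OF insert.IH, rotated]) (rule c)
      then show "f \<in> ell2.span (insert b S)" by (auto simp: ell2.span_breakdown_eq)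
    qed
  qed
qed

text \<open>With \<open>N = id + R B'\<close> the operator factors as \<open>N\<close> after
  \<open>B\<close>. As \<open>B\<close> is bijective, the range is that of \<open>N\<close> and the
  kernel is the image under \<open>B'\<close> of that of \<open>N\<close>, so everything reduces to
  a finite-rank perturbation of the identity.\<close>

lemma fredholm_index_zero_invertible_plus_finite_rank:
  assumes B: "bounded_clinear B" "bounded_clinear B'" "\<And>f. B (B' f) = f" "\<And>f. B' (B f) = f"
    and R: "bounded_clinear R" "finite_dim (range R)"
  shows "fredholm (\<lambda>f. B f + R f)" and "fredholm_index (\<lambda>f. B f + R f) = 0"
proof -
  define N where "N = (\<lambda>f. f + R (B' f))"
  have C: "bounded_clinear (\<lambda>f. R (B' f))" by (rule bounded_clinear_compose[OF R(1) B(2)])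
  have "bounded_clinear N"
    unfolding N_def using bounded_clinear_add[OF bounded_clinear_scaleC[of 1] C] by simp
  then have N: "Vector_Spaces.linear (*\<^sub>C) (*\<^sub>C) N" by (rule bounded_clinear_linear)
  obtain T where T: "finite T" "range R \<subseteq> ell2.span T" using R(2) by (auto simp: finite_dim_def)
  obtain K S G where K: "finite K" "ell2.independent K" "ell2.span K = {x. N x = 0}"
    and S: "finite S" "card S = card K" "ell2.span (range N \<union> S) = UNIV"
      "\<And>B. finite B \<Longrightarrow> ell2.span (range N \<union> B) = UNIV \<Longrightarrow> card S \<le> card B"
    and G: "finite G" "range N = {x. N x - x \<in> ell2.span G}"
    by (rule ell2.finite_rank_perturbation_of_identity[OF N T(1)]) (use T(2) in \<open>auto simp: N_def\<close>)
  have M: "(\<lambda>f. B f + R f) = (\<lambda>f. N (B f))" by (simp add: N_def B)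
  have "range (\<lambda>f. N (B f)) = N ` range B" by auto
  also have "range B = UNIV" using B(3) by (metis surjI)
  finally have range: "range (\<lambda>f. B f + R f) = range N" unfolding M .
  have "kernel (\<lambda>f. B f + R f) = {f. B f \<in> ell2.span K}" by (simp add: kernel_def M K(3))
  also have "\<dots> = B' ` ell2.span K" using B(3,4) by (auto simp: image_iff) metis
  also have "\<dots> = ell2.span (B' ` K)"
    using vector_space_pair.linear_span_image[OF ell2.vector_space_pair_self bounded_clinear_linear[OF B(2)]]
    by simp
  finally have ker: "kernel (\<lambda>f. B f + R f) = ell2.span (B' ` K)" .
  have injB': "inj_on B' A" for A using B(3) by (metis inj_onI)
  have "ell2.independent (B' ` K)"
    using vector_space_pair.linear_independent_injective_image[OF ell2.vector_space_pair_self
        bounded_clinear_linear[OF B(2)] K(2) injB'] .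
  then have "ell2.dim (ell2.span (B' ` K)) = card (B' ` K)"
    by (rule ell2.dim_span_eq_card_independent)
  then have dim: "ell2.dim (kernel (\<lambda>f. B f + R f)) = card K"
    unfolding ker using card_image[OF injB', of K] by simp
  \<comment> \<open>Here \<open>N - id\<close> is the bounded operator \<open>R B'\<close>, and
    finite-dimensional subspaces are closed.\<close>
  have "range N = (\<lambda>f. R (B' f)) -` ell2.span G" unfolding G(2) by (auto simp: N_def)
  moreover have "closed ((\<lambda>f. R (B' f)) -` ell2.span G)"
    using C by (intro closed_vimage closed_ell2_span_finite G(1))
      (auto simp: bounded_clinear_def intro: bounded_linear.continuous_on)
  ultimately have "closed (range N)" by simp
  then show "fredholm (\<lambda>f. B f + R f)"
    unfolding fredholm_def finite_dim_def finite_codim_def range unfolding ker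
    using bounded_clinear_add[OF B(1) R(1)] K(1) S(1,3) by blast
  have "codim (range N) = card K"
    unfolding codim_def by (rule Least_equality) (use S in auto)
  then show "fredholm_index (\<lambda>f. B f + R f) = 0"
    by (simp add: fredholm_index_def dim range)
qed

text \<open>Solving \<open>T f - z f = g\<close> means finding a fixed point of
  \<open>f \<mapsto> (T f - g) / z\<close>, a contraction with ratio \<open>r / cmod z\<close>. The
  inverse inherits linearity, and \<open>z f = T f - g\<close> bounds it by
  \<open>1 / (cmod z - r)\<close>.\<close>

lemma bijective_bounded_perturbation_of_scalar:
  assumes T: "bounded_clinear T" "\<And>f. norm (T f) \<le> r * norm f" and r: "0 \<le> r" "r < cmod z"
  obtains B' where "bounded_clinear B'" "\<And>f. T (B' f) - z *\<^sub>C B' f = f" "\<And>f. B' (T f - z *\<^sub>C f) = f"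
proof -
  let ?B = "\<lambda>f. T f - z *\<^sub>C f"
  have z: "z \<noteq> 0" using r by auto
  interpret T: Vector_Spaces.linear "(*\<^sub>C)" "(*\<^sub>C)" T by (rule bounded_clinear_linear[OF T(1)])
  have B: "bounded_clinear ?B" by (intro bounded_clinear_diff T(1) bounded_clinear_scaleC)
  interpret B: Vector_Spaces.linear "(*\<^sub>C)" "(*\<^sub>C)" ?B by (rule bounded_clinear_linear[OF B])
  have "\<exists>!f. inverse z *\<^sub>C (T f - g) = f" for g
  proof (rule banach_fix_type)
    show "0 \<le> r / cmod z" "r / cmod z < 1" using r z by (auto simp: divide_less_eq)
    show "\<forall>x y. dist (inverse z *\<^sub>C (T x - g)) (inverse z *\<^sub>C (T y - g)) \<le> r / cmod z * dist x y"
    proof (intro allI)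
      fix x y
      have "dist (inverse z *\<^sub>C (T x - g)) (inverse z *\<^sub>C (T y - g)) = norm (inverse z *\<^sub>C T (x - y))"
        by (simp add: dist_norm T.diff ell2.scale_right_diff_distrib)
      also have "\<dots> \<le> r * norm (x - y) / cmod z"
        using T(2)[of "x - y"] by (simp add: norm_inverse divide_inverse mult.commute mult_left_mono)
      finally show "dist (inverse z *\<^sub>C (T x - g)) (inverse z *\<^sub>C (T y - g)) \<le> r / cmod z * dist x y"
        by (simp add: dist_norm)
    qed
  qed
  moreover have "inverse z *\<^sub>C (T f - g) = f \<longleftrightarrow> ?B f = g" for f g
  proof -
    have "inverse z *\<^sub>C (T f - g) = f \<longleftrightarrow> z *\<^sub>C inverse z *\<^sub>C (T f - g) = z *\<^sub>C f"
      using z by (simp only: ell2.scale_cancel_left) simp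
    also have "\<dots> \<longleftrightarrow> T f - g = z *\<^sub>C f" using z by (simp only: ell2.scale_scale) simp
    finally show ?thesis by (auto simp: algebra_simps)
  qed
  ultimately have ex1: "\<exists>!f. ?B f = g" for g by simp
  define B' where "B' g = (THE f. ?B f = g)" for g
  have B1: "?B (B' g) = g" for g unfolding B'_def by (rule theI'[OF ex1])
  have B2: "B' (?B f) = f" for f unfolding B'_def by (rule the1_equality[OF ex1]) simp
  have norm: "norm (B' g) \<le> inverse (cmod z - r) * norm g" for g
  proof -
    have "cmod z * norm (B' g) = norm (T (B' g) - g)"
      using arg_cong[OF B1[of g], of "\<lambda>h. norm (T (B' g) - h)"] by simp
    also have "\<dots> \<le> r * norm (B' g) + norm g"
      using norm_triangle_ineq4[of "T (B' g)" g] T(2)[of "B' g"] by linarith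
    finally have "(cmod z - r) * norm (B' g) \<le> norm g" by (simp add: algebra_simps)
    then show ?thesis using r by (simp add: field_simps)
  qed
  have "bounded_clinear B'"
  proof (rule bounded_clinearI[OF _ _ norm])
    show "B' (f + g) = B' f + B' g" for f g
      using B2[of "B' f + B' g"] by (simp only: B.add B1)
    show "B' (c *\<^sub>C f) = c *\<^sub>C B' f" for c f
      using B2[of "c *\<^sub>C B' f"] by (simp only: B.scale B1)
  qed
  then show ?thesis using that B1 B2 by blast
qed

section \<open>Fourier coefficients on the torus\<close>

definition torus_exp :: "int ^ 'n::finite \<Rightarrow> real ^ 'n \<Rightarrow> complex" where
  "torus_exp l x = cis (2 * pi * (of_lattice l \<bullet> x))"

text \<open>A gauge integral, which gives direct access to the fundamental theorem of calculus and
  to swapping integrals of continuous functions. It is matched with the Lebesgue integral of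
  \<open>Op_formula\<close> in \<open>Op_formula_finite_support\<close>.\<close>

definition fourier_coeff :: "(real ^ 'n \<Rightarrow> complex) \<Rightarrow> int ^ 'n::finite \<Rightarrow> complex" where
  "fourier_coeff g l = integral (cbox 0 1) (\<lambda>x. g x * torus_exp (- l) x)"

lemma of_lattice_nth [simp]: "of_lattice k $ j = of_int (k $ j)"
  by (simp add: of_lattice_def)

lemma of_lattice_simps [simp]:
  "of_lattice 0 = 0" "of_lattice (k + l) = of_lattice k + of_lattice l"
  "of_lattice (k - l) = of_lattice k - of_lattice l" "of_lattice (- k) = - of_lattice k"
  by (simp_all add: vec_eq_iff)

lemma norm_torus_exp [simp]: "cmod (torus_exp l x) = 1"
  by (simp add: torus_exp_def)

lemma torus_exp_zero [simp]: "torus_exp 0 x = 1"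
  by (simp add: torus_exp_def)

lemma torus_exp_add: "torus_exp (l + m) x = torus_exp l x * torus_exp m x"
  by (simp add: torus_exp_def cis_mult inner_add_left ring_distribs)

lemma torus_exp_minus: "torus_exp (- l) x = cnj (torus_exp l x)"
  by (simp add: torus_exp_def cis_cnj)

lemma torus_exp_diff_arg: "torus_exp l (x - y) = torus_exp l x * torus_exp (- l) y"
  by (simp add: torus_exp_def cis_mult inner_diff_right right_diff_distrib)

lemma continuous_on_torus_exp [continuous_intros]: "continuous_on A (torus_exp l)"
  unfolding torus_exp_def cis_conv_exp by (intro continuous_intros)

lemma torus_fun_torus_exp: "torus_fun (torus_exp l)"
proof -
  have "torus_exp l (x + of_lattice m) = torus_exp l x" for x :: "real ^ 'a" and m
  proof -
    have "of_lattice l \<bullet> (of_lattice m :: real ^ 'a) = of_int (\<Sum>j\<in>UNIV. l $ j * m $ j)"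
      by (simp add: inner_vec_def)
    moreover have "cis (2 * pi * of_int i) = 1" for i
      using cis_multiple_2pi[of "of_int i"] by simp
    moreover have "torus_exp l (x + of_lattice m) = torus_exp l x * cis (2 * pi * (of_lattice l \<bullet> of_lattice m))"
      by (simp add: torus_exp_def inner_add_right ring_distribs cis_mult)
    ultimately show ?thesis by (simp only: mult_1_right)
  qed
  then show ?thesis by (simp add: torus_fun_def)
qed

lemma torus_fun_mult: "torus_fun f \<Longrightarrow> torus_fun g \<Longrightarrow> torus_fun (\<lambda>x. f x * g x)"
  by (simp add: torus_fun_def)

lemma torus_fun_axis: "torus_fun f \<Longrightarrow> f (x + axis j 1) = f x"
proof -
  assume "torus_fun f"
  then have "f (x + of_lattice (axis j 1)) = f x" by (simp only: torus_fun_def)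
  also have "of_lattice (axis j 1) = (axis j 1 :: real ^ 'a)" by (simp add: vec_eq_iff axis_def)
  finally show ?thesis .
qed

lemma content_unit_cube [simp]: "measure lborel (cbox 0 (1 :: real ^ 'n)) = 1"
  by (subst content_cbox_cart) (auto simp: interval_ne_empty_cart)

lemma axis_in_Basis: "(axis j 1 :: real ^ 'n) \<in> Basis"
  by (auto simp: Basis_vec_def)

text \<open>The shifted cube is cut at \<open>x $ j = 1\<close>. By periodicity the protruding slab
  can be moved back by one unit, where it fills the missing slab
  \<open>x $ j \<le> s\<close>.\<close>

lemma integral_torus_translate:
  fixes f :: "real ^ 'n::finite \<Rightarrow> complex"
  assumes per: "torus_fun f" and cont: "continuous_on UNIV f" and s: "0 \<le> s" "s \<le> 1"
  shows "integral (cbox 0 1) (\<lambda>x. f (x + s *\<^sub>R axis j 1)) = integral (cbox 0 1) f"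
proof -
  have int: "f integrable_on cbox a b" for a b
    by (rule integrable_continuous[OF continuous_on_subset[OF cont]]) simp
  let ?e = "axis j 1 :: real ^ 'n"
  have e: "x \<bullet> ?e = x $ j" for x by (simp add: inner_axis)
  let ?Q = "cbox (s *\<^sub>R ?e) (1 + s *\<^sub>R ?e)"
  have "integral (cbox 0 1) (\<lambda>x. f (x + s *\<^sub>R ?e)) = integral ?Q f"
    using integral_shift_cbox[of "s *\<^sub>R ?e" "s *\<^sub>R ?e" "1 + s *\<^sub>R ?e" f] by simp
  also have "\<dots> = integral (?Q \<inter> {x. x \<bullet> ?e \<le> 1}) f + integral (?Q \<inter> {x. x \<bullet> ?e \<ge> 1}) f"
    by (rule integral_split[OF int axis_in_Basis])
  also have "?Q \<inter> {x. x \<bullet> ?e \<le> 1} = cbox 0 1 \<inter> {x. x \<bullet> ?e \<ge> s}"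
    using s unfolding e by (auto simp: mem_box_cart axis_def split: if_splits) (smt (verit))+
  also have "?Q \<inter> {x. x \<bullet> ?e \<ge> 1} = cbox ?e (1 + s *\<^sub>R ?e)"
    using s unfolding e by (auto simp: mem_box_cart axis_def split: if_splits) (smt (verit))+
  also have "integral (cbox ?e (1 + s *\<^sub>R ?e)) f
      = integral (cbox 0 (1 + s *\<^sub>R ?e - ?e)) f"
    using integral_shift_cbox[of ?e ?e "1 + s *\<^sub>R ?e" f] torus_fun_axis[OF per] by simp
  also have "cbox 0 (1 + s *\<^sub>R ?e - ?e) = cbox 0 1 \<inter> {x. x \<bullet> ?e \<le> s}"
    using s unfolding e by (auto simp: mem_box_cart axis_def split: if_splits) (smt (verit))+
  also have "integral (cbox 0 1 \<inter> {x. x \<bullet> ?e \<ge> s}) f + integral (cbox 0 1 \<inter> {x. x \<bullet> ?e \<le> s}) f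
      = integral (cbox 0 1) f"
    using integral_split[OF int axis_in_Basis[of j], of 0 1 s] by (simp add: add.commute)
  finally show ?thesis .
qed

section \<open>Partial derivatives and integration by parts on the torus\<close>

lemma has_vector_derivative_partial:
  assumes "(\<lambda>t. g (x + t *\<^sub>R axis j 1)) differentiable (at 0)"
  shows "((\<lambda>t. g (x + t *\<^sub>R axis j 1)) has_vector_derivative partial j g x) (at 0)"
  using assms by (simp add: partial_def vector_derivative_works)

lemma partial_eqI:
  "((\<lambda>t. g (x + t *\<^sub>R axis j 1)) has_vector_derivative D) (at 0) \<Longrightarrow> partial j g x = D"
  unfolding partial_def by (rule vector_derivative_at)

text \<open>\<open>partial\<close> only knows derivatives at parameter 0; composing with
  \<open>u - t\<close> transports them along the whole line, as the fundamental theorem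
  requires.\<close>

lemma has_vector_derivative_partial_line:
  assumes "\<And>x. (\<lambda>t. g (x + t *\<^sub>R axis j 1)) differentiable (at 0)"
  shows "((\<lambda>t. g (x + t *\<^sub>R axis j 1)) has_vector_derivative partial j g (x + t *\<^sub>R axis j 1)) (at t)"
proof -
  let ?e = "axis j 1 :: real ^ 'a"
  have "((\<lambda>s. g ((x + t *\<^sub>R ?e) + s *\<^sub>R ?e)) has_vector_derivative partial j g (x + t *\<^sub>R ?e)) (at (t - t))"
    using has_vector_derivative_partial[OF assms] by simp
  moreover have "((\<lambda>u. u - t) has_vector_derivative 1) (at t)"
    by (auto intro!: derivative_eq_intros)
  ultimately have "((\<lambda>s. g ((x + t *\<^sub>R ?e) + s *\<^sub>R ?e)) \<circ> (\<lambda>u. u - t) has_vector_derivative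
      1 *\<^sub>R partial j g (x + t *\<^sub>R ?e)) (at t)"
    by (rule vector_diff_chain_at[rotated])
  then show ?thesis by (simp add: o_def algebra_simps)
qed

lemma torus_fun_partial:
  assumes "torus_fun g"
  shows "torus_fun (partial j g)"
proof -
  have "g (x + of_lattice m + t *\<^sub>R axis j 1) = g (x + t *\<^sub>R axis j 1)" for x m and t :: real
  proof -
    have "x + of_lattice m + t *\<^sub>R axis j 1 = x + t *\<^sub>R axis j 1 + of_lattice m"
      by simp
    then show ?thesis using assms by (simp only: torus_fun_def)
  qed
  then show ?thesis by (simp add: torus_fun_def partial_def)
qed

text \<open>Averaging over translates along the axis does not change the integral. After swapping
  the integrals the inner one runs over a full period of a derivative and vanishes. This is
  integration by parts without boundary terms.\<close>

lemma integral_partial_eq_zero: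
  fixes g :: "real ^ 'n::finite \<Rightarrow> complex"
  assumes per: "torus_fun g" and diff: "\<And>x. (\<lambda>t. g (x + t *\<^sub>R axis j 1)) differentiable (at 0)"
    and cont: "continuous_on UNIV (partial j g)"
  shows "integral (cbox 0 1) (partial j g) = 0"
proof -
  let ?e = "axis j 1 :: real ^ 'n"
  have line: "integral {0..1} (\<lambda>t. partial j g (x + t *\<^sub>R ?e)) = 0" for x
  proof -
    have "((\<lambda>t. partial j g (x + t *\<^sub>R ?e)) has_integral g (x + 1 *\<^sub>R ?e) - g (x + 0 *\<^sub>R ?e)) {0..1}"
      by (rule fundamental_theorem_of_calculus)
        (auto intro: has_vector_derivative_at_within has_vector_derivative_partial_line[OF diff])
    then show ?thesis using torus_fun_axis[OF per, of x j] by (simp add: integral_unique)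
  qed
  have "continuous_on (cbox (0, 0) (1, 1)) (\<lambda>(x, t). partial j g (x + t *\<^sub>R ?e))"
    unfolding case_prod_beta
    by (rule continuous_on_compose2[OF cont]) (auto intro!: continuous_intros)
  then have "integral (cbox 0 1) (\<lambda>x. integral (cbox 0 1) (\<lambda>t. partial j g (x + t *\<^sub>R ?e)))
     = integral (cbox 0 1) (\<lambda>t. integral (cbox 0 1) (\<lambda>x. partial j g (x + t *\<^sub>R ?e)))"
    by (rule integral_swap_continuous)
  also have "\<dots> = integral (cbox 0 1) (\<lambda>t :: real. integral (cbox 0 1) (partial j g))"
    by (rule Henstock_Kurzweil_Integration.integral_cong)
      (auto intro!: integral_torus_translate torus_fun_partial per cont)
  also have "\<dots> = integral (cbox 0 1) (partial j g)" by simp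
  finally show ?thesis using line by simp
qed

lemma torus_exp_line:
  "((\<lambda>t. torus_exp l (x + t *\<^sub>R axis j 1)) has_vector_derivative
     2 * pi * \<i> * of_int (l $ j) * torus_exp l x) (at 0)"
proof -
  let ?f = "\<lambda>z. exp (\<i> * (2 * pi * (complex_of_real (of_lattice l \<bullet> x) + z * of_int (l $ j))))"
  have "(?f has_field_derivative 2 * pi * \<i> * of_int (l $ j) * ?f 0) (at (of_real 0))"
    by (auto intro!: derivative_eq_intros)
  from has_vector_derivative_real_field[OF this] show ?thesis
    by (simp add: torus_exp_def cis_conv_exp inner_add_right inner_axis)
qed

lemma integrable_torus: "continuous_on UNIV g \<Longrightarrow> (g :: real ^ 'n \<Rightarrow> 'b::banach) integrable_on cbox a b"
  by (rule integrable_continuous) (rule continuous_on_subset, auto)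

text \<open>If \<open>l $ j \<noteq> 0\<close>, the character is a multiple of its own
  \<open>j\<close>-th derivative, which integrates to 0.\<close>

lemma integral_torus_exp: "integral (cbox 0 1) (torus_exp l) = (if l = 0 then 1 else 0)"
proof (cases "l = 0")
  case True
  then have "torus_exp l = (\<lambda>x. 1)" by (simp add: fun_eq_iff)
  then show ?thesis using True by simp
next
  case False
  then obtain j where j: "l $ j \<noteq> 0" by (auto simp: vec_eq_iff)
  have p: "partial j (torus_exp l) = (\<lambda>x. (2 * pi * \<i> * of_int (l $ j)) * torus_exp l x)"
    by (rule ext, rule partial_eqI, rule torus_exp_line)
  have "integral (cbox 0 1) (partial j (torus_exp l)) = 0"
    by (rule integral_partial_eq_zero[OF torus_fun_torus_exp])
      (auto simp: p intro!: differentiableI_vector torus_exp_line continuous_intros)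
  then show ?thesis using False j unfolding p by simp
qed

lemma continuous_on_C_k: "C_k r g \<Longrightarrow> continuous_on UNIV g"
  by (cases r) auto

text \<open>The shape \<open>c * f - d * g\<close> is that of the recursion of \<open>D_op\<close>;
  for Fourier coefficients the case \<open>c = d = 1\<close> also handles differences in the lattice
  variable.\<close>

lemma partial_lincomb:
  assumes "\<And>x. (\<lambda>t. f (x + t *\<^sub>R axis j 1)) differentiable (at 0)"
    "\<And>x. (\<lambda>t. g (x + t *\<^sub>R axis j 1)) differentiable (at 0)"
  shows "partial j (\<lambda>x. c * f x - d * g x) = (\<lambda>x. c * partial j f x - d * partial j g x)"
  by (rule ext, rule partial_eqI, rule has_vector_derivative_diff; rule has_vector_derivative_mult_right)
    (auto intro: has_vector_derivative_partial assms)

lemma C_k_lincomb: "C_k r f \<Longrightarrow> C_k r g \<Longrightarrow> C_k r (\<lambda>x. c * f x - d * g x)"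
proof (induction r arbitrary: f g)
  case 0
  then show ?case by (auto intro!: continuous_intros)
next
  case (Suc r)
  then show ?case
    by (auto intro!: continuous_intros differentiable_diff differentiable_mult simp: partial_lincomb)
qed

lemma smooth_torus_lincomb:
  "smooth_torus f \<Longrightarrow> smooth_torus g \<Longrightarrow> smooth_torus (\<lambda>x. c * f x - d * g x)"
  by (auto simp: smooth_torus_def torus_fun_def intro!: C_k_lincomb)

lemma smooth_torusD:
  assumes "smooth_torus g"
  shows "torus_fun g" "continuous_on UNIV g" "(\<lambda>t. g (x + t *\<^sub>R axis j 1)) differentiable (at 0)"
    "continuous_on UNIV (partial j g)" "smooth_torus (partial j g)"
proof -
  have g: "torus_fun g" "C_k r g" for r using assms by (auto simp: smooth_torus_def)
  show "torus_fun g" by (rule g)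
  show "continuous_on UNIV g" by (rule continuous_on_C_k[OF g(2)])
  show "(\<lambda>t. g (x + t *\<^sub>R axis j 1)) differentiable (at 0)" using g(2)[of "Suc 0"] by simp
  show "continuous_on UNIV (partial j g)" using g(2)[of "Suc 0"] by simp
  have "C_k r (partial j g)" for r using g(2)[of "Suc r"] by simp
  then show "smooth_torus (partial j g)" using torus_fun_partial[OF g(1)] by (simp add: smooth_torus_def)
qed

lemma fourier_coeff_lincomb:
  assumes "continuous_on UNIV f" "continuous_on UNIV g"
  shows "fourier_coeff (\<lambda>x. c * f x - d * g x) l = c * fourier_coeff f l - d * fourier_coeff g l"
proof -
  have int: "(\<lambda>x. h x * torus_exp (- l) x) integrable_on cbox 0 1" if "continuous_on UNIV h" for h
    using that by (intro integrable_torus continuous_intros)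
  have "fourier_coeff (\<lambda>x. c * f x - d * g x) l =
      integral (cbox 0 1) (\<lambda>x. c * (f x * torus_exp (- l) x) - d * (g x * torus_exp (- l) x))"
    unfolding fourier_coeff_def by (simp add: algebra_simps)
  also have "\<dots> = integral (cbox 0 1) (\<lambda>x. c * (f x * torus_exp (- l) x))
      - integral (cbox 0 1) (\<lambda>x. d * (g x * torus_exp (- l) x))"
    by (intro Henstock_Kurzweil_Integration.integral_diff integrable_on_mult_right int assms)
  finally show ?thesis by (simp add: fourier_coeff_def)
qed

text \<open>The product rule, applied to \<open>g\<close> times a character, expresses a function of
  integral 0.\<close>

lemma fourier_coeff_partial:
  assumes "smooth_torus g"
  shows "fourier_coeff (partial j g) l = 2 * pi * \<i> * of_int (l $ j) * fourier_coeff g l"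
proof -
  note g = smooth_torusD[OF assms]
  let ?h = "\<lambda>x. g x * torus_exp (- l) x"
  let ?d = "\<lambda>x. g x * ((- (2 * pi * \<i> * of_int (l $ j))) * torus_exp (- l) x) + partial j g x * torus_exp (- l) x"
  have d: "((\<lambda>t. ?h (x + t *\<^sub>R axis j 1)) has_vector_derivative ?d x) (at 0)" for x
    using has_vector_derivative_mult[OF has_vector_derivative_partial[OF g(3)[of x j]] torus_exp_line[of "- l" x j]]
    by simp
  have p: "partial j ?h = ?d" by (rule ext, rule partial_eqI, rule d)
  have int: "(\<lambda>x. h x * torus_exp (- l) x) integrable_on cbox 0 1" if "continuous_on UNIV h" for h
    using that by (intro integrable_torus continuous_intros)
  have "integral (cbox 0 1) (partial j ?h) = 0"
  proof (rule integral_partial_eq_zero)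
    show "torus_fun ?h" by (intro torus_fun_mult g torus_fun_torus_exp)
    show "(\<lambda>t. ?h (x + t *\<^sub>R axis j 1)) differentiable (at 0)" for x
      by (rule differentiableI_vector[OF d])
    show "continuous_on UNIV (partial j ?h)" unfolding p by (intro continuous_intros g)
  qed
  also have "partial j ?h = (\<lambda>x. partial j g x * torus_exp (- l) x -
      (2 * pi * \<i> * of_int (l $ j)) * (g x * torus_exp (- l) x))"
    unfolding p by (simp add: algebra_simps)
  also have "integral (cbox 0 1) \<dots> = integral (cbox 0 1) (\<lambda>x. partial j g x * torus_exp (- l) x)
      - integral (cbox 0 1) (\<lambda>x. (2 * pi * \<i> * of_int (l $ j)) * (g x * torus_exp (- l) x))"
    by (intro Henstock_Kurzweil_Integration.integral_diff integrable_on_mult_right int g)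
  finally show ?thesis by (simp add: fourier_coeff_def)
qed

text \<open>Each step multiplies the coefficient by \<open>l $ j - r\<close>, so the total factor is
  a falling factorial. It vanishes for \<open>0 \<le> l $ j < r\<close>, which is why the order of
  differentiation will have to depend on \<open>l\<close>. Smoothness is proved simultaneously
  because each step integrates the previous function by parts.\<close>

lemma smooth_torus_D_op:
  assumes "smooth_torus g"
  shows "smooth_torus (D_op j r g)"
    and "fourier_coeff (D_op j r g) l = (\<Prod>i<r. of_int (l $ j) - of_nat i) * fourier_coeff g l"
proof (induction r)
  case 0
  { case 1 then show ?case using assms by simp }
  { case 2 then show ?case by simp }
next
  case (Suc r)
  { case 1 show ?case
      unfolding D_op.simps by (intro smooth_torus_lincomb smooth_torusD(5) Suc.IH(1)) }
  { case 2
    have "fourier_coeff (D_op j (Suc r) g) l =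
        1 / (2 * pi * \<i>) * (2 * pi * \<i> * of_int (l $ j) * fourier_coeff (D_op j r g) l)
          - of_nat r * fourier_coeff (D_op j r g) l"
      using smooth_torusD(2,4)[OF Suc.IH(1)]
      by (simp only: D_op.simps fourier_coeff_lincomb fourier_coeff_partial[OF Suc.IH(1)])
    also have "\<dots> = (of_int (l $ j) - of_nat r) * fourier_coeff (D_op j r g) l"
      by (simp add: field_simps)
    finally show ?case using Suc.IH(2) by (simp add: mult.assoc mult.left_commute mult.commute) }
qed

lemma coordinates: "distinct (coordinates :: 'n::finite list)" "set (coordinates :: 'n list) = UNIV"
proof -
  have "\<exists>js :: 'n list. distinct js \<and> set js = UNIV"
    using finite_distinct_list[of "UNIV :: 'n set"] by auto
  from someI_ex[OF this] show "distinct (coordinates :: 'n list)" "set (coordinates :: 'n list) = UNIV"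
    by (simp_all add: coordinates_def)
qed

lemma smooth_torus_D_multi:
  assumes "smooth_torus g"
  shows "smooth_torus (D_multi \<beta> g)"
    and "fourier_coeff (D_multi \<beta> g) l =
      (\<Prod>j\<in>UNIV. \<Prod>i<\<beta> j. of_int (l $ j) - of_nat i) * fourier_coeff g l"
proof -
  have "smooth_torus (foldr (\<lambda>j. D_op j (\<beta> j)) js g) \<and>
    fourier_coeff (foldr (\<lambda>j. D_op j (\<beta> j)) js g) l =
      (\<Prod>j\<leftarrow>js. \<Prod>i<\<beta> j. of_int (l $ j) - of_nat i) * fourier_coeff g l" for js
    by (induction js) (simp_all add: assms smooth_torus_D_op)
  moreover have "(\<Prod>j\<leftarrow>coordinates. f j) = (\<Prod>j\<in>UNIV. f j)" for f :: "'a \<Rightarrow> complex"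
    using prod.distinct_set_conv_list[OF coordinates(1), of f] unfolding coordinates(2) by simp
  ultimately show "smooth_torus (D_multi \<beta> g)"
    "fourier_coeff (D_multi \<beta> g) l =
      (\<Prod>j\<in>UNIV. \<Prod>i<\<beta> j. of_int (l $ j) - of_nat i) * fourier_coeff g l"
    unfolding D_multi_def by (metis (no_types, lifting))+
qed

lemma norm_fourier_coeff_le:
  assumes "continuous_on UNIV g" "\<And>x. cmod (g x) \<le> B"
  shows "cmod (fourier_coeff g l) \<le> B"
proof -
  have "B \<ge> 0" using order_trans[OF norm_ge_zero assms(2)] .
  then have "cmod (fourier_coeff g l) \<le> B * measure lborel (cbox 0 (1 :: real ^ 'a))"
    unfolding fourier_coeff_def using assms
    by (intro has_integral_bound[OF _ integrable_integral] integrable_torus continuous_intros)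
      (auto simp: norm_mult)
  then show ?thesis by simp
qed

lemma has_integral_fourier_coeff:
  "continuous_on UNIV g \<Longrightarrow> ((\<lambda>x. g x * torus_exp (- l) x) has_integral fourier_coeff g l) (cbox 0 1)"
  unfolding fourier_coeff_def by (intro integrable_integral integrable_torus continuous_intros)

section \<open>Orthogonality of the characters and Bessel's inequality\<close>

lemma has_integral_torus_exp: "(torus_exp l has_integral (if l = 0 then 1 else 0)) (cbox 0 1)"
  using integrable_integral[OF integrable_torus[OF continuous_on_torus_exp], of l 0 1]
  by (simp only: integral_torus_exp)

text \<open>Expanding the square and using orthogonality. The coefficients \<open>b\<close> are
  arbitrary since two cases are needed: \<open>b = fourier_coeff h\<close> gives Bessel's
  inequality, and \<open>h = 0\<close> gives the norm of a trigonometric sum.\<close>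

lemma has_integral_norm_sq_diff_trig_sum:
  assumes G: "finite G" and h: "continuous_on UNIV h"
  shows "((\<lambda>x. (cmod (h x - (\<Sum>k\<in>G. b k * torus_exp k x)))\<^sup>2) has_integral
    integral (cbox 0 1) (\<lambda>x. (cmod (h x))\<^sup>2) - 2 * Re (\<Sum>k\<in>G. cnj (b k) * fourier_coeff h k)
      + (\<Sum>k\<in>G. (cmod (b k))\<^sup>2)) (cbox 0 1)"
proof -
  have A: "((\<lambda>x. (cmod (h x))\<^sup>2) has_integral integral (cbox 0 1) (\<lambda>x. (cmod (h x))\<^sup>2)) (cbox 0 1)"
    by (intro integrable_integral integrable_torus continuous_intros h)
  have B: "((\<lambda>x. \<Sum>k\<in>G. cnj (b k) * (h x * torus_exp (- k) x)) has_integral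
      (\<Sum>k\<in>G. cnj (b k) * fourier_coeff h k)) (cbox 0 1)"
    by (intro has_integral_sum has_integral_mult_right has_integral_fourier_coeff h G)
  have C: "((\<lambda>x. \<Sum>k\<in>G. \<Sum>m\<in>G. b k * cnj (b m) * torus_exp (k - m) x) has_integral
      (\<Sum>k\<in>G. \<Sum>m\<in>G. b k * cnj (b m) * (if k - m = 0 then 1 else 0))) (cbox 0 1)"
    by (intro has_integral_sum has_integral_mult_right has_integral_torus_exp G)
  have sq: "(\<Sum>k\<in>G. \<Sum>m\<in>G. b k * cnj (b m) * (if k - m = 0 then 1 else 0)) = of_real (\<Sum>k\<in>G. (cmod (b k))\<^sup>2)"
    using G by (simp add: complex_norm_square if_distrib[of "\<lambda>x. _ * x"] del: of_real_power cong: if_cong)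
  have pointwise: "(cmod (h x))\<^sup>2 - 2 * Re (\<Sum>k\<in>G. cnj (b k) * (h x * torus_exp (- k) x))
      + Re (\<Sum>k\<in>G. \<Sum>m\<in>G. b k * cnj (b m) * torus_exp (k - m) x)
      = (cmod (h x - (\<Sum>k\<in>G. b k * torus_exp k x)))\<^sup>2" for x
  proof -
    define p where "p = (\<Sum>k\<in>G. b k * torus_exp k x)"
    have "(\<Sum>k\<in>G. cnj (b k) * (h x * torus_exp (- k) x)) = h x * cnj p"
      by (simp add: p_def sum_distrib_left torus_exp_minus mult.left_commute)
    moreover have "(\<Sum>k\<in>G. \<Sum>m\<in>G. b k * cnj (b m) * torus_exp (k - m) x) = p * cnj p"
    proof -
      have "torus_exp (k - m) x = torus_exp k x * cnj (torus_exp m x)" for k m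
        using torus_exp_add[of k "- m" x] by (simp add: torus_exp_minus)
      then show ?thesis by (simp add: p_def sum_product mult_ac)
    qed
    ultimately show ?thesis
      by (simp add: cmod_power2 flip: p_def) (simp add: power2_eq_square algebra_simps)
  qed
  have "((\<lambda>x. (cmod (h x))\<^sup>2 - 2 * Re (\<Sum>k\<in>G. cnj (b k) * (h x * torus_exp (- k) x))
      + Re (\<Sum>k\<in>G. \<Sum>m\<in>G. b k * cnj (b m) * torus_exp (k - m) x)) has_integral
      integral (cbox 0 1) (\<lambda>x. (cmod (h x))\<^sup>2) - 2 * Re (\<Sum>k\<in>G. cnj (b k) * fourier_coeff h k)
      + Re (\<Sum>k\<in>G. \<Sum>m\<in>G. b k * cnj (b m) * (if k - m = 0 then 1 else 0))) (cbox 0 1)"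
    by (intro has_integral_add has_integral_diff has_integral_mult_right A has_integral_Re B C)
  then show ?thesis unfolding pointwise sq by simp
qed

lemma bessel_inequality:
  assumes G: "finite G" and h: "continuous_on UNIV h"
  shows "(\<Sum>k\<in>G. (cmod (fourier_coeff h k))\<^sup>2) \<le> integral (cbox 0 1) (\<lambda>x. (cmod (h x))\<^sup>2)"
proof -
  have "Re (\<Sum>k\<in>G. cnj (fourier_coeff h k) * fourier_coeff h k) = (\<Sum>k\<in>G. (cmod (fourier_coeff h k))\<^sup>2)"
    by (simp add: cmod_power2) (simp add: power2_eq_square)
  then show ?thesis
    using has_integral_nonneg[OF has_integral_norm_sq_diff_trig_sum[OF G h, of "fourier_coeff h"]] by simp
qed

text \<open>This is the norm bound for the convolution operator whose symbol \<open>g\<close> does not depend on the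
  lattice point.\<close>

lemma sum_norm_sq_convolution_le:
  assumes g: "continuous_on UNIV g" "\<And>x. cmod (g x) \<le> B" and S: "finite S" and G: "finite G"
  shows "(\<Sum>k\<in>G. (cmod (\<Sum>m\<in>S. fourier_coeff g (m - k) * c m))\<^sup>2) \<le> B\<^sup>2 * (\<Sum>m\<in>S. (cmod (c m))\<^sup>2)"
proof -
  \<comment> \<open>The transform of a family carries the frequencies \<open>- m\<close>;
    accordingly row \<open>k\<close> of the convolution is the coefficient of \<open>g * p\<close>
    at \<open>- k\<close>.\<close>
  define p where "p x = (\<Sum>k\<in>uminus ` S. c (- k) * torus_exp k x)" for x :: "real ^ 'a"
  have p_cont: "continuous_on UNIV p" unfolding p_def by (intro continuous_intros)
  have p_eq: "p x = (\<Sum>m\<in>S. c m * torus_exp (- m) x)" for x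
    unfolding p_def by (subst sum.reindex) auto
  have norm_p: "((\<lambda>x. (cmod (p x))\<^sup>2) has_integral (\<Sum>m\<in>S. (cmod (c m))\<^sup>2)) (cbox 0 1)"
    using has_integral_norm_sq_diff_trig_sum[of "uminus ` S" "\<lambda>_. 0" "\<lambda>k. c (- k)"] S
    by (simp add: fourier_coeff_def sum.reindex flip: p_def)
  have coeff: "fourier_coeff (\<lambda>x. g x * p x) (- k) = (\<Sum>m\<in>S. fourier_coeff g (m - k) * c m)" for k
  proof -
    have "((\<lambda>x. \<Sum>m\<in>S. g x * torus_exp (- (m - k)) x * c m) has_integral
        (\<Sum>m\<in>S. fourier_coeff g (m - k) * c m)) (cbox 0 1)"
      by (intro has_integral_sum has_integral_mult_left has_integral_fourier_coeff g S)
    moreover have "(\<Sum>m\<in>S. g x * torus_exp (- (m - k)) x * c m) = g x * p x * torus_exp (- (- k)) x" for x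
    proof -
      have "torus_exp (- (m - k)) x = torus_exp (- m) x * torus_exp k x" for m
        using torus_exp_add[of "- m" k x] by simp
      then show ?thesis by (simp add: p_eq sum_distrib_left sum_distrib_right mult_ac)
    qed
    ultimately show ?thesis unfolding fourier_coeff_def by (simp add: integral_unique)
  qed
  have "(\<Sum>k\<in>G. (cmod (\<Sum>m\<in>S. fourier_coeff g (m - k) * c m))\<^sup>2)
      = (\<Sum>k\<in>uminus ` G. (cmod (fourier_coeff (\<lambda>x. g x * p x) k))\<^sup>2)"
    by (simp add: sum.reindex coeff)
  also have "\<dots> \<le> integral (cbox 0 1) (\<lambda>x. (cmod (g x * p x))\<^sup>2)"
    using G by (intro bessel_inequality continuous_intros g p_cont) auto
  also have "\<dots> \<le> integral (cbox 0 1) (\<lambda>x. B\<^sup>2 * (cmod (p x))\<^sup>2)"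
    by (intro integral_le integrable_torus continuous_intros g p_cont)
      (auto simp: norm_mult power_mult_distrib intro!: mult_right_mono power_mono g)
  also have "\<dots> = B\<^sup>2 * (\<Sum>m\<in>S. (cmod (c m))\<^sup>2)"
    using norm_p by (intro integral_unique has_integral_mult_right)
  finally show ?thesis .
qed

section \<open>Trigonometric polynomials and a peaked kernel\<close>

definition trig_polynomial :: "(real ^ 'n::finite \<Rightarrow> complex) \<Rightarrow> bool" where
  "trig_polynomial p \<longleftrightarrow> (\<exists>S c. finite S \<and> p = (\<lambda>x. \<Sum>l\<in>S. c l * torus_exp l x))"

lemma trig_polynomial_monom: "trig_polynomial (\<lambda>x. c * torus_exp l x)"
  unfolding trig_polynomial_def by (rule exI[of _ "{l}"], rule exI[of _ "\<lambda>_. c"]) simp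

lemma trig_polynomial_add:
  assumes "trig_polynomial p" "trig_polynomial q"
  shows "trig_polynomial (\<lambda>x. p x + q x)"
proof -
  obtain S c where S: "finite S" "p = (\<lambda>x. \<Sum>l\<in>S. c l * torus_exp l x)"
    using assms(1) by (auto simp: trig_polynomial_def)
  obtain T d where T: "finite T" "q = (\<lambda>x. \<Sum>l\<in>T. d l * torus_exp l x)"
    using assms(2) by (auto simp: trig_polynomial_def)
  have "p x + q x = (\<Sum>l\<in>S \<union> T. ((if l \<in> S then c l else 0) + (if l \<in> T then d l else 0)) * torus_exp l x)" for x
  proof -
    have "p x = (\<Sum>l\<in>S \<union> T. (if l \<in> S then c l else 0) * torus_exp l x)"
      unfolding S(2) using S(1) T(1) by (intro sum.mono_neutral_cong_left) auto
    moreover have "q x = (\<Sum>l\<in>S \<union> T. (if l \<in> T then d l else 0) * torus_exp l x)"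
      unfolding T(2) using S(1) T(1) by (intro sum.mono_neutral_cong_left) auto
    ultimately show ?thesis by (simp add: sum.distrib ring_distribs)
  qed
  then show ?thesis unfolding trig_polynomial_def using S(1) T(1)
    by (intro exI[of _ "S \<union> T"] exI[of _ "\<lambda>l. (if l \<in> S then c l else 0) + (if l \<in> T then d l else 0)"]) auto
qed

lemma trig_polynomial_sum:
  "(\<And>i. i \<in> I \<Longrightarrow> trig_polynomial (p i)) \<Longrightarrow> trig_polynomial (\<lambda>x. \<Sum>i\<in>I. p i x)"
  by (induction I rule: infinite_finite_induct)
    (auto intro: trig_polynomial_add trig_polynomial_monom[of 0, simplified])

lemma trig_polynomial_mult:
  assumes "trig_polynomial p" "trig_polynomial q"
  shows "trig_polynomial (\<lambda>x. p x * q x)"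
proof -
  obtain S c where S: "finite S" "p = (\<lambda>x. \<Sum>l\<in>S. c l * torus_exp l x)"
    using assms(1) by (auto simp: trig_polynomial_def)
  obtain T d where T: "finite T" "q = (\<lambda>x. \<Sum>l\<in>T. d l * torus_exp l x)"
    using assms(2) by (auto simp: trig_polynomial_def)
  have "p x * q x = (\<Sum>l\<in>S. \<Sum>m\<in>T. (c l * d m) * torus_exp (l + m) x)" for x
    by (simp add: S T sum_product torus_exp_add mult_ac)
  then show ?thesis
    by (simp only:) (intro trig_polynomial_sum trig_polynomial_monom)
qed

lemma trig_polynomial_power: "trig_polynomial p \<Longrightarrow> trig_polynomial (\<lambda>x. p x ^ N)"
  by (induction N) (auto intro: trig_polynomial_mult trig_polynomial_monom[of 1 0, simplified])

lemma fourier_coeff_trig_sum: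
  assumes "finite S" "l \<in> S"
  shows "fourier_coeff (\<lambda>x. \<Sum>m\<in>S. c m * torus_exp m x) l = c l"
proof -
  have "((\<lambda>x. \<Sum>m\<in>S. c m * torus_exp (m - l) x) has_integral
      (\<Sum>m\<in>S. c m * (if m - l = 0 then 1 else 0))) (cbox 0 1)"
    by (intro has_integral_sum has_integral_mult_right has_integral_torus_exp assms)
  moreover have "(\<Sum>m\<in>S. c m * torus_exp (m - l) x) = (\<Sum>m\<in>S. c m * torus_exp m x) * torus_exp (- l) x" for x
  proof -
    have "torus_exp (m - l) x = torus_exp m x * torus_exp (- l) x" for m
      using torus_exp_add[of m "- l" x] by simp
    then show ?thesis by (simp only: sum_distrib_right mult.assoc)
  qed
  moreover have "(\<Sum>m\<in>S. c m * (if m - l = 0 then 1 else 0)) = c l"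
    using assms by (simp add: if_distrib[of "\<lambda>x. _ * x"] cong: if_cong)
  ultimately show ?thesis unfolding fourier_coeff_def by (simp add: integral_unique)
qed

text \<open>The sum over \<open>j\<close> of the squared modulus of
  \<open>1 + exp (2 pi i x $ j)\<close>: a nonnegative trigonometric polynomial that attains its
  maximum \<open>4 n\<close> exactly at the lattice points.\<close>

definition peak :: "real ^ 'n::finite \<Rightarrow> real" where
  "peak x = (\<Sum>j\<in>UNIV. 2 + 2 * cos (2 * pi * x $ j))"

lemma peak_nonneg: "0 \<le> peak x"
  unfolding peak_def using cos_ge_minus_one by (intro sum_nonneg) (smt (verit))

lemma continuous_on_peak [continuous_intros]:
  fixes f :: "'a::t2_space \<Rightarrow> real ^ 'n::finite"
  shows "continuous_on A f \<Longrightarrow> continuous_on A (\<lambda>x. peak (f x))"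
  unfolding peak_def by (auto intro!: continuous_intros)

lemma trig_polynomial_peak_power: "trig_polynomial (\<lambda>x :: real ^ 'n::finite. of_real (peak x ^ N))"
proof -
  have peak_eq: "complex_of_real (peak x) = (\<Sum>j\<in>UNIV. 2 * torus_exp 0 x + (1 * torus_exp (axis j 1) x + 1 * torus_exp (- axis j 1) x))" for x :: "real ^ 'n"
  proof -
    have "of_lattice (axis j 1) \<bullet> x = x $ j" for j :: 'n
    proof -
      have "of_lattice (axis j 1) = (axis j 1 :: real ^ 'n)" by (simp add: vec_eq_iff axis_def)
      then show ?thesis by (simp add: inner_axis')
    qed
    then have "torus_exp (axis j 1) x + torus_exp (- axis j 1) x = of_real (2 * cos (2 * pi * x $ j))" for j :: 'n
      unfolding torus_exp_minus by (simp add: torus_exp_def complex_eq_iff)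
    then show ?thesis by (simp add: peak_def)
  qed
  have "trig_polynomial (\<lambda>x :: real ^ 'n. complex_of_real (peak x))"
    unfolding peak_eq by (intro trig_polynomial_sum trig_polynomial_add trig_polynomial_monom)
  from trig_polynomial_power[OF this] show ?thesis by simp
qed

text \<open>Modulo 1, \<open>t\<close> may be replaced by its distance to the nearest integer, which
  lies between \<open>\<delta>\<close> and \<open>1/2\<close>, where the cosine of
  \<open>2 pi\<close> times it decreases.\<close>

lemma cos_far_from_int_le:
  fixes t \<delta> :: real
  assumes \<delta>: "0 < \<delta>" "\<delta> \<le> 1/2" and far: "\<And>m :: int. \<delta> \<le> \<bar>t - of_int m\<bar>"
  shows "cos (2 * pi * t) \<le> cos (2 * pi * \<delta>)"
proof -
  define u where "u = \<bar>t - round t\<bar>"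
  have u: "\<delta> \<le> u" "u \<le> 1/2"
    using far[of "round t"] of_int_round_abs_le[of t] by (auto simp: u_def abs_minus_commute)
  have "cos (2 * pi * t) = cos (2 * pi * (t - round t))"
    using cos_int_2pin[of "round t"] sin_int_2pin[of "round t"]
    by (simp add: right_diff_distrib cos_diff mult_ac)
  also have "\<dots> = cos (2 * pi * u)"
    unfolding u_def using cos_abs_real[of "2 * pi * (t - round t)"] by (simp add: abs_mult)
  also have "\<dots> \<le> cos (2 * pi * \<delta>)"
    using u \<delta> by (intro cos_monotone_0_pi_le) (auto simp: field_simps)
  finally show ?thesis .
qed

text \<open>Averaging \<open>g\<close> against the translate to \<open>y\<close> of the nonnegative trigonometric polynomial
  \<open>peak ^ N\<close>, whose mass concentrates at lattice points, bounds \<open>g y\<close> by the Fourier coefficients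
  without any inversion formula.\<close>

lemma norm_le_sum_fourier_coeff:
  fixes g :: "real ^ 'n::finite \<Rightarrow> complex"
  assumes per: "torus_fun g" and cont: "continuous_on UNIV g"
    and M: "\<And>S. finite S \<Longrightarrow> (\<Sum>l\<in>S. cmod (fourier_coeff g l)) \<le> M"
  shows "cmod (g y) \<le> M"
proof (rule field_le_epsilon)
  fix e :: real assume e: "0 < e"
  let ?n = "real CARD('n)"
  have n: "?n \<ge> 1" using zero_less_card_finite[where 'a = 'n] by linarith
  obtain \<delta>0 where \<delta>0: "0 < \<delta>0" "\<And>x. dist x y < \<delta>0 \<Longrightarrow> dist (g x) (g y) < e"
    using cont e by (metis continuous_on_iff UNIV_I)
  \<comment> \<open>The bound \<open>1/2\<close> serves the cosine estimate; dividing by the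
    dimension turns closeness in each coordinate into closeness in norm.\<close>
  define \<delta> where "\<delta> = min (1/2) (\<delta>0 / ?n)"
  have \<delta>: "0 < \<delta>" "\<delta> \<le> 1/2" "\<delta> * ?n \<le> \<delta>0" using \<delta>0(1) n by (auto simp: \<delta>_def min_def field_simps)
  \<comment> \<open>The largest value of \<open>peak\<close> when one coordinate is at least
    \<open>\<delta>\<close> from the integers and all others contribute their maximum 4.\<close>
  define \<theta> where "\<theta> = 4 * ?n - (2 - 2 * cos (2 * pi * \<delta>))"
  have near_or_far: "cmod (g y - g x) \<le> e \<or> peak (x - y) \<le> \<theta>" for x
  proof (cases "\<exists>j. \<forall>m :: int. \<delta> \<le> \<bar>(x - y) $ j - m\<bar>")
    case True
    then obtain j where j: "\<And>m :: int. \<delta> \<le> \<bar>(x - y) $ j - m\<bar>" by blast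
    have "peak (x - y) = (2 + 2 * cos (2 * pi * (x - y) $ j)) + (\<Sum>i\<in>UNIV - {j}. 2 + 2 * cos (2 * pi * (x - y) $ i))"
      unfolding peak_def by (rule sum.remove) auto
    also have "\<dots> \<le> (2 + 2 * cos (2 * pi * \<delta>)) + (\<Sum>i\<in>UNIV - {j}. 4)"
      using cos_far_from_int_le[OF \<delta>(1,2) j] by (intro add_mono sum_mono) (auto simp: mult.assoc)
    also have "\<dots> = \<theta>" using n by (simp add: \<theta>_def card_Diff_subset of_nat_diff algebra_simps)
    finally show ?thesis ..
  next
    case False
    then have "\<forall>j. \<exists>m :: int. \<bar>(x - y) $ j - m\<bar> < \<delta>" by (auto simp: not_le)
    then obtain m :: "'n \<Rightarrow> int" where m: "\<And>j. \<bar>(x - y) $ j - m j\<bar> < \<delta>" by metis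
    define x' where "x' = x + of_lattice (- (\<chi> j. m j))"
    have "norm (x' - y) \<le> (\<Sum>j\<in>UNIV. \<bar>(x' - y) $ j\<bar>)" by (rule norm_le_l1_cart)
    also have "\<dots> < (\<Sum>j\<in>(UNIV :: 'n set). \<delta>)"
      using m by (intro sum_strict_mono) (auto simp: x'_def algebra_simps)
    also have "\<dots> \<le> \<delta>0" using \<delta>(3) by (simp add: mult.commute)
    finally have "dist (g x') (g y) < e" by (intro \<delta>0) (simp add: dist_norm)
    moreover have "g x' = g x" using per unfolding torus_fun_def x'_def by blast
    ultimately show ?thesis by (simp add: dist_norm norm_minus_commute)
  qed
  have "cos (2 * pi * \<delta>) < 1"
    using \<delta> cos_monotone_0_pi[of 0 "2 * pi * \<delta>"] by (simp add: field_simps)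
  then have \<theta>: "0 \<le> \<theta>" "\<theta> < 4 * ?n"
    unfolding \<theta>_def using n cos_ge_minus_one[of "2 * pi * \<delta>"] by linarith+
  \<comment> \<open>A level strictly between the far values and the maximum. The kernel exceeds it
    on a set of positive volume, so its mass grows at least like \<open>\<theta>' ^ N\<close>, which
    beats the far contribution \<open>\<theta> ^ N\<close>.\<close>
  define \<theta>' where "\<theta>' = (\<theta> + 4 * ?n) / 2"
  have \<theta>': "\<theta> < \<theta>'" "\<theta>' < 4 * ?n" "0 < \<theta>'" using \<theta> by (auto simp: \<theta>'_def)
  have "peak (0 :: real ^ 'n) = 4 * ?n" by (simp add: peak_def)
  moreover have "continuous_on UNIV (peak :: real ^ 'n \<Rightarrow> real)"
    by (intro continuous_on_peak continuous_on_id)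
  ultimately obtain r where r: "0 < r" "\<And>x :: real ^ 'n. dist x 0 < r \<Longrightarrow> dist (peak x) (4 * ?n) < 4 * ?n - \<theta>'"
    using \<theta>'(2) by (metis UNIV_I continuous_on_iff diff_gt_0_iff_gt)
  define s where "s = min 1 (r / (2 * ?n))"
  have s: "0 < s" "s \<le> 1" "s * ?n < r" using r(1) n by (auto simp: s_def min_def field_simps)
  \<comment> \<open>One orthant of a neighbourhood of the origin suffices, and it stays inside the
    unit cube.\<close>
  let ?C = "cbox 0 (\<chi> j. s) :: (real ^ 'n) set"
  have C_sub: "?C \<subseteq> cbox 0 1" using s(2) by (auto simp: mem_box_cart) (meson order_trans)
  have peak_C: "\<theta>' \<le> peak x" if "x \<in> ?C" for x
  proof -
    have "norm x \<le> (\<Sum>j\<in>UNIV. \<bar>x $ j\<bar>)" by (rule norm_le_l1_cart)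
    also have "\<dots> \<le> (\<Sum>j\<in>(UNIV :: 'n set). s)"
      using that by (intro sum_mono) (auto simp: mem_box_cart)
    also have "\<dots> < r" using s by (simp add: mult.commute)
    finally have "dist (peak x) (4 * ?n) < 4 * ?n - \<theta>'" by (intro r) simp
    then show ?thesis by (simp add: dist_real_def)
  qed
  define \<kappa> where "\<kappa> = measure lborel ?C"
  have "\<kappa> > 0" unfolding \<kappa>_def using s by (subst content_cbox_cart) (auto simp: interval_ne_empty_cart intro: less_imp_le)
  have "bounded ((\<lambda>x. g y - g x) ` cbox 0 1)"
    by (intro compact_imp_bounded compact_continuous_image continuous_intros continuous_on_subset[OF cont]) auto
  then obtain D where D: "D > 0" "\<And>x. x \<in> cbox 0 1 \<Longrightarrow> cmod (g y - g x) \<le> D"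
    by (force simp: bounded_pos)
  have main: "cmod (g y) \<le> M + e + D / \<kappa> * (\<theta> / \<theta>') ^ N" for N
  proof -
    let ?V = "\<lambda>x :: real ^ 'n. peak x ^ N"
    obtain S c where S: "finite S" "\<And>x. complex_of_real (?V x) = (\<Sum>l\<in>S. c l * torus_exp l x)"
      using trig_polynomial_peak_power[of N] unfolding trig_polynomial_def fun_eq_iff by blast
    define c0 where "c0 = integral (cbox 0 1) ?V"
    have V_int: "?V integrable_on cbox a b" for a b
      by (intro integrable_torus continuous_intros)
    have c0: "(?V has_integral c0) (cbox 0 1)" unfolding c0_def by (rule integrable_integral[OF V_int])
    \<comment> \<open>Translation multiplies each coefficient by a number and leaves the constant
      one unchanged, so the mass of the kernel is the same at every \<open>y\<close>.\<close>
    have translate: "((\<lambda>x. ?V (x - y)) has_integral c0) (cbox 0 1)" for y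
    proof -
      have "((\<lambda>x. \<Sum>l\<in>S. c l * torus_exp (- l) y * torus_exp l x) has_integral
          (\<Sum>l\<in>S. c l * torus_exp (- l) y * (if l = 0 then 1 else 0))) (cbox 0 1)" for y
        by (intro has_integral_sum has_integral_mult_right has_integral_torus_exp S)
      also have "(\<lambda>x. \<Sum>l\<in>S. c l * torus_exp (- l) y * torus_exp l x) = (\<lambda>x. complex_of_real (?V (x - y)))" for y
        unfolding S(2) by (simp add: torus_exp_diff_arg mult_ac)
      also have "(\<Sum>l\<in>S. c l * torus_exp (- l) y * (if l = 0 then 1 else 0)) = (if 0 \<in> S then c 0 else 0)" for y
        using S(1) by (simp add: if_distrib[of "\<lambda>x. _ * x"] cong: if_cong)
      finally have *: "((\<lambda>x. complex_of_real (?V (x - y))) has_integral (if 0 \<in> S then c 0 else 0)) (cbox 0 1)" for y .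
      have "(if 0 \<in> S then c 0 else 0) = of_real c0"
        by (rule has_integral_unique[OF _ has_integral_of_real[OF c0]]) (use *[of 0] in simp)
      with has_integral_Re[OF *[of y]] show ?thesis by simp
    qed
    \<comment> \<open>For a nonnegative function no Fourier coefficient exceeds the
      integral.\<close>
    have c_le: "cmod (c l) \<le> c0" if "l \<in> S" for l
    proof -
      have "c l = fourier_coeff (\<lambda>x. complex_of_real (?V x)) l"
        unfolding S(2) using fourier_coeff_trig_sum[OF S(1) that, of c] by simp
      also have "cmod \<dots> \<le> c0"
        unfolding fourier_coeff_def c0_def
        by (rule integral_norm_bound_integral)
          (auto intro!: integrable_torus continuous_intros simp: norm_mult norm_power peak_nonneg)
      finally show ?thesis .
    qed
    \<comment> \<open>The average of \<open>g\<close> against the kernel centred at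
      \<open>y\<close>. It is a finite combination of Fourier coefficients of \<open>g\<close>, with
      weights of modulus at most \<open>c0\<close>.\<close>
    define J where "J = (\<Sum>l\<in>S. c l * torus_exp (- l) y * fourier_coeff g (- l))"
    have "((\<lambda>x. \<Sum>l\<in>S. c l * torus_exp (- l) y * (g x * torus_exp (- (- l)) x)) has_integral J) (cbox 0 1)"
      unfolding J_def by (intro has_integral_sum has_integral_mult_right has_integral_fourier_coeff cont S)
    also have "(\<lambda>x. \<Sum>l\<in>S. c l * torus_exp (- l) y * (g x * torus_exp (- (- l)) x)) = (\<lambda>x. g x * of_real (?V (x - y)))"
      unfolding S(2) by (simp add: torus_exp_diff_arg sum_distrib_left mult_ac)
    finally have J: "((\<lambda>x. g x * of_real (?V (x - y))) has_integral J) (cbox 0 1)" .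
    have "cmod J \<le> (\<Sum>l\<in>S. c0 * cmod (fourier_coeff g (- l)))"
      unfolding J_def by (intro sum_norm_le) (auto simp: norm_mult intro!: mult_right_mono c_le)
    also have "\<dots> = c0 * (\<Sum>l\<in>uminus ` S. cmod (fourier_coeff g l))"
      by (simp add: sum.reindex sum_distrib_left)
    also have "\<dots> \<le> c0 * M"
      using S(1) by (intro mult_left_mono M has_integral_nonneg[OF c0]) (auto simp: peak_nonneg)
    finally have J_le: "cmod J \<le> c0 * M" .
    have diff: "((\<lambda>x. (g y - g x) * of_real (?V (x - y))) has_integral g y * of_real c0 - J) (cbox 0 1)"
      using has_integral_diff[OF has_integral_mult_right[OF has_integral_of_real[OF translate[of y]]] J, of "g y"]
      by (simp add: left_diff_distrib)
    have "((\<lambda>x. e * ?V (x - y) + D * \<theta> ^ N) has_integral (e * c0 + D * \<theta> ^ N)) (cbox 0 1)"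
      using has_integral_const[of "D * \<theta> ^ N" 0 "1 :: real ^ 'n"]
      by (intro has_integral_add has_integral_mult_right[OF translate]) simp
    moreover have "cmod ((g y - g x) * of_real (?V (x - y))) \<le> e * ?V (x - y) + D * \<theta> ^ N"
      if x: "x \<in> cbox 0 1" for x
    proof -
      have V0: "0 \<le> ?V (x - y)" by (simp add: peak_nonneg)
      show ?thesis
      proof (cases "cmod (g y - g x) \<le> e")
        case True
        then have "cmod (g y - g x) * ?V (x - y) \<le> e * ?V (x - y)" by (rule mult_right_mono[OF _ V0])
        then show ?thesis using D(1) \<theta>(1) V0 by (auto simp: norm_mult norm_power peak_nonneg add_increasing2)
      next
        case False
        then have "?V (x - y) \<le> \<theta> ^ N" using near_or_far[of x] by (auto intro: power_mono peak_nonneg)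
        then have "cmod (g y - g x) * ?V (x - y) \<le> D * \<theta> ^ N"
          using D(2)[OF x] V0 D(1) by (intro mult_mono) auto
        then show ?thesis using V0 e by (simp add: norm_mult norm_power peak_nonneg add_increasing)
      qed
    qed
    ultimately have "cmod (g y * of_real c0 - J) \<le> e * c0 + D * \<theta> ^ N"
      using integral_norm_bound_integral[of _ "cbox 0 1" "\<lambda>x. e * ?V (x - y) + D * \<theta> ^ N"] diff
      by (metis (no_types, lifting) has_integral_integrable integral_unique)
    then have upper: "cmod (g y) * c0 \<le> (M + e) * c0 + D * \<theta> ^ N"
      using J_le norm_triangle_ineq2[of "g y * of_real c0" J] has_integral_nonneg[OF c0]
      by (simp add: norm_mult peak_nonneg algebra_simps)
    have "\<kappa> * \<theta>' ^ N = integral ?C (\<lambda>x. \<theta>' ^ N)" by (simp add: \<kappa>_def)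
    also have "\<dots> \<le> integral ?C ?V"
      using peak_C \<theta>'(3) by (intro integral_le V_int) (auto intro!: power_mono)
    also have "\<dots> \<le> c0"
      unfolding c0_def by (intro integral_subset_le V_int C_sub) (auto simp: peak_nonneg)
    finally have lower: "\<kappa> * \<theta>' ^ N \<le> c0" .
    have pos: "0 < \<kappa> * \<theta>' ^ N" using \<open>\<kappa> > 0\<close> \<theta>'(3) by simp
    then have c0_pos: "0 < c0" using lower by linarith
    have "cmod (g y) \<le> M + e + D * \<theta> ^ N / c0" using upper c0_pos by (simp add: field_simps)
    also have "D * \<theta> ^ N / c0 \<le> D * \<theta> ^ N / (\<kappa> * \<theta>' ^ N)"
      using lower pos D(1) \<theta>(1) by (intro divide_left_mono) auto
    also have "\<dots> = D / \<kappa> * (\<theta> / \<theta>') ^ N" by (simp add: power_divide)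
    finally show ?thesis by simp
  qed
  have "(\<lambda>N. M + e + D / \<kappa> * (\<theta> / \<theta>') ^ N) \<longlonglongrightarrow> M + e + D / \<kappa> * 0"
    using \<theta> \<theta>' by (intro tendsto_intros LIMSEQ_power_zero) (auto simp: field_simps)
  then show "cmod (g y) \<le> M + e"
    using main by (intro LIMSEQ_le_const[of _ "M + e"]) auto
qed

text \<open>For finite support the transform is a trigonometric sum, so the integral splits into one
  Fourier coefficient of the symbol per column.\<close>

lemma Op_formula_finite_support:
  assumes \<sigma>: "continuous_on UNIV (\<sigma> k)" and S: "finite S" "\<And>m. m \<notin> S \<Longrightarrow> f m = 0"
  shows "Op_formula \<sigma> f k = (\<Sum>m\<in>S. fourier_coeff (\<sigma> k) (m - k) * f m)"
proof -
  have F: "fourier f x = (\<Sum>m\<in>S. torus_exp (- m) x * f m)" for x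
  proof -
    have "fourier f x = (\<Sum>\<^sub>\<infinity>k\<in>S. exp (- 2 * pi * \<i> * (of_lattice k \<bullet> x)) * f k)"
      unfolding fourier_def by (rule infsum_cong_neutral) (auto simp: S(2))
    also have "\<dots> = (\<Sum>m\<in>S. torus_exp (- m) x * f m)"
      using S(1) by (simp add: torus_exp_def cis_conv_exp mult_ac)
    finally show ?thesis .
  qed
  have E: "exp (2 * pi * \<i> * (of_lattice k \<bullet> x)) = torus_exp k x" for x
    by (simp add: torus_exp_def cis_conv_exp mult_ac)
  let ?h = "\<lambda>x. torus_exp k x * \<sigma> k x * (\<Sum>m\<in>S. torus_exp (- m) x * f m)"
  have "continuous_on UNIV ?h" by (intro continuous_intros \<sigma>)
  then have "set_integrable lborel (cbox 0 1) ?h"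
    unfolding set_integrable_def
    by (intro borel_integrable_compact compact_cbox) (rule continuous_on_subset, auto)
  then have "Op_formula \<sigma> f k = integral (cbox 0 1) ?h"
    unfolding Op_formula_def F E by (rule set_borel_integral_eq_integral)
  also have "?h = (\<lambda>x. \<Sum>m\<in>S. (\<sigma> k x * torus_exp (- (m - k)) x) * f m)"
  proof -
    have "torus_exp (- (m - k)) x = torus_exp k x * torus_exp (- m) x" for m x
      using torus_exp_add[of k "- m" x] by simp
    then show ?thesis by (simp add: sum_distrib_left mult_ac)
  qed
  also have "integral (cbox 0 1) \<dots> = (\<Sum>m\<in>S. fourier_coeff (\<sigma> k) (m - k) * f m)"
    by (intro integral_unique has_integral_sum has_integral_mult_left has_integral_fourier_coeff \<sigma> S)
  finally show ?thesis .
qed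

section \<open>The lattice and the symbol class\<close>

lemma lattice_box_eq: "{k :: int ^ 'n::finite. \<forall>j. k $ j \<in> I j} = vec_lambda ` PiE UNIV I"
proof (intro equalityI subsetI)
  fix k :: "int ^ 'n" assume "k \<in> {k. \<forall>j. k $ j \<in> I j}"
  then show "k \<in> vec_lambda ` PiE UNIV I" by (intro image_eqI[of _ _ "vec_nth k"]) auto
qed auto

lemma finite_lattice_box: "(\<And>j. finite (I j)) \<Longrightarrow> finite {k :: int ^ 'n::finite. \<forall>j. k $ j \<in> I j}"
  unfolding lattice_box_eq by (intro finite_imageI finite_PiE) auto

lemma sum_lattice_box:
  fixes v :: "'n::finite \<Rightarrow> int \<Rightarrow> 'c::comm_semiring_1"
  assumes "\<And>j. finite (I j)"
  shows "(\<Sum>k\<in>{k. \<forall>j. k $ j \<in> I j}. \<Prod>j\<in>UNIV. v j (k $ j)) = (\<Prod>j\<in>UNIV. \<Sum>i\<in>I j. v j i)"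
proof -
  have "inj_on vec_lambda (PiE UNIV I)" by (auto intro!: inj_onI simp: vec_lambda_inject)
  then show ?thesis
    unfolding lattice_box_eq by (subst sum.reindex) (simp_all add: prod_sum_PiE assms)
qed

lemma card_lattice_box:
  assumes "\<And>j. finite (I j)"
  shows "card {k :: int ^ 'n::finite. \<forall>j. k $ j \<in> I j} = (\<Prod>j\<in>UNIV. card (I j))"
  using sum_lattice_box[of I "\<lambda>_ _. 1 :: nat"] assms by simp

lemma finite_norm_of_lattice_le: "finite {k :: int ^ 'n::finite. norm (of_lattice k) \<le> R}"
proof (rule finite_subset)
  show "{k :: int ^ 'n. norm (of_lattice k) \<le> R} \<subseteq> {k. \<forall>j. k $ j \<in> {-\<lceil>R\<rceil>..\<lceil>R\<rceil>}}"
  proof (clarsimp, intro conjI)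
    fix k :: "int ^ 'n" and j assume "norm (of_lattice k) \<le> R"
    then have "\<bar>of_int (k $ j)\<bar> \<le> R" using component_le_norm_cart[of "of_lattice k" j] by simp
    then show "- \<lceil>R\<rceil> \<le> k $ j" "k $ j \<le> \<lceil>R\<rceil>" by linarith+
  qed
qed (rule finite_lattice_box, simp)

text \<open>Balls contain finitely many lattice points, so letting the norm tend to infinity means
  excluding finite sets. From here on, exceptional sets are handled by finiteness.\<close>

lemma filtercomap_norm_of_lattice:
  "filtercomap (\<lambda>k :: int ^ 'n::finite. norm (of_lattice k)) at_top = cofinite"
proof (rule filter_eqI)
  fix P :: "int ^ 'n \<Rightarrow> bool"
  show "eventually P (filtercomap (\<lambda>k. norm (of_lattice k)) at_top) \<longleftrightarrow> eventually P cofinite"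
    unfolding eventually_filtercomap_at_top_linorder eventually_cofinite
  proof
    assume "\<exists>N. \<forall>k. norm (of_lattice k) \<ge> N \<longrightarrow> P k"
    then obtain N where N: "\<And>k. norm (of_lattice k) \<ge> N \<Longrightarrow> P k" by blast
    have "{k. \<not> P k} \<subseteq> {k. norm (of_lattice k) \<le> N}" using N linear by blast
    then show "finite {k. \<not> P k}" by (rule finite_subset[OF _ finite_norm_of_lattice_le])
  next
    assume fin: "finite {k. \<not> P k}"
    have "P k" if "norm (of_lattice k) \<ge> 1 + (\<Sum>k\<in>{k. \<not> P k}. norm (of_lattice k))" for k
    proof (rule ccontr)
      assume "\<not> P k"
      then have "norm (of_lattice k) \<le> (\<Sum>k\<in>{k. \<not> P k}. norm (of_lattice k))"
        using member_le_sum[of k "{k. \<not> P k}" "\<lambda>k. norm (of_lattice k)"] fin by simp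
      then show False using that by simp
    qed
    then show "\<exists>N. \<forall>k. norm (of_lattice k) \<ge> N \<longrightarrow> P k" by blast
  qed
qed

lemma infinite_UNIV_lattice: "infinite (UNIV :: (int ^ 'n::finite) set)"
proof
  assume "finite (UNIV :: (int ^ 'n) set)"
  then have "finite ((\<lambda>i. \<chi> j. i) ` (UNIV :: int set) :: (int ^ 'n) set)" by (rule finite_subset[rotated]) auto
  then have "finite (UNIV :: int set)"
    by (rule finite_imageD) (auto intro!: inj_onI simp: vec_eq_iff)
  then show False by simp
qed

text \<open>The unit vectors generate the lattice as a group. Used to pass from unit shifts to
  arbitrary ones.\<close>

lemma lattice_induct_additive:
  fixes h :: "int ^ 'n::finite"
  assumes "P 0" "\<And>j. P (axis j 1)" "\<And>a b. P a \<Longrightarrow> P b \<Longrightarrow> P (a + b)" "\<And>a. P a \<Longrightarrow> P (- a)"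
  shows "P h"
proof -
  have ax_add: "(axis j (a + b) :: int ^ 'n) = axis j a + axis j b" for j a b
    by (simp add: vec_eq_iff axis_def)
  have ax_neg: "(axis j (- a) :: int ^ 'n) = - axis j a" for j a
    by (simp add: vec_eq_iff axis_def)
  have nat: "P (axis j (int i))" for j i
  proof (induction i)
    case 0
    have "(axis j (int 0) :: int ^ 'n) = 0" by (simp add: vec_eq_iff axis_def)
    then show ?case using assms(1) by (simp only:)
  next
    case (Suc i)
    then show ?case using assms(3)[OF assms(2)[of j] Suc] by (simp add: ax_add)
  qed
  have "P (axis j i)" for j i
    using nat[of j "nat i"] assms(4)[OF nat[of j "nat (- i)"]] by (cases "i \<ge> 0") (auto simp: ax_neg)
  then have "P (\<Sum>j\<in>J. axis j (h $ j))" for J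
    by (induction J rule: infinite_finite_induct) (auto intro: assms)
  moreover have "h = (\<Sum>j\<in>UNIV. axis j (h $ j))" by (simp add: vec_eq_iff axis_def)
  ultimately show ?thesis by metis
qed

section \<open>A summable weight on the lattice\<close>

definition int_weight :: "int \<Rightarrow> real" where
  "int_weight i = (if i = 0 \<or> i = 1 then 1 else 1 / (i * (i - 1)))"

lemma int_weight_pos: "0 < int_weight i"
  by (cases "i > 1") (auto simp: int_weight_def mult_neg_neg zero_less_mult_iff)

text \<open>The range is symmetric under \<open>i \<mapsto> 1 - i\<close>, which preserves the
  weight. Enlarging it adds two equal terms \<open>1 / ((N + 1) * (N + 2))\<close>, and these
  telescope.\<close>

lemma sum_int_weight: "(\<Sum>i\<in>{- int N..int N + 1}. int_weight i) = 4 - 2 / (real N + 1)"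
proof (induction N)
  case 0
  have "{0..1 :: int} = {0, 1}" by auto
  then show ?case by (simp add: int_weight_def)
next
  case (Suc N)
  have "{- int (Suc N)..int (Suc N) + 1} = insert (- int N - 1) (insert (int N + 2) {- int N..int N + 1})"
    by auto
  then have "(\<Sum>i\<in>{- int (Suc N)..int (Suc N) + 1}. int_weight i)
      = int_weight (- int N - 1) + (int_weight (int N + 2) + (4 - 2 / (real N + 1)))"
    using Suc by simp
  also have "int_weight (- int N - 1) = 1 / ((real N + 1) * (real N + 2))"
    by (simp add: int_weight_def algebra_simps)
  also have "int_weight (int N + 2) = 1 / ((real N + 1) * (real N + 2))"
    by (simp add: int_weight_def algebra_simps)
  also have "1 / ((real N + 1) * (real N + 2)) = 1 / (real N + 1) - 1 / (real N + 2)"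
    by (simp add: field_simps)
  finally show ?case by simp
qed

definition lattice_weight :: "int ^ 'n::finite \<Rightarrow> real" where
  "lattice_weight l = (\<Prod>j\<in>UNIV. int_weight (l $ j))"

lemma lattice_weight_pos: "0 < lattice_weight l"
  unfolding lattice_weight_def by (intro prod_pos) (simp add: int_weight_pos)

lemma sum_lattice_weight_le:
  assumes "finite L"
  shows "(\<Sum>l\<in>L. lattice_weight (l :: int ^ 'n::finite)) \<le> 4 ^ CARD('n)"
proof -
  define N where "N = nat (\<Sum>l\<in>L. \<Sum>j\<in>UNIV. \<bar>l $ j\<bar>)"
  let ?B = "{k :: int ^ 'n. \<forall>j. k $ j \<in> {- int N..int N + 1}}"
  have "L \<subseteq> ?B"
  proof
    fix l assume l: "l \<in> L"
    have "\<bar>l $ j\<bar> \<le> int N" for j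
    proof -
      have "\<bar>l $ j\<bar> \<le> (\<Sum>j\<in>UNIV. \<bar>l $ j\<bar>)"
        using member_le_sum[of j UNIV "\<lambda>j. \<bar>l $ j\<bar>"] by simp
      also have "\<dots> \<le> (\<Sum>l\<in>L. \<Sum>j\<in>UNIV. \<bar>l $ j\<bar>)"
        using member_le_sum[OF l _ assms, of "\<lambda>l. \<Sum>j\<in>UNIV. \<bar>l $ j\<bar>"] by (simp add: sum_nonneg)
      finally show ?thesis by (simp add: N_def sum_nonneg)
    qed
    then show "l \<in> ?B" by (auto simp: abs_le_iff) (smt (verit))+
  qed
  then have "(\<Sum>l\<in>L. lattice_weight l) \<le> (\<Sum>l\<in>?B. lattice_weight l)"
    by (intro sum_mono2 finite_lattice_box) (auto intro: less_imp_le[OF lattice_weight_pos])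
  also have "\<dots> = (\<Prod>j\<in>(UNIV :: 'n set). \<Sum>i\<in>{- int N..int N + 1}. int_weight i)"
    unfolding lattice_weight_def by (rule sum_lattice_box) simp
  also have "\<dots> \<le> (\<Prod>j\<in>(UNIV :: 'n set). 4)"
    unfolding sum_int_weight by (intro prod_mono) (auto simp: field_simps)
  finally show ?thesis by simp
qed

section \<open>Consequences of the symbol estimates\<close>

lemma diff_multi_zero [simp]: "diff_multi (\<lambda>_. 0) \<tau> = \<tau>"
proof -
  have "foldr (\<lambda>j. diff_op j ^^ 0) js \<tau> = \<tau>" for js by (induction js) auto
  then show ?thesis by (simp add: diff_multi_def)
qed

lemma diff_multi_unit: "diff_multi (\<lambda>i. if i = j then 1 else 0) \<tau> = diff_op j \<tau>"
proof -
  have "foldr (\<lambda>i. diff_op i ^^ (if i = j then 1 else 0)) js \<tau> = (if j \<in> set js then diff_op j \<tau> else \<tau>)"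
    if "distinct js" for js
    using that by (induction js) auto
  from this[OF coordinates(1)] show ?thesis by (simp add: diff_multi_def coordinates(2))
qed

lemma D_multi_zero [simp]: "D_multi (\<lambda>_. 0) g = g"
proof -
  have "foldr (\<lambda>j. D_op j 0) js g = g" for js by (induction js) auto
  then show ?thesis by (simp add: D_multi_def)
qed

lemma S0_smooth: "\<sigma> \<in> S0 \<Longrightarrow> smooth_torus (\<sigma> k)"
  by (simp add: S0_def)

text \<open>At frequency \<open>l\<close> we use \<open>D\<close> of order two exactly in the coordinates where \<open>l $ j * (l $ j - 1)\<close>,
  the factor it produces, does not vanish.\<close>

lemma S0_fourier_coeff_decay:
  fixes \<sigma> :: "int ^ 'n::finite \<Rightarrow> real ^ 'n \<Rightarrow> complex"
  assumes \<sigma>: "\<sigma> \<in> S0"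
  obtains C where "C \<ge> 0" "\<And>k l. cmod (fourier_coeff (\<sigma> k) l) \<le> C * lattice_weight l"
proof -
  define \<beta> where "\<beta> J = (\<lambda>j. if j \<in> J then 2 else 0 :: nat)" for J :: "'n set"
  have "\<exists>C. \<forall>k x. cmod (D_multi (\<beta> J) (\<sigma> k) x) \<le> C" for J
  proof -
    obtain C where "\<forall>k x. cmod (D_multi (\<beta> J) (\<lambda>y. diff_multi (\<lambda>_. 0) (\<lambda>m. \<sigma> m y) k) x)
          \<le> C * (1 + norm (of_lattice k)) powr (- real (\<Sum>j\<in>(UNIV :: 'n set). 0))"
      using \<sigma> unfolding S0_def by blast
    then show ?thesis by (intro exI[of _ C]) (simp add: add_nonneg_eq_0_iff)
  qed
  then obtain C where C: "\<And>J k x. cmod (D_multi (\<beta> J) (\<sigma> k) x) \<le> C J" by metis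
  have C_nonneg: "0 \<le> C J" for J using order_trans[OF norm_ge_zero C] .
  \<comment> \<open>There are only finitely many sets of coordinates, so one constant serves all
    frequencies.\<close>
  define C' where "C' = (\<Sum>J\<in>UNIV. C J)"
  have C': "C J \<le> C'" for J unfolding C'_def by (rule member_le_sum) (auto intro: C_nonneg)
  have "cmod (fourier_coeff (\<sigma> k) l) \<le> C' * lattice_weight l" for k l
  proof -
    define J where "J = {j. l $ j \<noteq> 0 \<and> l $ j \<noteq> 1}"
    have g: "smooth_torus (D_multi (\<beta> J) (\<sigma> k))"
      by (rule smooth_torus_D_multi[OF S0_smooth[OF \<sigma>]])
    \<comment> \<open>In the coordinates of \<open>J\<close> the factor
      \<open>l $ j * (l $ j - 1)\<close> cancels the weight; in the others both are 1.\<close>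
    have w: "cmod (\<Prod>i<\<beta> J j. of_int (l $ j) - of_nat i) * int_weight (l $ j) = 1" for j
    proof (cases "j \<in> J")
      case True
      then have "l $ j \<noteq> 0" "l $ j \<noteq> 1" by (auto simp: J_def)
      then have "0 < l $ j * (l $ j - 1)" by (simp add: zero_less_mult_iff) linarith
      then have pos: "0 < real_of_int (l $ j) * (real_of_int (l $ j) - 1)"
        by (metis of_int_0_less_iff of_int_1 of_int_diff of_int_mult)
      have "(\<Prod>i<2. complex_of_int (l $ j) - of_nat i) = of_real (real_of_int (l $ j) * (real_of_int (l $ j) - 1))"
        by (simp add: numeral_2_eq_2)
      then have "cmod (\<Prod>i<2. complex_of_int (l $ j) - of_nat i) = real_of_int (l $ j) * (real_of_int (l $ j) - 1)"
        using pos by (simp only: norm_of_real abs_of_pos)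
      then show ?thesis using True pos by (simp add: \<beta>_def int_weight_def J_def)
    qed (auto simp: \<beta>_def J_def int_weight_def)
    have "cmod (fourier_coeff (\<sigma> k) l)
      = cmod (fourier_coeff (\<sigma> k) l) * (\<Prod>j\<in>UNIV. cmod (\<Prod>i<\<beta> J j. of_int (l $ j) - of_nat i) * int_weight (l $ j))"
      unfolding w by simp
    also have "\<dots> = cmod (fourier_coeff (D_multi (\<beta> J) (\<sigma> k)) l) * lattice_weight l"
      unfolding smooth_torus_D_multi(2)[OF S0_smooth[OF \<sigma>]] prod.distrib
      by (simp add: norm_mult lattice_weight_def flip: prod_norm)
    also have "\<dots> \<le> C' * lattice_weight l"
      by (intro mult_right_mono norm_fourier_coeff_le smooth_torusD(2)[OF g] order_trans[OF C C']
          less_imp_le[OF lattice_weight_pos])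
    finally show ?thesis .
  qed
  moreover have "0 \<le> C'" using C_nonneg by (simp add: C'_def sum_nonneg)
  ultimately show ?thesis by (rule that[rotated])
qed

text \<open>For a unit shift the bound \<open>C / (1 + norm (of_lattice k))\<close> on the
  difference of the symbol passes to its coefficients, so it can exceed \<open>e\<close> only in a
  ball. Sums and negatives of shifts follow by the triangle inequality and by translating the finite
  exceptional sets.\<close>

lemma S0_fourier_coeff_slowly_varying:
  assumes \<sigma>: "\<sigma> \<in> S0" and e: "0 < e"
  shows "finite {k. e \<le> cmod (fourier_coeff (\<sigma> (k + h)) l - fourier_coeff (\<sigma> k) l)}"
proof -
  let ?a = "\<lambda>k. fourier_coeff (\<sigma> k) l"
  define P where "P h \<longleftrightarrow> (\<forall>e>0. finite {k. e \<le> cmod (?a (k + h) - ?a k)})" for h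
  have "P h"
  proof (rule lattice_induct_additive)
    show "P 0" by (simp add: P_def)
  next
    fix j
    obtain C where C: "\<forall>k x. cmod (D_multi (\<lambda>_. 0) (\<lambda>y. diff_multi (\<lambda>i. if i = j then 1 else 0) (\<lambda>m. \<sigma> m y) k) x)
          \<le> C * (1 + norm (of_lattice k)) powr (- real (\<Sum>i\<in>UNIV. if i = j then 1 else 0))"
      using \<sigma> unfolding S0_def by blast
    have "cmod (1 * \<sigma> (k + axis j 1) x - 1 * \<sigma> k x) \<le> C / (1 + norm (of_lattice k))" for k x
      using C[rule_format, of k x] by (simp add: diff_multi_unit diff_op_def powr_minus divide_inverse)
    then have bound: "cmod (?a (k + axis j 1) - ?a k) \<le> C / (1 + norm (of_lattice k))" for k
      using fourier_coeff_lincomb[of "\<sigma> (k + axis j 1)" "\<sigma> k" 1 1 l] smooth_torusD(2)[OF S0_smooth[OF \<sigma>]]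
        norm_fourier_coeff_le[of "\<lambda>x. 1 * \<sigma> (k + axis j 1) x - 1 * \<sigma> k x" "C / (1 + norm (of_lattice k))" l]
      by (auto intro!: continuous_intros)
    show "P (axis j 1)" unfolding P_def
    proof (intro allI impI)
      fix e :: real assume e: "0 < e"
      have "{k. e \<le> cmod (?a (k + axis j 1) - ?a k)} \<subseteq> {k. norm (of_lattice k) \<le> C / e}"
      proof clarify
        fix k assume "e \<le> cmod (?a (k + axis j 1) - ?a k)"
        then have "e \<le> C / (1 + norm (of_lattice k))" using bound order_trans by blast
        then have "e * (1 + norm (of_lattice k)) \<le> C" by (simp add: pos_le_divide_eq add_pos_nonneg)
        then have "e * norm (of_lattice k) \<le> C" using e by (simp add: algebra_simps)
        then show "norm (of_lattice k) \<le> C / e" using e by (simp add: field_simps)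
      qed
      then show "finite {k. e \<le> cmod (?a (k + axis j 1) - ?a k)}"
        by (rule finite_subset[OF _ finite_norm_of_lattice_le])
    qed
  next
    fix a b assume ab: "P a" "P b"
    show "P (a + b)" unfolding P_def
    proof (intro allI impI)
      fix e :: real assume "0 < e"
      then have "finite ({k. e / 2 \<le> cmod (?a (k + a) - ?a k)} \<union>
          (\<lambda>k. k - a) ` {k. e / 2 \<le> cmod (?a (k + b) - ?a k)})"
        using ab[unfolded P_def, rule_format, of "e / 2"] by (intro finite_UnI finite_imageI) auto
      moreover have "{k. e \<le> cmod (?a (k + (a + b)) - ?a k)} \<subseteq> {k. e / 2 \<le> cmod (?a (k + a) - ?a k)} \<union>
          (\<lambda>k. k - a) ` {k. e / 2 \<le> cmod (?a (k + b) - ?a k)}"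
      proof
        fix k assume k: "k \<in> {k. e \<le> cmod (?a (k + (a + b)) - ?a k)}"
        have "cmod (?a (k + (a + b)) - ?a k) \<le> cmod (?a (k + a + b) - ?a (k + a)) + cmod (?a (k + a) - ?a k)"
          using norm_triangle_ineq[of "?a (k + a + b) - ?a (k + a)" "?a (k + a) - ?a k"] by (simp add: add.assoc)
        then have "e / 2 \<le> cmod (?a (k + a) - ?a k) \<or> e / 2 \<le> cmod (?a (k + a + b) - ?a (k + a))"
          using k by auto
        then show "k \<in> {k. e / 2 \<le> cmod (?a (k + a) - ?a k)} \<union>
            (\<lambda>k. k - a) ` {k. e / 2 \<le> cmod (?a (k + b) - ?a k)}"
          by (auto intro!: image_eqI[of _ _ "k + a"])
      qed
      ultimately show "finite {k. e \<le> cmod (?a (k + (a + b)) - ?a k)}" by (rule finite_subset[rotated])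
    qed
  next
    fix a assume a: "P a"
    show "P (- a)" unfolding P_def
    proof (intro allI impI)
      fix e :: real assume "0 < e"
      then have "finite ((\<lambda>k. k + a) ` {k. e \<le> cmod (?a (k + a) - ?a k)})" using a by (simp add: P_def)
      moreover have "{k. e \<le> cmod (?a (k + - a) - ?a k)} \<subseteq> (\<lambda>k. k + a) ` {k. e \<le> cmod (?a (k + a) - ?a k)}"
        by (auto simp: norm_minus_commute intro!: image_eqI[of _ _ "_ - a"])
      ultimately show "finite {k. e \<le> cmod (?a (k + - a) - ?a k)}" by (rule finite_subset[rotated])
    qed
  qed
  then show ?thesis using e by (simp add: P_def)
qed

text \<open>\<open>L0\<close> nearly attains the supremum of the finite sums, leaving at most
  \<open>e\<close> for any set disjoint from it.\<close>

lemma tail_sum_small: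
  fixes w :: "'a \<Rightarrow> real"
  assumes w: "\<And>l. 0 \<le> w l" "\<And>L. finite L \<Longrightarrow> sum w L \<le> W" and e: "0 < e"
  obtains L0 where "finite L0" "\<And>L. finite L \<Longrightarrow> L \<inter> L0 = {} \<Longrightarrow> sum w L \<le> e"
proof -
  let ?A = "sum w ` {L. finite L}"
  have bdd: "bdd_above ?A" using w(2) by (auto intro!: bdd_aboveI2)
  have "Sup ?A - e < Sup ?A" using e by simp
  then obtain L0 where L0: "finite L0" "Sup ?A - e < sum w L0"
    using less_cSup_iff[OF _ bdd, of "Sup ?A - e"] by auto
  have "sum w L \<le> e" if "finite L" "L \<inter> L0 = {}" for L
  proof -
    have "sum w L + sum w L0 = sum w (L \<union> L0)" using that L0(1) by (simp add: sum.union_disjoint)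
    also have "\<dots> \<le> Sup ?A" using that L0(1) by (intro cSup_upper bdd) auto
    finally show ?thesis using L0(2) by simp
  qed
  then show ?thesis using L0(1) that by blast
qed

text \<open>In a cube of side \<open>N\<close> the proportion of points that stay inside under the
  shift by \<open>l\<close> is the product of \<open>1 - \<bar>l $ j\<bar> / N\<close>, which tends
  to 1.\<close>

lemma folner_cube:
  fixes \<Lambda> :: "(int ^ 'n::finite) set" and \<tau> :: real
  assumes \<Lambda>: "finite \<Lambda>" and \<tau>: "0 < \<tau>"
  obtains Q :: "(int ^ 'n) set" where "finite Q" "Q \<noteq> {}"
    "\<And>l. l \<in> \<Lambda> \<Longrightarrow> real (card {q \<in> Q. q + l \<notin> Q}) \<le> \<tau> * card Q"
proof -
  let ?Q = "\<lambda>N :: nat. {q :: int ^ 'n. \<forall>j. q $ j \<in> {0..<int N}}"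
  have fin: "finite (?Q N)" for N by (rule finite_lattice_box) simp
  have card: "card (?Q N) = (\<Prod>j\<in>(UNIV :: 'n set). N)" for N by (subst card_lattice_box) auto
  have "\<forall>\<^sub>F N in sequentially. real (card {q \<in> ?Q N. q + l \<notin> ?Q N}) \<le> \<tau> * card (?Q N)" for l
  proof -
    have "(\<lambda>N. \<Prod>j\<in>UNIV. 1 - real_of_int \<bar>l $ j\<bar> / real N) \<longlonglongrightarrow> (\<Prod>j\<in>(UNIV :: 'n set). 1 - 0)"
      by (intro tendsto_prod tendsto_diff tendsto_const lim_const_over_n)
    then have "\<forall>\<^sub>F N in sequentially. 1 - \<tau> < (\<Prod>j\<in>UNIV. 1 - real_of_int \<bar>l $ j\<bar> / real N)"
      using \<tau> by (intro order_tendstoD) auto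
    \<comment> \<open>Then \<open>N - \<bar>l $ j\<bar>\<close> is nonnegative and is the true
      length of the interval \<open>?I j\<close> below, without truncation.\<close>
    moreover have "\<forall>\<^sub>F N in sequentially. \<forall>j\<in>UNIV. nat \<bar>l $ j\<bar> \<le> N"
      by (intro eventually_ball_finite) (auto intro: eventually_ge_at_top)
    ultimately show ?thesis using eventually_gt_at_top[of 0]
    proof eventually_elim
      case (elim N)
      let ?I = "\<lambda>j. {max 0 (- (l $ j))..<min (int N) (int N - l $ j)}"
      have "1 - \<tau> \<le> (\<Prod>j\<in>UNIV. 1 - real_of_int \<bar>l $ j\<bar> / real N)" using elim by simp
      also have "\<dots> = (\<Prod>j\<in>UNIV. real (card (?I j)) / real N)"
      proof (rule prod.cong[OF refl])
        fix j
        have "card (?I j) = nat (int N - \<bar>l $ j\<bar>)" by simp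
        moreover have "\<bar>l $ j\<bar> \<le> int N" using elim(2) by (simp add: nat_le_iff)
        ultimately have "real (card (?I j)) = real N - real_of_int \<bar>l $ j\<bar>" by simp
        then show "1 - real_of_int \<bar>l $ j\<bar> / real N = real (card (?I j)) / real N"
          using elim(3) by (simp only: diff_divide_distrib) simp
      qed
      also have "\<dots> = real (card {q :: int ^ 'n. \<forall>j. q $ j \<in> ?I j}) / card (?Q N)"
        by (simp only: card_lattice_box finite_atLeastLessThan_int card_atLeastLessThan_int of_nat_prod
            prod_dividef diff_0_right nat_int)
      also have "{q :: int ^ 'n. \<forall>j. q $ j \<in> ?I j} = ?Q N - {q \<in> ?Q N. q + l \<notin> ?Q N}"
      proof -
        have "x \<in> {max 0 (- y)..<min (int N) (int N - y)} \<longleftrightarrow> x \<in> {0..<int N} \<and> x + y \<in> {0..<int N}" for x y :: int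
          by auto
        then show ?thesis by (simp only:) auto
      qed
      also have "real (card \<dots>) = card (?Q N) - real (card {q \<in> ?Q N. q + l \<notin> ?Q N})"
        using fin[of N] by (subst card_Diff_subset) (auto intro!: of_nat_diff card_mono)
      finally have "(1 - \<tau>) \<le> (card (?Q N) - real (card {q \<in> ?Q N. q + l \<notin> ?Q N})) / card (?Q N)" .
      moreover have "0 < card (?Q N)" using elim(3) unfolding card by simp
      ultimately show ?case by (simp add: field_simps)
    qed
  qed
  then have "\<forall>\<^sub>F N in sequentially. \<forall>l\<in>\<Lambda>. real (card {q \<in> ?Q N. q + l \<notin> ?Q N}) \<le> \<tau> * card (?Q N)"
    using \<Lambda> by (intro eventually_ball_finite) auto
  from eventually_conj[OF this eventually_gt_at_top[of 0]]
  obtain N where N: "\<forall>l\<in>\<Lambda>. real (card {q \<in> ?Q N. q + l \<notin> ?Q N}) \<le> \<tau> * card (?Q N)" "0 < N"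
    by (auto dest: eventually_happens)
  have "card (?Q N) \<noteq> 0" using N(2) unfolding card by simp
  then have "?Q N \<noteq> {}" by (metis card.empty)
  then show ?thesis using that[OF fin] N(1) by blast
qed

section \<open>Localisation\<close>

lemma L2_set_sum_le: "L2_set (\<lambda>i. \<Sum>l\<in>L. g l i) A \<le> (\<Sum>l\<in>L. L2_set (g l) A)"
proof (induction L rule: infinite_finite_induct)
  case (insert l L)
  have "L2_set (\<lambda>i. \<Sum>l\<in>insert l L. g l i) A \<le> L2_set (g l) A + L2_set (\<lambda>i. \<Sum>l\<in>L. g l i) A"
    using insert.hyps L2_set_triangle_ineq by simp
  then show ?case using insert by simp
qed (simp_all add: L2_set_0')

lemma L2_set_square: "(L2_set f A)\<^sup>2 = (\<Sum>i\<in>A. (f i)\<^sup>2)"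
  by (simp add: L2_set_def sum_nonneg)

lemma L2_set_le_iff: "0 \<le> C \<Longrightarrow> L2_set f A \<le> C \<longleftrightarrow> (\<Sum>i\<in>A. (f i)\<^sup>2) \<le> C\<^sup>2"
  by (metis L2_set_square L2_set_nonneg power2_le_imp_le power_mono)

lemma L2_set_norm_triangle_le:
  "L2_set (\<lambda>i. norm (f i + g i)) A \<le> L2_set (\<lambda>i. norm (f i)) A + L2_set (\<lambda>i. norm (g i)) A"
  by (rule order_trans[OF L2_set_mono L2_set_triangle_ineq]) (auto intro: norm_triangle_ineq)

text \<open>Rewrites a row sum by diagonals \<open>l = m - k\<close>. The set of diagonals does not
  depend on the row, so the triangle inequality for \<open>L2_set\<close> can be applied diagonal by
  diagonal.\<close>

lemma sum_reindex_shift: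
  fixes h :: "'a::ab_group_add \<Rightarrow> 'b::comm_monoid_add"
  assumes "finite S" "finite G" "k \<in> G"
  shows "(\<Sum>l\<in>(\<lambda>(m, k). m - k) ` (S \<times> G). if k + l \<in> S then h (k + l) else 0) = sum h S"
proof -
  let ?L = "(\<lambda>(m, k). m - k) ` (S \<times> G)"
  have "(\<Sum>l\<in>?L. if k + l \<in> S then h (k + l) else 0)
      = (\<Sum>l\<in>(\<lambda>m. m - k) ` S. if k + l \<in> S then h (k + l) else 0)"
    using assms by (intro sum.mono_neutral_right)
      (auto simp: image_iff; metis add.commute add_diff_cancel_left')+
  also have "\<dots> = sum h S" by (subst sum.reindex) (auto simp: inj_on_def)
  finally show ?thesis .
qed

text \<open>Localisation: with \<open>ind\<close> the indicator of a large cube \<open>Q\<close>, the operator with matrix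
  \<open>a k (m - k)\<close> is compared, inside each translate \<open>p + Q\<close>, with the convolution operator frozen at \<open>p\<close>.
  Summing over \<open>p\<close> restores the full norm up to the factor \<open>card Q\<close>.\<close>

lemma slowly_varying_matrix_norm_bound:
  fixes a :: "int ^ 'n::finite \<Rightarrow> int ^ 'n \<Rightarrow> complex"
  assumes w: "\<And>k l. cmod (a k l) \<le> w l" "\<And>L. finite L \<Longrightarrow> sum w L \<le> W"
    and slow: "\<And>h l e. 0 < e \<Longrightarrow> finite {k. e \<le> cmod (a (k + h) l - a k l)}"
    and frozen: "finite {p. \<not> (\<forall>S G c. finite S \<longrightarrow> finite G \<longrightarrow>
      (\<Sum>k\<in>G. (cmod (\<Sum>m\<in>S. a p (m - k) * c m))\<^sup>2) \<le> D\<^sup>2 * (\<Sum>m\<in>S. (cmod (c m))\<^sup>2))}"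
    and D: "0 \<le> D" and \<epsilon>: "0 < \<epsilon>"
  obtains F where "finite F"
    "\<And>S G f. finite S \<Longrightarrow> finite G \<Longrightarrow> S \<inter> F = {} \<Longrightarrow>
      L2_set (\<lambda>k. cmod (\<Sum>m\<in>S. a k (m - k) * f m)) G \<le> (D + \<epsilon>) * L2_set (\<lambda>m. cmod (f m)) S"
proof -
  have w0: "0 \<le> w l" for l using order_trans[OF norm_ge_zero w(1)] .
  have wW: "w l \<le> W" for l using w(2)[of "{l}"] by simp
  have W0: "0 \<le> W" using w0 wW order_trans by blast
  obtain L0 where L0: "finite L0" "\<And>L. finite L \<Longrightarrow> L \<inter> L0 = {} \<Longrightarrow> sum w L \<le> \<epsilon> / 4"
    using tail_sum_small[OF w0 w(2), of "\<epsilon> / 4"] \<epsilon> by auto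
  \<comment> \<open>Each diagonal in \<open>L0\<close> will cost \<open>2 * \<delta>\<close>, in
    total at most \<open>\<epsilon> / 2\<close>; the tail costs twice \<open>\<epsilon> / 4\<close>.
    Adding 1 covers an empty \<open>L0\<close>.\<close>
  define \<delta> where "\<delta> = \<epsilon> / (4 * (real (card L0) + 1))"
  have \<delta>: "0 < \<delta>" using \<epsilon> by (simp add: \<delta>_def)
  have \<delta>_card: "2 * \<delta> * card L0 \<le> \<epsilon> / 2" using \<epsilon> by (simp add: \<delta>_def field_simps)
  \<comment> \<open>At most a fraction \<open>2 * \<tau>\<close> of the windows separates
    \<open>k\<close> from \<open>k + l\<close>, each at squared cost up to \<open>W\<^sup>2\<close>;
    the total must not exceed \<open>\<delta>\<^sup>2\<close>.\<close>
  define \<tau> where "\<tau> = \<delta>\<^sup>2 / (W\<^sup>2 + 1) / 2"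
  have \<tau>: "0 < \<tau>" using \<delta> W0 by (simp add: \<tau>_def add_nonneg_pos)
  have \<tau>_le: "w l * w l * (2 * \<tau>) \<le> \<delta>\<^sup>2" for l
  proof -
    have \<tau>2: "2 * \<tau> = \<delta>\<^sup>2 / (W\<^sup>2 + 1)"
      unfolding \<tau>_def by (rule mult_2[THEN trans], rule field_sum_of_halves)
    have "w l * w l * (2 * \<tau>) \<le> W * W * (2 * \<tau>)"
      using w0 wW \<tau> W0 by (intro mult_right_mono mult_mono) auto
    also have "\<dots> = W * W * (\<delta>\<^sup>2 / (W\<^sup>2 + 1))" by (simp only: \<tau>2)
    also have "\<dots> = \<delta>\<^sup>2 * (W\<^sup>2 / (W\<^sup>2 + 1))"
      by (simp only: power2_eq_square[of W] times_divide_eq_right mult.commute)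
    also have "\<dots> \<le> \<delta>\<^sup>2 * 1"
      by (intro mult_left_mono) (auto simp: divide_le_eq_1 add_nonneg_pos)
    finally show ?thesis by simp
  qed
  obtain Q :: "(int ^ 'n) set" where Q: "finite Q" "Q \<noteq> {}"
    "\<And>l. l \<in> L0 \<union> uminus ` L0 \<Longrightarrow> real (card {q \<in> Q. q + l \<notin> Q}) \<le> \<tau> * card Q"
    using folner_cube[of "L0 \<union> uminus ` L0" \<tau>] L0(1) \<tau> by auto
  define q where "q = sqrt (card Q)"
  have q: "0 < q" "q\<^sup>2 = card Q" using Q(1,2) by (auto simp: q_def card_gt_0_iff)
  define ind :: "int ^ 'n \<Rightarrow> complex" where "ind x = (if x \<in> Q then 1 else 0)" for x
  define bad where "bad = {p. \<not> (\<forall>S G c. finite S \<longrightarrow> finite G \<longrightarrow>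
      (\<Sum>k\<in>G. (cmod (\<Sum>m\<in>S. a p (m - k) * c m))\<^sup>2) \<le> D\<^sup>2 * (\<Sum>m\<in>S. (cmod (c m))\<^sup>2))}
    \<union> (\<Union>l\<in>L0. \<Union>x\<in>Q. {p. \<delta> \<le> cmod (a (p + (x - l)) l - a p l)})"
  define F where "F = (\<lambda>(p, x). p + x) ` (bad \<times> Q)"
  have "finite bad" unfolding bad_def using frozen slow \<delta> L0(1) Q(1) by (intro finite_UnI finite_UN_I) auto
  then have "finite F" unfolding F_def using Q(1) by auto
  moreover
  have "L2_set (\<lambda>k. cmod (\<Sum>m\<in>S. a k (m - k) * f m)) G \<le> (D + \<epsilon>) * L2_set (\<lambda>m. cmod (f m)) S"
    if S: "finite S" and G: "finite G" and SF: "S \<inter> F = {}" for S G f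
  proof -
    define N where "N = L2_set (\<lambda>m. cmod (f m)) S"
    have N0: "0 \<le> N" by (simp add: N_def)
    have N2: "N\<^sup>2 = (\<Sum>m\<in>S. (cmod (f m))\<^sup>2)" by (simp add: N_def L2_set_square)
    \<comment> \<open>All windows that meet a relevant row or column, so that each of these points
      is counted exactly \<open>card Q\<close> times.\<close>
    define E where "E = (\<lambda>(k, x). k - x) ` ((G \<union> S) \<times> Q)"
    have E: "finite E" using S G Q(1) by (auto simp: E_def)
    have count: "card {p \<in> E. k - p \<in> Q} = card Q" if "k \<in> G \<union> S" for k
    proof -
      have "{p \<in> E. k - p \<in> Q} = (\<lambda>x. k - x) ` Q"
        using that by (force simp: E_def image_iff)
      then show ?thesis by (simp add: card_image inj_on_def)
    qed
    have sum_ind: "(\<Sum>p\<in>E. (cmod (ind (k - p)))\<^sup>2) = q\<^sup>2" if "k \<in> G \<union> S" for k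
    proof -
      have "(\<Sum>p\<in>E. (cmod (ind (k - p)))\<^sup>2) = (\<Sum>p\<in>E. if k - p \<in> Q then 1 else 0)"
        by (rule sum.cong) (auto simp: ind_def)
      also have "\<dots> = card {p \<in> E. k - p \<in> Q}" using E by (simp flip: sum.inter_filter)
      finally show ?thesis using count[OF that] q(2) by simp
    qed
    have good: "p \<notin> bad" if "m \<in> S" "m - p \<in> Q" for p m
      using SF that unfolding F_def by (force simp: image_iff)
    define X where "X = (\<lambda>(p, k). \<Sum>m\<in>S. a p (m - k) * (ind (m - p) * f m))"
    define Y where "Y = (\<lambda>(p, k). \<Sum>m\<in>S. (ind (k - p) * a k (m - k) - ind (m - p) * a p (m - k)) * f m)"
    have "L2_set (\<lambda>i. cmod (X i)) (E \<times> G) \<le> D * q * N"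
    proof (subst L2_set_le_iff)
      have row: "(\<Sum>k\<in>G. (cmod (X (p, k)))\<^sup>2) \<le> D\<^sup>2 * (\<Sum>m\<in>S. (cmod (ind (m - p) * f m))\<^sup>2)" if "p \<in> E" for p
      proof (cases "p \<in> bad")
        case True
        then have zero: "ind (m - p) = 0" if "m \<in> S" for m using good[OF that, of p] by (auto simp: ind_def)
        have "X (p, k) = 0" for k unfolding X_def by (auto intro!: sum.neutral zero)
        then show ?thesis by (simp add: sum_nonneg)
      next
        case False
        then have "\<forall>S G c. finite S \<longrightarrow> finite G \<longrightarrow>
          (\<Sum>k\<in>G. (cmod (\<Sum>m\<in>S. a p (m - k) * c m))\<^sup>2) \<le> D\<^sup>2 * (\<Sum>m\<in>S. (cmod (c m))\<^sup>2)"
          by (simp add: bad_def)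
        from this[rule_format, OF S G, of "\<lambda>m. ind (m - p) * f m"] show ?thesis by (simp add: X_def)
      qed
      have "(\<Sum>i\<in>E \<times> G. (cmod (X i))\<^sup>2) = (\<Sum>p\<in>E. \<Sum>k\<in>G. (cmod (X (p, k)))\<^sup>2)"
        by (simp add: sum.cartesian_product case_prod_beta)
      also have "\<dots> \<le> (\<Sum>p\<in>E. D\<^sup>2 * (\<Sum>m\<in>S. (cmod (ind (m - p) * f m))\<^sup>2))"
        by (rule sum_mono[OF row])
      also have "\<dots> = D\<^sup>2 * (\<Sum>p\<in>E. \<Sum>m\<in>S. (cmod (ind (m - p)))\<^sup>2 * (cmod (f m))\<^sup>2)"
        by (simp add: sum_distrib_left norm_mult power_mult_distrib)
      also have "\<dots> = D\<^sup>2 * (\<Sum>m\<in>S. (\<Sum>p\<in>E. (cmod (ind (m - p)))\<^sup>2) * (cmod (f m))\<^sup>2)"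
        by (subst sum.swap) (simp add: sum_distrib_right)
      also have "\<dots> = (D * q * N)\<^sup>2"
        by (simp add: sum_ind N2 power_mult_distrib sum_distrib_left mult_ac)
      finally show "(\<Sum>i\<in>E \<times> G. (cmod (X i))\<^sup>2) \<le> (D * q * N)\<^sup>2" .
    qed (use D q N0 in auto)
    moreover have "L2_set (\<lambda>i. cmod (Y i)) (E \<times> G) \<le> \<epsilon> * q * N"
    proof -
      define \<Lambda> where "\<Lambda> = (\<lambda>(m, k). m - k) ` (S \<times> G)"
      have \<Lambda>: "finite \<Lambda>" using S G by (auto simp: \<Lambda>_def)
      define d where "d l k p = ind (k - p) * a k l - ind (k + l - p) * a p l" for l k p
      define Z where "Z l = (\<lambda>(p, k). if k + l \<in> S then d l k p * f (k + l) else 0)" for l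
      have Y_eq: "Y (p, k) = (\<Sum>l\<in>\<Lambda>. Z l (p, k))" if "k \<in> G" for p k
        using sum_reindex_shift[OF S G that, of "\<lambda>m. (ind (k - p) * a k (m - k) - ind (m - p) * a p (m - k)) * f m"]
        by (simp add: Y_def Z_def d_def \<Lambda>_def cong: if_cong)
      define \<eta> where "\<eta> l = (if l \<in> L0 then 2 * \<delta> else 2 * w l)" for l
      have \<eta>0: "0 \<le> \<eta> l" for l using \<delta> w0 by (simp add: \<eta>_def)
      have d_le: "L2_set (\<lambda>p. cmod (d l k p)) E \<le> \<eta> l * q" if k: "k \<in> G" "k + l \<in> S" for l k
      proof -
        have L2_ind: "L2_set (\<lambda>p. cmod (ind (x - p)) * C) E = q * C" if "x \<in> G \<union> S" "0 \<le> C" for x C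
          using sum_ind[OF that(1)] q(1) that(2)
          by (simp add: L2_set_def power_mult_distrib real_sqrt_mult flip: sum_distrib_right)
        show ?thesis
        proof (cases "l \<in> L0")
          case False
          \<comment> \<open>Outside \<open>L0\<close> no cancellation is sought: both terms are
            bounded by \<open>w l\<close>.\<close>
          have "L2_set (\<lambda>p. cmod (d l k p)) E \<le> L2_set (\<lambda>p. cmod (ind (k - p)) * w l + cmod (ind (k + l - p)) * w l) E"
            unfolding d_def
            by (intro L2_set_mono order_trans[OF norm_triangle_ineq4] add_mono)
              (auto simp: norm_mult intro!: mult_left_mono w)
          also have "\<dots> \<le> L2_set (\<lambda>p. cmod (ind (k - p)) * w l) E + L2_set (\<lambda>p. cmod (ind (k + l - p)) * w l) E"
            by (rule L2_set_triangle_ineq)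
          also have "\<dots> = 2 * w l * q" using k by (simp add: L2_ind w0)
          finally show ?thesis using False by (simp add: \<eta>_def)
        next
          case True
          \<comment> \<open>An edge term, nonzero only if the window separates \<open>k\<close> from
            \<open>k + l\<close>, and a variation term. The latter carries the window at the column
            \<open>k + l \<in> S\<close>, which guarantees \<open>p \<notin> bad\<close> wherever it
            does not vanish.\<close>
          have split: "d l k p = (ind (k - p) - ind (k + l - p)) * a k l + ind (k + l - p) * (a k l - a p l)" for p
            by (simp add: d_def algebra_simps)
          have "L2_set (\<lambda>p. cmod ((ind (k - p) - ind (k + l - p)) * a k l)) E \<le> \<delta> * q"
          proof (subst L2_set_le_iff)
            have A: "{p \<in> E. (k - p \<in> Q) \<noteq> (k + l - p \<in> Q)} \<subseteq>
                (\<lambda>x. k - x) ` {x \<in> Q. x + l \<notin> Q} \<union> (\<lambda>x. k + l - x) ` {x \<in> Q. x + - l \<notin> Q}"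
              (is "?A \<subseteq> _ ` ?B1 \<union> _ ` ?B2")
            proof
              fix p assume p: "p \<in> ?A"
              show "p \<in> (\<lambda>x. k - x) ` ?B1 \<union> (\<lambda>x. k + l - x) ` ?B2"
              proof (cases "k - p \<in> Q")
                case True
                then have "k - p \<in> ?B1" "p = k - (k - p)" using p by (auto simp: algebra_simps)
                then show ?thesis by blast
              next
                case False
                then have "k + l - p \<in> ?B2" "p = k + l - (k + l - p)" using p by (auto simp: algebra_simps)
                then show ?thesis by blast
              qed
            qed
            have "card ?A \<le> card ((\<lambda>x. k - x) ` ?B1) + card ((\<lambda>x. k + l - x) ` ?B2)"
              using Q(1) by (intro order_trans[OF card_mono[OF _ A] card_Un_le]) auto
            also have "\<dots> \<le> card ?B1 + card ?B2"
              using Q(1) by (intro add_mono card_image_le) auto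
            finally have cardA: "real (card ?A) \<le> 2 * \<tau> * card Q"
              using Q(3)[of l] Q(3)[of "- l"] True by simp
            have "(\<Sum>p\<in>E. (cmod ((ind (k - p) - ind (k + l - p)) * a k l))\<^sup>2)
                \<le> (\<Sum>p\<in>E. if (k - p \<in> Q) \<noteq> (k + l - p \<in> Q) then (w l)\<^sup>2 else 0)"
              by (rule sum_mono) (auto simp: ind_def norm_mult intro!: power_mono w)
            also have "\<dots> = card ?A * (w l)\<^sup>2" using E by (simp flip: sum.inter_filter)
            also have "\<dots> \<le> 2 * \<tau> * card Q * (w l)\<^sup>2" by (rule mult_right_mono[OF cardA]) simp
            also have "\<dots> = (w l * w l * (2 * \<tau>)) * q\<^sup>2" unfolding q(2) by (simp add: power2_eq_square)
            also have "\<dots> \<le> \<delta>\<^sup>2 * q\<^sup>2" by (intro mult_right_mono \<tau>_le) simp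
            finally show "(\<Sum>p\<in>E. (cmod ((ind (k - p) - ind (k + l - p)) * a k l))\<^sup>2) \<le> (\<delta> * q)\<^sup>2"
              by (simp add: power_mult_distrib)
          qed (use \<delta> q in auto)
          moreover have "L2_set (\<lambda>p. cmod (ind (k + l - p) * (a k l - a p l))) E \<le> \<delta> * q"
          proof -
            have "cmod (ind (k + l - p) * (a k l - a p l)) \<le> cmod (ind (k + l - p)) * \<delta>" for p
            proof (cases "k + l - p \<in> Q")
              case True
              have "p \<notin> bad" using good[OF k(2) True] .
              then have "\<not> \<delta> \<le> cmod (a (p + ((k + l - p) - l)) l - a p l)"
                using \<open>l \<in> L0\<close> True unfolding bad_def by blast
              then show ?thesis using True by (simp add: ind_def)
            qed (simp add: ind_def)
            then have "L2_set (\<lambda>p. cmod (ind (k + l - p) * (a k l - a p l))) E \<le> L2_set (\<lambda>p. cmod (ind (k + l - p)) * \<delta>) E"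
              by (intro L2_set_mono) auto
            also have "\<dots> = \<delta> * q" using k \<delta> by (simp add: L2_ind)
            finally show ?thesis .
          qed
          ultimately have "L2_set (\<lambda>p. cmod (d l k p)) E \<le> \<delta> * q + \<delta> * q"
            unfolding split by (intro order_trans[OF L2_set_norm_triangle_le] add_mono)
          then show ?thesis using True by (simp add: \<eta>_def)
        qed
      qed
      have Z_le: "L2_set (\<lambda>i. cmod (Z l i)) (E \<times> G) \<le> \<eta> l * q * N" for l
      proof (subst L2_set_le_iff)
        let ?G = "{k \<in> G. k + l \<in> S}"
        have "(\<Sum>i\<in>E \<times> G. (cmod (Z l i))\<^sup>2) = (\<Sum>k\<in>G. \<Sum>p\<in>E. (cmod (Z l (p, k)))\<^sup>2)"
          by (subst sum.swap) (simp add: sum.cartesian_product case_prod_beta)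
        also have "\<dots> = (\<Sum>k\<in>?G. \<Sum>p\<in>E. (cmod (d l k p))\<^sup>2 * (cmod (f (k + l)))\<^sup>2)"
          using G E by (intro sum.mono_neutral_cong_right) (auto simp: Z_def norm_mult power_mult_distrib)
        also have "\<dots> = (\<Sum>k\<in>?G. (L2_set (\<lambda>p. cmod (d l k p)) E)\<^sup>2 * (cmod (f (k + l)))\<^sup>2)"
          by (simp add: L2_set_square sum_distrib_right)
        also have "\<dots> \<le> (\<Sum>k\<in>?G. (\<eta> l * q)\<^sup>2 * (cmod (f (k + l)))\<^sup>2)"
          by (intro sum_mono mult_right_mono power_mono d_le) auto
        also have "\<dots> = (\<eta> l * q)\<^sup>2 * (\<Sum>m\<in>(\<lambda>k. k + l) ` ?G. (cmod (f m))\<^sup>2)"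
          by (subst sum.reindex) (simp_all add: sum_distrib_left)
        also have "\<dots> \<le> (\<eta> l * q)\<^sup>2 * (\<Sum>m\<in>S. (cmod (f m))\<^sup>2)"
          using S by (intro mult_left_mono sum_mono2) auto
        also have "\<dots> = (\<eta> l * q * N)\<^sup>2" by (simp add: N2 power_mult_distrib)
        finally show "(\<Sum>i\<in>E \<times> G. (cmod (Z l i))\<^sup>2) \<le> (\<eta> l * q * N)\<^sup>2" .
      qed (use \<eta>0 q N0 in auto)
      have "L2_set (\<lambda>i. cmod (Y i)) (E \<times> G) \<le> L2_set (\<lambda>i. \<Sum>l\<in>\<Lambda>. cmod (Z l i)) (E \<times> G)"
        by (intro L2_set_mono) (auto simp: Y_eq norm_sum)
      also have "\<dots> \<le> (\<Sum>l\<in>\<Lambda>. L2_set (\<lambda>i. cmod (Z l i)) (E \<times> G))" by (rule L2_set_sum_le)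
      also have "\<dots> \<le> (\<Sum>l\<in>\<Lambda>. \<eta> l) * q * N"
        unfolding sum_distrib_right by (intro sum_mono Z_le)
      also have "\<dots> \<le> \<epsilon> * q * N"
      proof (intro mult_right_mono)
        have "(\<Sum>l\<in>\<Lambda>. \<eta> l) = (\<Sum>l\<in>\<Lambda> \<inter> L0. \<eta> l) + (\<Sum>l\<in>\<Lambda> - L0. \<eta> l)"
          using \<Lambda> by (rule sum.Int_Diff)
        also have "(\<Sum>l\<in>\<Lambda> \<inter> L0. \<eta> l) \<le> (\<Sum>l\<in>L0. \<eta> l)" using L0(1) by (intro sum_mono2 \<eta>0) auto
        also have "(\<Sum>l\<in>L0. \<eta> l) = 2 * \<delta> * card L0" by (simp add: \<eta>_def)
        also have "(\<Sum>l\<in>\<Lambda> - L0. \<eta> l) = 2 * sum w (\<Lambda> - L0)" by (simp add: \<eta>_def sum_distrib_left)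
        also have "sum w (\<Lambda> - L0) \<le> \<epsilon> / 4" using \<Lambda> by (intro L0(2)) auto
        finally show "(\<Sum>l\<in>\<Lambda>. \<eta> l) \<le> \<epsilon>" using \<delta>_card by simp
      qed (use q N0 in auto)
      finally show ?thesis .
    qed
    ultimately have "L2_set (\<lambda>i. cmod (X i + Y i)) (E \<times> G) \<le> D * q * N + \<epsilon> * q * N"
      by (intro order_trans[OF L2_set_norm_triangle_le] add_mono)
    moreover have "L2_set (\<lambda>i. cmod (X i + Y i)) (E \<times> G) = q * L2_set (\<lambda>k. cmod (\<Sum>m\<in>S. a k (m - k) * f m)) G"
    proof -
      have "X (p, k) + Y (p, k) = ind (k - p) * (\<Sum>m\<in>S. a k (m - k) * f m)" for p k
        by (simp add: X_def Y_def sum_distrib_left algebra_simps flip: sum.distrib)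
      then have XY: "X i + Y i = ind (snd i - fst i) * (\<Sum>m\<in>S. a (snd i) (m - snd i) * f m)" for i
        by (metis prod.collapse)
      have "(\<Sum>i\<in>E \<times> G. (cmod (X i + Y i))\<^sup>2)
          = (\<Sum>k\<in>G. \<Sum>p\<in>E. (cmod (ind (k - p)))\<^sup>2 * (cmod (\<Sum>m\<in>S. a k (m - k) * f m))\<^sup>2)"
        by (subst sum.swap) (simp add: XY sum.cartesian_product case_prod_beta norm_mult power_mult_distrib)
      also have "\<dots> = q\<^sup>2 * (\<Sum>k\<in>G. (cmod (\<Sum>m\<in>S. a k (m - k) * f m))\<^sup>2)"
        by (simp add: sum_ind sum_distrib_left flip: sum_distrib_right)
      finally show ?thesis using q(1) by (simp add: L2_set_def real_sqrt_mult)
    qed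
    ultimately have "q * L2_set (\<lambda>k. cmod (\<Sum>m\<in>S. a k (m - k) * f m)) G \<le> q * ((D + \<epsilon>) * N)"
      by (simp add: algebra_simps)
    then show ?thesis using q(1) by (simp add: N_def)
  qed
  ultimately show ?thesis using that by blast
qed

section \<open>The operator and its essential norm\<close>

text \<open>Since \<open>Abs_ell2\<close> is total, the displayed coefficients are the actual ones
  only after square-summability is known, see \<open>ell2_coeff_matrix_op\<close>.\<close>

definition matrix_op :: "(int ^ 'n::finite \<Rightarrow> int ^ 'n \<Rightarrow> complex) \<Rightarrow> (int ^ 'n) ell2 \<Rightarrow> (int ^ 'n) ell2" where
  "matrix_op a f = Abs_ell2 (\<lambda>k. \<Sum>\<^sub>\<infinity>m. a k (m - k) * ell2_coeff f m)"

section \<open>Matrices whose diagonals are dominated by a summable weight\<close>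

context
  fixes a :: "int ^ 'n::finite \<Rightarrow> int ^ 'n \<Rightarrow> complex" and w :: "int ^ 'n \<Rightarrow> real" and W :: real
  assumes w: "\<And>k l. cmod (a k l) \<le> w l" "\<And>L. finite L \<Longrightarrow> sum w L \<le> W"
begin

lemma weight_nonneg: "0 \<le> w l" "0 \<le> W"
  using order_trans[OF norm_ge_zero w(1)] w(2)[of "{}"] by auto

lemma matrix_row_summable: "(\<lambda>m. a k (m - k) * ell2_coeff f m) summable_on UNIV"
proof -
  have "(\<lambda>m. cmod (a k (m - k) * ell2_coeff f m)) summable_on UNIV"
  proof (rule nonneg_bdd_above_summable_on)
    show "bdd_above (sum (\<lambda>m. cmod (a k (m - k) * ell2_coeff f m)) ` {F. F \<subseteq> UNIV \<and> finite F})"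
    proof (rule bdd_aboveI2)
      fix S :: "(int ^ 'n) set" assume "S \<in> {F. F \<subseteq> UNIV \<and> finite F}"
      then have S: "finite S" by simp
      have "(\<Sum>m\<in>S. cmod (a k (m - k) * ell2_coeff f m)) \<le> (\<Sum>m\<in>S. w (m - k) * norm f)"
        by (intro sum_mono) (auto simp: norm_mult intro!: mult_mono w ell2_coeff_le_norm weight_nonneg)
      also have "\<dots> = sum w ((\<lambda>m. m - k) ` S) * norm f"
        by (subst sum.reindex) (simp_all add: sum_distrib_right inj_on_def)
      also have "\<dots> \<le> W * norm f" using S by (intro mult_right_mono w) auto
      finally show "(\<Sum>m\<in>S. cmod (a k (m - k) * ell2_coeff f m)) \<le> W * norm f" .
    qed
  qed simp
  then show ?thesis by (rule abs_summable_summable)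
qed

text \<open>A Young-type inequality: the \<open>l\<close>-th diagonal is a weighted shift of norm at
  most \<open>w l\<close>, and these norms add up to at most \<open>W\<close>.\<close>

lemma matrix_finite_norm_le:
  assumes S: "finite S" and G: "finite G"
  shows "L2_set (\<lambda>k. cmod (\<Sum>m\<in>S. a k (m - k) * f m)) G \<le> W * L2_set (\<lambda>m. cmod (f m)) S"
proof -
  let ?L = "(\<lambda>(m, k). m - k) ` (S \<times> G)"
  let ?Z = "\<lambda>l k. if k + l \<in> S then a k l * f (k + l) else 0"
  have row: "(\<Sum>m\<in>S. a k (m - k) * f m) = (\<Sum>l\<in>?L. ?Z l k)" if "k \<in> G" for k
    using sum_reindex_shift[OF S G that, of "\<lambda>m. a k (m - k) * f m"] by (simp cong: if_cong)
  have Z: "L2_set (\<lambda>k. cmod (?Z l k)) G \<le> w l * L2_set (\<lambda>m. cmod (f m)) S" for l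
  proof (subst L2_set_le_iff)
    have "(\<Sum>k\<in>G. (cmod (?Z l k))\<^sup>2) = (\<Sum>k\<in>{k \<in> G. k + l \<in> S}. (cmod (a k l * f (k + l)))\<^sup>2)"
      using G by (intro sum.mono_neutral_cong_right) auto
    also have "\<dots> \<le> (\<Sum>k\<in>{k \<in> G. k + l \<in> S}. (w l * cmod (f (k + l)))\<^sup>2)"
      by (intro sum_mono power_mono) (auto simp: norm_mult intro!: mult_right_mono w)
    also have "\<dots> = (\<Sum>m\<in>(\<lambda>k. k + l) ` {k \<in> G. k + l \<in> S}. (w l * cmod (f m))\<^sup>2)"
      by (subst sum.reindex) simp_all
    also have "\<dots> \<le> (\<Sum>m\<in>S. (w l * cmod (f m))\<^sup>2)"
      using S by (intro sum_mono2) auto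
    also have "\<dots> = (w l * L2_set (\<lambda>m. cmod (f m)) S)\<^sup>2"
      by (simp add: power_mult_distrib L2_set_square sum_distrib_left)
    finally show "(\<Sum>k\<in>G. (cmod (?Z l k))\<^sup>2) \<le> (w l * L2_set (\<lambda>m. cmod (f m)) S)\<^sup>2" .
  qed (simp add: weight_nonneg)
  have "L2_set (\<lambda>k. cmod (\<Sum>m\<in>S. a k (m - k) * f m)) G \<le> L2_set (\<lambda>k. \<Sum>l\<in>?L. cmod (?Z l k)) G"
    by (intro L2_set_mono) (auto simp: row norm_sum)
  also have "\<dots> \<le> (\<Sum>l\<in>?L. L2_set (\<lambda>k. cmod (?Z l k)) G)" by (rule L2_set_sum_le)
  also have "\<dots> \<le> (\<Sum>l\<in>?L. w l * L2_set (\<lambda>m. cmod (f m)) S)" by (rule sum_mono[OF Z])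
  also have "\<dots> \<le> W * L2_set (\<lambda>m. cmod (f m)) S"
    unfolding sum_distrib_right[symmetric] using S G by (intro mult_right_mono w) auto
  finally show ?thesis .
qed

text \<open>Transfers a bound from finite sections to full rows. With \<open>F = {}\<close> it
  yields boundedness, with the set from the localisation the sharp constant.\<close>

lemma matrix_partial_norm_le:
  assumes K: "0 \<le> K" "\<And>S G f. finite S \<Longrightarrow> finite G \<Longrightarrow> S \<inter> F = {} \<Longrightarrow>
      L2_set (\<lambda>k. cmod (\<Sum>m\<in>S. a k (m - k) * f m)) G \<le> K * L2_set (\<lambda>m. cmod (f m)) S"
    and f: "\<And>m. m \<in> F \<Longrightarrow> ell2_coeff f m = 0" and G: "finite G"
  shows "(\<Sum>k\<in>G. (cmod (\<Sum>\<^sub>\<infinity>m. a k (m - k) * ell2_coeff f m))\<^sup>2) \<le> (K * norm f)\<^sup>2"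
proof (rule tendsto_upperbound)
  let ?r = "\<lambda>S k. \<Sum>m\<in>S. a k (m - k) * ell2_coeff f m"
  have lim: "((\<lambda>S. ?r S k) \<longlongrightarrow> (\<Sum>\<^sub>\<infinity>m. a k (m - k) * ell2_coeff f m)) (finite_subsets_at_top UNIV)" for k
    using has_sum_infsum[OF matrix_row_summable] by (simp add: has_sum_def)
  then show "((\<lambda>S. \<Sum>k\<in>G. (cmod (?r S k))\<^sup>2) \<longlongrightarrow> (\<Sum>k\<in>G. (cmod (\<Sum>\<^sub>\<infinity>m. a k (m - k) * ell2_coeff f m))\<^sup>2))
      (finite_subsets_at_top UNIV)"
    by (intro tendsto_intros)
  have "(\<Sum>k\<in>G. (cmod (?r S k))\<^sup>2) \<le> (K * norm f)\<^sup>2" if S: "finite S" for S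
  proof -
    have "?r S k = (\<Sum>m\<in>S - F. a k (m - k) * ell2_coeff f m)" for k
      using S f by (intro sum.mono_neutral_right) auto
    then have "L2_set (\<lambda>k. cmod (?r S k)) G \<le> K * L2_set (\<lambda>m. cmod (ell2_coeff f m)) (S - F)"
      using K(2)[of "S - F" G "ell2_coeff f"] S G by (simp add: Diff_Int_distrib2 Int_commute)
    also have "\<dots> \<le> K * norm f"
      using ell2_sum_le_norm[of "S - F" f] S by (intro mult_left_mono K(1)) (auto simp: L2_set_le_iff)
    finally show ?thesis using K(1) by (simp add: L2_set_le_iff)
  qed
  then show "\<forall>\<^sub>F S in finite_subsets_at_top UNIV. (\<Sum>k\<in>G. (cmod (?r S k))\<^sup>2) \<le> (K * norm f)\<^sup>2"
    by (intro eventually_finite_subsets_at_top_weakI)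
qed simp

lemma ell2_coeff_matrix_op: "ell2_coeff (matrix_op a f) k = (\<Sum>\<^sub>\<infinity>m. a k (m - k) * ell2_coeff f m)"
proof -
  have "ell2_coeff (matrix_op a f) = (\<lambda>k. \<Sum>\<^sub>\<infinity>m. a k (m - k) * ell2_coeff f m)"
    unfolding matrix_op_def
    by (rule ell2_coeff_Abs, rule matrix_partial_norm_le[OF weight_nonneg(2), of "{}"])
      (auto intro: matrix_finite_norm_le)
  then show ?thesis by simp
qed

lemma norm_matrix_op_le:
  assumes "0 \<le> K" "\<And>S G f. finite S \<Longrightarrow> finite G \<Longrightarrow> S \<inter> F = {} \<Longrightarrow>
      L2_set (\<lambda>k. cmod (\<Sum>m\<in>S. a k (m - k) * f m)) G \<le> K * L2_set (\<lambda>m. cmod (f m)) S"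
    and "\<And>m. m \<in> F \<Longrightarrow> ell2_coeff f m = 0"
  shows "norm (matrix_op a f) \<le> K * norm f"
  using matrix_partial_norm_le[OF assms] assms(1)
  by (intro ell2_norm_leI) (simp_all add: ell2_coeff_matrix_op)

lemma bounded_clinear_matrix_op: "bounded_clinear (matrix_op a)"
proof (rule bounded_clinearI)
  show "matrix_op a (f + g) = matrix_op a f + matrix_op a g" for f g
    using infsum_add[OF matrix_row_summable matrix_row_summable]
    by (intro ell2_eqI) (simp add: ell2_coeff_matrix_op ring_distribs)
  show "matrix_op a (c *\<^sub>C f) = c *\<^sub>C matrix_op a f" for c f
    using infsum_cmult_right'[of c "\<lambda>m. a _ (m - _) * ell2_coeff f m" UNIV]
    by (intro ell2_eqI) (simp add: ell2_coeff_matrix_op mult.left_commute)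
  show "norm (matrix_op a f) \<le> W * norm f" for f
    using norm_matrix_op_le[OF weight_nonneg(2), of "{}"] matrix_finite_norm_le by simp
qed

end

section \<open>Identification of the operator with its matrix, and the sharp bound\<close>

lemma S0_weight:
  fixes \<sigma> :: "int ^ 'n::finite \<Rightarrow> real ^ 'n \<Rightarrow> complex"
  assumes "\<sigma> \<in> S0"
  shows "\<exists>w W. (\<forall>k l. cmod (fourier_coeff (\<sigma> k) l) \<le> w l) \<and> (\<forall>L. finite L \<longrightarrow> sum w L \<le> W)"
proof -
  obtain C where C: "C \<ge> 0" "\<And>k l. cmod (fourier_coeff (\<sigma> k) l) \<le> C * lattice_weight l"
    using S0_fourier_coeff_decay[OF assms] by blast
  have bound: "(\<Sum>l\<in>L. C * lattice_weight l) \<le> C * 4 ^ CARD('n)" if "finite L" for L :: "(int ^ 'n) set"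
    using sum_lattice_weight_le[OF that] C(1) by (simp add: mult_left_mono flip: sum_distrib_left)
  show ?thesis
    by (rule exI[of _ "\<lambda>l. C * lattice_weight l"], rule exI[of _ "C * 4 ^ CARD('n)"]) (simp add: C(2) bound)
qed

text \<open>The matrix operator satisfies the description that defines \<open>Op\<close>, and
  density of finite supports makes it the only one.\<close>

lemma Op_eq_matrix_op:
  assumes \<sigma>: "\<sigma> \<in> S0"
  shows "Op \<sigma> = matrix_op (\<lambda>k l. fourier_coeff (\<sigma> k) l)" (is "_ = ?A")
proof -
  obtain w W where w: "\<And>k l. cmod (fourier_coeff (\<sigma> k) l) \<le> w l" "\<And>L. finite L \<Longrightarrow> sum w L \<le> W"
    using S0_weight[OF \<sigma>] by auto
  have A: "bounded_clinear ?A" by (rule bounded_clinear_matrix_op[OF w])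
  have coeff: "ell2_coeff (?A f) k = (\<Sum>\<^sub>\<infinity>m. fourier_coeff (\<sigma> k) (m - k) * ell2_coeff f m)" for f k
    by (rule ell2_coeff_matrix_op[OF w])
  have formula: "ell2_coeff (?A f) = Op_formula \<sigma> (ell2_coeff f)" if fin: "finite {k. ell2_coeff f k \<noteq> 0}" for f
  proof
    fix k
    have "ell2_coeff (?A f) k = (\<Sum>\<^sub>\<infinity>m\<in>{m. ell2_coeff f m \<noteq> 0}. fourier_coeff (\<sigma> k) (m - k) * ell2_coeff f m)"
      unfolding coeff by (rule infsum_cong_neutral) auto
    also have "\<dots> = Op_formula \<sigma> (ell2_coeff f) k"
      using fin Op_formula_finite_support[where \<sigma> = \<sigma> and k = k, OF smooth_torusD(2)[OF S0_smooth[OF \<sigma>]] fin] by simp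
    finally show "ell2_coeff (?A f) k = Op_formula \<sigma> (ell2_coeff f) k" .
  qed
  show ?thesis unfolding Op_def
  proof (rule the_equality)
    fix B assume "bounded_clinear B \<and> (\<forall>f. finite {k. ell2_coeff f k \<noteq> 0} \<longrightarrow>
        ell2_coeff (B f) = Op_formula \<sigma> (ell2_coeff f))"
    then show "B = ?A" using formula by (intro bounded_clinear_eqI A) (auto simp flip: ell2_coeff_inject)
  qed (use A formula in blast)
qed

lemma bounded_clinear_Op: "\<sigma> \<in> S0 \<Longrightarrow> bounded_clinear (Op \<sigma>)"
  using S0_weight[of \<sigma>] bounded_clinear_matrix_op[of "\<lambda>k l. fourier_coeff (\<sigma> k) l"]
  by (metis Op_eq_matrix_op)

lemma ell2_coeff_Op_unit:
  assumes \<sigma>: "\<sigma> \<in> S0"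
  shows "ell2_coeff (Op \<sigma> (unit_ell2 m)) k = fourier_coeff (\<sigma> k) (m - k)"
proof -
  obtain w W where w: "\<And>k l. cmod (fourier_coeff (\<sigma> k) l) \<le> w l" "\<And>L. finite L \<Longrightarrow> sum w L \<le> W"
    using S0_weight[OF \<sigma>] by auto
  have "ell2_coeff (Op \<sigma> (unit_ell2 m)) k
      = (\<Sum>\<^sub>\<infinity>i. fourier_coeff (\<sigma> k) (i - k) * ell2_coeff (unit_ell2 m) i)"
    unfolding Op_eq_matrix_op[OF \<sigma>] by (rule ell2_coeff_matrix_op[OF w])
  also have "\<dots> = (\<Sum>\<^sub>\<infinity>i\<in>{m}. fourier_coeff (\<sigma> k) (i - k) * ell2_coeff (unit_ell2 m) i)"
    by (rule infsum_cong_neutral) auto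
  finally show ?thesis by simp
qed

lemma Op_norm_le_off_finite:
  fixes \<sigma> :: "int ^ 'n::finite \<Rightarrow> real ^ 'n \<Rightarrow> complex"
  assumes \<sigma>: "\<sigma> \<in> S0" and D: "0 \<le> D" "\<forall>\<^sub>F k in cofinite. \<forall>x. cmod (\<sigma> k x) \<le> D" and \<epsilon>: "0 < \<epsilon>"
  obtains F where "finite F"
    "\<And>f. (\<And>m. m \<in> F \<Longrightarrow> ell2_coeff f m = 0) \<Longrightarrow> norm (Op \<sigma> f) \<le> (D + \<epsilon>) * norm f"
proof -
  obtain w W where w: "\<And>k l. cmod (fourier_coeff (\<sigma> k) l) \<le> w l" "\<And>L. finite L \<Longrightarrow> sum w L \<le> W"
    using S0_weight[OF \<sigma>] by auto
  have "\<forall>\<^sub>F p in cofinite. \<forall>S G c. finite S \<longrightarrow> finite G \<longrightarrow>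
      (\<Sum>k\<in>G. (cmod (\<Sum>m\<in>S. fourier_coeff (\<sigma> p) (m - k) * c m))\<^sup>2) \<le> D\<^sup>2 * (\<Sum>m\<in>S. (cmod (c m))\<^sup>2)"
    using D(2) by eventually_elim
      (use sum_norm_sq_convolution_le[OF smooth_torusD(2)[OF S0_smooth[OF \<sigma>]]] in blast)
  then obtain F where F: "finite F"
    "\<And>S G f. finite S \<Longrightarrow> finite G \<Longrightarrow> S \<inter> F = {} \<Longrightarrow>
      L2_set (\<lambda>k. cmod (\<Sum>m\<in>S. fourier_coeff (\<sigma> k) (m - k) * f m)) G \<le> (D + \<epsilon>) * L2_set (\<lambda>m. cmod (f m)) S"
    using slowly_varying_matrix_norm_bound[of "\<lambda>k l. fourier_coeff (\<sigma> k) l" w W D \<epsilon>, OF w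
        S0_fourier_coeff_slowly_varying[OF \<sigma>] _ D(1) \<epsilon>]
    unfolding eventually_cofinite by blast
  have "norm (Op \<sigma> f) \<le> (D + \<epsilon>) * norm f" if "\<And>m. m \<in> F \<Longrightarrow> ell2_coeff f m = 0" for f
    unfolding Op_eq_matrix_op[OF \<sigma>]
    by (rule norm_matrix_op_le[OF w _ F(2)]) (use D \<epsilon> that in auto)
  then show ?thesis using that F(1) by blast
qed

section \<open>Compactness of operators\<close>

lemma restrict_ell2_in_compact:
  assumes "finite F"
  obtains K where "compact K" "\<And>f. norm f \<le> R \<Longrightarrow> restrict_ell2 F f \<in> K"
proof -
  have "\<exists>K. compact K \<and> (\<forall>f. norm f \<le> R \<longrightarrow> restrict_ell2 F f \<in> K)"
    using assms
  proof (induction F)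
    case empty
    have "restrict_ell2 {} f = 0" for f :: "'a ell2" by (rule ell2_eqI) simp
    then show ?case by (intro exI[of _ "{0}"]) simp
  next
    case (insert m F)
    then obtain K where K: "compact K" "\<And>f. norm f \<le> R \<Longrightarrow> restrict_ell2 F f \<in> K" by blast
    \<comment> \<open>Each new coordinate adds the image of a closed disc, and the sum of two
      compact sets is compact.\<close>
    have "bounded_linear (\<lambda>c. c *\<^sub>C unit_ell2 m)"
      by (rule bounded_linear_intro[where K = "norm (unit_ell2 m)"])
        (auto simp: ell2.scale_left_distrib scaleR_eq_scaleC scaleR_conv_of_real)
    then have "compact ((\<lambda>c. c *\<^sub>C unit_ell2 m) ` cball 0 R)"
      by (rule compact_continuous_image[OF linear_continuous_on compact_cball])
    then have "compact {x + y |x y. x \<in> K \<and> y \<in> (\<lambda>c. c *\<^sub>C unit_ell2 m) ` cball 0 R}"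
      by (rule compact_sums[OF K(1)])
    moreover have "restrict_ell2 (insert m F) f \<in> {x + y |x y. x \<in> K \<and> y \<in> (\<lambda>c. c *\<^sub>C unit_ell2 m) ` cball 0 R}"
      if f: "norm f \<le> R" for f
    proof -
      have "restrict_ell2 (insert m F) f = restrict_ell2 F f + ell2_coeff f m *\<^sub>C unit_ell2 m"
        using insert.hyps by (intro ell2_eqI) auto
      moreover have "ell2_coeff f m \<in> cball 0 R" using ell2_coeff_le_norm[of f m] f by simp
      ultimately show ?thesis using K(2)[OF f] by blast
    qed
    ultimately show ?case by blast
  qed
  then show ?thesis using that by blast
qed

lemma restrict_ell2_Compl: "f - restrict_ell2 F f = restrict_ell2 (- F) f"
  by (rule ell2_eqI) simp

text \<open>On a bounded set \<open>A\<close> is uniformly close to \<open>A\<close> composed with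
  the restriction to a finite set, which has values in a compact set; so the image is totally
  bounded.\<close>

lemma compact_operatorI_finite_tails:
  assumes A: "bounded_clinear A"
    and tails: "\<And>e. 0 < e \<Longrightarrow> \<exists>F. finite F \<and> (\<forall>f. (\<forall>m\<in>F. ell2_coeff f m = 0) \<longrightarrow> norm (A f) \<le> e * norm f)"
  shows "compact_operator A"
  unfolding compact_operator_def
proof (intro conjI A allI impI)
  interpret A: Vector_Spaces.linear "(*\<^sub>C)" "(*\<^sub>C)" A by (rule bounded_clinear_linear[OF A])
  fix S :: "'a ell2 set" assume "bounded S"
  then obtain R where R: "0 < R" "\<And>f. f \<in> S \<Longrightarrow> norm f \<le> R" by (auto simp: bounded_pos)
  show "compact (closure (A ` S))"
    unfolding compact_eq_totally_bounded
  proof (intro conjI allI impI)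
    show "complete (closure (A ` S))" by (simp add: complete_eq_closed)
    fix e :: real assume e: "0 < e"
    obtain F where F: "finite F" "\<And>f. (\<forall>m\<in>F. ell2_coeff f m = 0) \<Longrightarrow> norm (A f) \<le> e / (4 * R) * norm f"
      using tails[of "e / (4 * R)"] e R(1) by auto
    obtain K where K: "compact K" "\<And>f. norm f \<le> R \<Longrightarrow> restrict_ell2 F f \<in> K"
      using restrict_ell2_in_compact[OF F(1)] by blast
    have "compact (A ` K)"
      using A by (intro compact_continuous_image[OF linear_continuous_on K(1)]) (simp add: bounded_clinear_def)
    then obtain T where T: "finite T" "A ` K \<subseteq> (\<Union>x\<in>T. ball x (e / 4))"
      using e unfolding compact_eq_totally_bounded by (metis zero_less_divide_iff zero_less_numeral)
    \<comment> \<open>Closed balls, so that the finite cover survives taking the closure.\<close>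
    have "A ` S \<subseteq> (\<Union>x\<in>T. cball x (e / 2))"
    proof
      fix g assume "g \<in> A ` S"
      then obtain f where f: "f \<in> S" "g = A f" by blast
      then have "A (restrict_ell2 F f) \<in> A ` K" using K(2) R(2) by blast
      then obtain x where x: "x \<in> T" "dist x (A (restrict_ell2 F f)) < e / 4" using T(2) by auto
      have "dist (A (restrict_ell2 F f)) g = norm (A f - A (restrict_ell2 F f))"
        by (simp add: f(2) dist_norm norm_minus_commute)
      also have "\<dots> = norm (A (restrict_ell2 (- F) f))"
        by (simp only: A.diff[symmetric] restrict_ell2_Compl)
      also have "\<dots> \<le> e / (4 * R) * norm (restrict_ell2 (- F) f)" by (rule F(2)) simp
      also have "\<dots> \<le> e / (4 * R) * R"
        using e R(1) by (intro mult_left_mono order_trans[OF norm_restrict_ell2_le R(2)] f) auto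
      finally have "dist (A (restrict_ell2 F f)) g \<le> e / 4" using R(1) by simp
      then have "dist x g \<le> e / 2"
        using x(2) dist_triangle[of x g "A (restrict_ell2 F f)"] by simp
      then show "g \<in> (\<Union>x\<in>T. cball x (e / 2))" using x(1) by auto
    qed
    then have "closure (A ` S) \<subseteq> (\<Union>x\<in>T. cball x (e / 2))"
      by (rule closure_minimal) (use T(1) in auto)
    also have "\<dots> \<subseteq> (\<Union>x\<in>T. ball x e)" using e by force
    finally show "\<exists>T. finite T \<and> closure (A ` S) \<subseteq> (\<Union>x\<in>T. ball x e)" using T(1) by blast
  qed
qed

lemma finite_ell2_coeff_ge:
  assumes "0 < c"
  shows "finite {k. c \<le> cmod (ell2_coeff g k)}"
proof (rule ccontr)
  assume "infinite {k. c \<le> cmod (ell2_coeff g k)}"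
  obtain n :: nat where n: "(norm g)\<^sup>2 / c\<^sup>2 < n" using reals_Archimedean2 by blast
  obtain B where B: "B \<subseteq> {k. c \<le> cmod (ell2_coeff g k)}" "finite B" "card B = n"
    using infinite_arbitrarily_large[OF \<open>infinite _\<close>] by blast
  have "n * c\<^sup>2 = (\<Sum>k\<in>B. c\<^sup>2)" by (simp add: B)
  also have "\<dots> \<le> (\<Sum>k\<in>B. (cmod (ell2_coeff g k))\<^sup>2)"
    using B(1) assms by (intro sum_mono power_mono) auto
  also have "\<dots> \<le> (norm g)\<^sup>2" by (rule ell2_sum_le_norm[OF B(2)])
  finally show False using n assms by (simp add: field_simps)
qed

text \<open>The images of the unit vectors have a finite net of mesh \<open>e / 2\<close>. If the
  \<open>k\<close>-th coefficient of an image is at least \<open>e\<close>, that of a nearby net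
  point is at least \<open>e / 2\<close>, and each net point admits only finitely many such
  \<open>k\<close>. Applied with \<open>g k = k + l\<close>.\<close>

lemma compact_operator_diagonal_vanishes:
  fixes A :: "'a ell2 \<Rightarrow> 'a ell2" and g :: "'a \<Rightarrow> 'a"
  assumes A: "compact_operator A" and e: "0 < e"
  shows "finite {k. e \<le> cmod (ell2_coeff (A (unit_ell2 (g k))) k)}"
proof -
  let ?S = "range unit_ell2 :: 'a ell2 set"
  have "bounded ?S" unfolding bounded_iff by (intro exI[of _ 1]) (auto simp: norm_unit_ell2)
  then have "compact (closure (A ` ?S))" using A by (simp add: compact_operator_def)
  then obtain T where T: "finite T" "closure (A ` ?S) \<subseteq> (\<Union>x\<in>T. ball x (e / 2))"
    using half_gt_zero[OF e] unfolding compact_eq_totally_bounded by blast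
  have "{k. e \<le> cmod (ell2_coeff (A (unit_ell2 (g k))) k)} \<subseteq> (\<Union>x\<in>T. {k. e / 2 \<le> cmod (ell2_coeff x k)})"
  proof
    fix k assume k: "k \<in> {k. e \<le> cmod (ell2_coeff (A (unit_ell2 (g k))) k)}"
    have "A (unit_ell2 (g k)) \<in> closure (A ` ?S)"
      by (intro subsetD[OF closure_subset] imageI rangeI)
    then obtain x where x: "x \<in> T" "dist x (A (unit_ell2 (g k))) < e / 2" using T(2) by auto
    have "cmod (ell2_coeff (A (unit_ell2 (g k))) k) \<le> cmod (ell2_coeff x k) + cmod (ell2_coeff (A (unit_ell2 (g k)) - x) k)"
      using norm_triangle_ineq[of "ell2_coeff x k" "ell2_coeff (A (unit_ell2 (g k)) - x) k"] by simp
    also have "cmod (ell2_coeff (A (unit_ell2 (g k)) - x) k) \<le> e / 2"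
      using x(2) ell2_coeff_le_norm[of "A (unit_ell2 (g k)) - x" k] by (simp add: dist_norm norm_minus_commute)
    finally have "e / 2 \<le> cmod (ell2_coeff x k)" using k by simp
    then show "k \<in> (\<Union>x\<in>T. {k. e / 2 \<le> cmod (ell2_coeff x k)})" using x(1) by blast
  qed
  then show ?thesis
    by (rule finite_subset) (intro finite_UN_I T(1) finite_ell2_coeff_ge half_gt_zero e)
qed

text \<open>Finitely many diagonals are small far out by compactness, and the remaining ones have a
  small sum uniformly in \<open>k\<close>.\<close>

lemma symbol_vanishes_if_compact_Op:
  fixes \<sigma> :: "int ^ 'n::finite \<Rightarrow> real ^ 'n \<Rightarrow> complex"
  assumes \<sigma>: "\<sigma> \<in> S0" and comp: "compact_operator (Op \<sigma>)" and e: "0 < e"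
  shows "\<forall>\<^sub>F k in cofinite. \<forall>x. cmod (\<sigma> k x) \<le> e"
proof -
  obtain w W where w: "\<And>k l. cmod (fourier_coeff (\<sigma> k) l) \<le> w l" "\<And>L. finite L \<Longrightarrow> sum w L \<le> W"
    using S0_weight[OF \<sigma>] by auto
  have w0: "0 \<le> w l" for l using order_trans[OF norm_ge_zero w(1)] .
  obtain L0 where L0: "finite L0" "\<And>L. finite L \<Longrightarrow> L \<inter> L0 = {} \<Longrightarrow> sum w L \<le> e / 2"
    using tail_sum_small[OF w0 w(2), of "e / 2"] e by auto
  define \<delta> where "\<delta> = e / (2 * (real (card L0) + 1))"
  have \<delta>: "0 < \<delta>" "\<delta> * card L0 \<le> e / 2" using e by (auto simp: \<delta>_def field_simps)
  have "\<forall>\<^sub>F k in cofinite. \<forall>l\<in>L0. cmod (fourier_coeff (\<sigma> k) l) < \<delta>"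
  proof (intro eventually_ball_finite ballI L0(1))
    fix l
    have "finite {k. \<delta> \<le> cmod (ell2_coeff (Op \<sigma> (unit_ell2 (k + l))) k)}"
      by (rule compact_operator_diagonal_vanishes[OF comp \<delta>(1)])
    then show "\<forall>\<^sub>F k in cofinite. cmod (fourier_coeff (\<sigma> k) l) < \<delta>"
      by (simp add: eventually_cofinite ell2_coeff_Op_unit[OF \<sigma>] not_less)
  qed
  then show ?thesis
  proof eventually_elim
    case (elim k)
    have g: "torus_fun (\<sigma> k)" "continuous_on UNIV (\<sigma> k)"
      using smooth_torusD(1,2)[OF S0_smooth[OF \<sigma>]] by auto
    have "(\<Sum>l\<in>S. cmod (fourier_coeff (\<sigma> k) l)) \<le> e" if S: "finite S" for S
    proof -
      have "(\<Sum>l\<in>S. cmod (fourier_coeff (\<sigma> k) l)) =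
          (\<Sum>l\<in>S \<inter> L0. cmod (fourier_coeff (\<sigma> k) l)) + (\<Sum>l\<in>S - L0. cmod (fourier_coeff (\<sigma> k) l))"
        by (rule sum.Int_Diff[OF S])
      also have "(\<Sum>l\<in>S \<inter> L0. cmod (fourier_coeff (\<sigma> k) l)) \<le> (\<Sum>l\<in>L0. cmod (fourier_coeff (\<sigma> k) l))"
        by (rule sum_mono2[OF L0(1)]) auto
      also have "\<dots> \<le> (\<Sum>l\<in>L0. \<delta>)" using elim by (intro sum_mono) (auto intro: less_imp_le)
      also have "\<dots> \<le> e / 2" using \<delta>(2) by (simp add: mult.commute)
      also have "(\<Sum>l\<in>S - L0. cmod (fourier_coeff (\<sigma> k) l)) \<le> sum w (S - L0)" by (intro sum_mono w)
      also have "\<dots> \<le> e / 2" using S by (intro L0(2)) auto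
      finally show ?thesis by simp
    qed
    then show ?case using norm_le_sum_fourier_coeff[OF g] by blast
  qed
qed

section \<open>The limit superior of the symbol and the conclusions\<close>

lemma limsup_symbol_eq:
  "limsup_symbol \<sigma> = Limsup cofinite (\<lambda>k. SUP x. ereal (cmod (\<sigma> k x)))"
  unfolding limsup_symbol_def filtercomap_norm_of_lattice ..

lemma limsup_symbol_nonneg: "0 \<le> limsup_symbol \<sigma>"
  unfolding limsup_symbol_eq
proof (rule le_Limsup)
  show "\<forall>\<^sub>F k in cofinite. 0 \<le> (SUP x. ereal (cmod (\<sigma> k x)))"
    by (intro always_eventually allI SUP_upper2[where i = undefined]) auto
qed (simp add: infinite_UNIV_lattice)

lemma limsup_symbol_le:
  "\<forall>\<^sub>F k in cofinite. \<forall>x. cmod (\<sigma> k x) \<le> D \<Longrightarrow> limsup_symbol \<sigma> \<le> ereal D"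
  unfolding limsup_symbol_eq by (rule Limsup_bounded, erule eventually_mono) (auto intro: SUP_least)

lemma eventually_symbol_le:
  assumes "limsup_symbol \<sigma> < ereal D"
  shows "\<forall>\<^sub>F k in cofinite. \<forall>x. cmod (\<sigma> k x) \<le> D"
  using Limsup_lessD[OF assms[unfolded limsup_symbol_eq]]
proof eventually_elim
  case (elim k)
  have "ereal (cmod (\<sigma> k x)) \<le> ereal D" for x
    by (rule order_trans[OF SUP_upper less_imp_le[OF elim]]) simp
  then show ?case by simp
qed

lemma compact_Op_iff:
  assumes \<sigma>: "\<sigma> \<in> S0"
  shows "compact_operator (Op \<sigma>) \<longleftrightarrow> limsup_symbol \<sigma> = 0"
proof
  assume "compact_operator (Op \<sigma>)"
  then have "limsup_symbol \<sigma> \<le> 0 + ereal e" if "0 < e" for e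
    using limsup_symbol_le[OF symbol_vanishes_if_compact_Op[OF \<sigma> _ that]] by simp
  then have "limsup_symbol \<sigma> \<le> 0" by (rule ereal_le_epsilon2)
  then show "limsup_symbol \<sigma> = 0" using limsup_symbol_nonneg by (rule antisym)
next
  assume d: "limsup_symbol \<sigma> = 0"
  show "compact_operator (Op \<sigma>)"
  proof (rule compact_operatorI_finite_tails[OF bounded_clinear_Op[OF \<sigma>]])
    fix e :: real assume e: "0 < e"
    \<comment> \<open>One half of \<open>e\<close> bounds the symbol, the other absorbs the loss in
      the localisation.\<close>
    have "\<forall>\<^sub>F k in cofinite. \<forall>x. cmod (\<sigma> k x) \<le> e / 2" using d e by (intro eventually_symbol_le) simp
    then obtain F where "finite F"
      "\<And>f. (\<And>m. m \<in> F \<Longrightarrow> ell2_coeff f m = 0) \<Longrightarrow> norm (Op \<sigma> f) \<le> (e / 2 + e / 2) * norm f"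
      using Op_norm_le_off_finite[OF \<sigma>, of "e / 2" "e / 2"] e by auto
    then show "\<exists>F. finite F \<and> (\<forall>f. (\<forall>m\<in>F. ell2_coeff f m = 0) \<longrightarrow> norm (Op \<sigma> f) \<le> e * norm f)"
      by auto
  qed
qed

lemma essential_spectrum_Op_subset:
  assumes \<sigma>: "\<sigma> \<in> S0"
  shows "essential_spectrum (Op \<sigma>) \<subseteq> {z. ereal (cmod z) \<le> limsup_symbol \<sigma>}"
proof
  fix z assume z: "z \<in> essential_spectrum (Op \<sigma>)"
  show "z \<in> {z. ereal (cmod z) \<le> limsup_symbol \<sigma>}"
  proof (rule ccontr)
    assume "z \<notin> {z. ereal (cmod z) \<le> limsup_symbol \<sigma>}"
    then obtain r where r: "limsup_symbol \<sigma> < ereal r" "ereal r < ereal (cmod z)"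
      using ereal_dense2[of "limsup_symbol \<sigma>" "ereal (cmod z)"] by (metis mem_Collect_eq not_le)
    have "0 \<le> r" using order_le_less_trans[OF limsup_symbol_nonneg r(1)] by simp
    then obtain F where F: "finite F"
      "\<And>f. (\<And>m. m \<in> F \<Longrightarrow> ell2_coeff f m = 0) \<Longrightarrow> norm (Op \<sigma> f) \<le> (r + (cmod z - r) / 2) * norm f"
      using Op_norm_le_off_finite[OF \<sigma> _ eventually_symbol_le[OF r(1)], of "(cmod z - r) / 2"] r(2) by auto
    \<comment> \<open>Half of the gap between \<open>r\<close> and \<open>cmod z\<close> is spent on
      the localisation, so the norm bound remains strictly below \<open>cmod z\<close>.\<close>
    define K where "K = r + (cmod z - r) / 2"
    have K: "0 \<le> K" "K < cmod z" using \<open>0 \<le> r\<close> r(2) by (auto simp: K_def field_simps)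
    note Op = bounded_clinear_Op[OF \<sigma>]
    interpret Op: Vector_Spaces.linear "(*\<^sub>C)" "(*\<^sub>C)" "Op \<sigma>" by (rule bounded_clinear_linear[OF Op])
    define T where "T f = Op \<sigma> (restrict_ell2 (- F) f)" for f
    define R where "R f = Op \<sigma> (restrict_ell2 F f)" for f
    have T: "bounded_clinear T" and R: "bounded_clinear R"
      unfolding T_def R_def by (rule bounded_clinear_compose[OF Op bounded_clinear_restrict])+
    have T_le: "norm (T f) \<le> K * norm f" for f
    proof -
      have "norm (T f) \<le> K * norm (restrict_ell2 (- F) f)" unfolding T_def K_def by (rule F(2)) simp
      also have "\<dots> \<le> K * norm f" by (intro mult_left_mono norm_restrict_ell2_le K)
      finally show ?thesis .
    qed
    obtain B' where B': "bounded_clinear B'" "\<And>f. T (B' f) - z *\<^sub>C B' f = f" "\<And>f. B' (T f - z *\<^sub>C f) = f"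
      using bijective_bounded_perturbation_of_scalar[OF T T_le K] by blast
    have "R f \<in> ell2.span ((\<lambda>k. Op \<sigma> (unit_ell2 k)) ` F)" for f
      unfolding R_def restrict_ell2_finite[OF F(1)] Op.sum Op.scale
      by (intro ell2.span_sum ell2.span_scale ell2.span_base) auto
    then have fin: "finite_dim (range R)" unfolding finite_dim_def using F(1) by blast
    have B: "bounded_clinear (\<lambda>f. T f - z *\<^sub>C f)" by (intro bounded_clinear_diff T bounded_clinear_scaleC)
    have "Op \<sigma> f - z *\<^sub>C f = (T f - z *\<^sub>C f) + R f" for f
    proof -
      have "Op \<sigma> f = T f + R f"
        by (simp add: T_def R_def flip: Op.add restrict_ell2_Compl)
      then show ?thesis by simp
    qed
    then have eq: "(\<lambda>f. Op \<sigma> f - z *\<^sub>C f) = (\<lambda>f. (T f - z *\<^sub>C f) + R f)" by (rule ext)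
    show False
      using z fredholm_index_zero_invertible_plus_finite_rank[OF B B' R fin]
      by (simp add: essential_spectrum_def flip: eq)
  qed
qed

theorem corollary5p3:
  fixes \<sigma> :: "int ^ 'n::finite \<Rightarrow> real ^ 'n \<Rightarrow> complex" and d :: ereal
  assumes "\<sigma> \<in> S0"
    and "d = limsup_symbol \<sigma>"
  shows "(compact_operator (Op \<sigma>) \<longleftrightarrow> d = 0) \<and>
    essential_spectrum (Op \<sigma>) \<subseteq> {z. ereal (cmod z) \<le> d}"
  using compact_Op_iff[OF assms(1)] essential_spectrum_Op_subset[OF assms(1)] assms(2) by simp

end
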